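(* In the group $F_2$, Whitehead's algorithm (deciding, for two given elements $u, v \in F_2$, whether there is $\phi \in \mathrm{Aut}(F_2)$ with $\phi(u) = v$) terminates in polynomial time with respect to $\max(|u|,|v|)$, the maximum length of the two words in question.
   Context: $F_2$ is the free group of rank 2 with fixed free basis $X=\{x_1,x_2\}$; elements are given as reduced words in $X^{\pm 1}$ and $|u|$ denotes reduced word length. An elementary Whitehead automorphism is either (i) an automorphism permuting the set $X^{\pm1}$, or (ii) an automorphism for which there is a fixed letter $a \in X^{\pm 1}$ with $a \mapsto a$ and every basis element $x \in X$ with $x \neq a^{\pm1}$ mapped to one of $x,\ xa,\ a^{-1}x,\ a^{-1}xa$. There are finitely many of them. Whitehead's algorithm, in the form considered here, on input $u,v$: First part: as long as some elementary Whitehead automorphism strictly decreases the length of the current word, apply such an automorphism; do this starting from $u$ and starting from $v$, obtaining words $u'$ and $v'$ of minimum possible length in their automorphic orbits. If $|u'| \ne |v'|$, answer "no". Second part (if $|u'|=|v'|$): starting from $u'$, build by backtracking (depth-first) search a tree of words: at the current word, apply the elementary Whitehead automorphisms until one of them yields a word of length $|u'|$ different from all words obtained so far; if there is one, record it, connect it to the current word, and make it the current word; if there is none, return to the preceding word in the tree. Stop when no new word can be obtained from any recorded word. Answer "yes" if and only if $v'$ is among the recorded words. *)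

theory Defs
  imports "HOL-Algebra.Bij" "HOL-Computational_Algebra.Polynomial"
begin

section \<open>The free group of rank 2\<close>

datatype gen = X1 | X2

text \<open>The letter \<open>(x, True)\<close> is the basis element \<open>x\<close>, and \<open>(x, False)\<close> is its inverse.\<close>

type_synonym letter = "gen \<times> bool"
type_synonym word = "letter list"

definition inv_letter :: "letter \<Rightarrow> letter" where
  "inv_letter a = (fst a, \<not> snd a)"

definition reduced :: "word \<Rightarrow> bool" where
  "reduced w \<longleftrightarrow> successively (\<lambda>a b. b \<noteq> inv_letter a) w"

fun push :: "letter \<Rightarrow> word \<Rightarrow> word" where
  "push a [] = [a]"
| "push a (b # w) = (if b = inv_letter a then w else a # b # w)"

definition free_reduce :: "word \<Rightarrow> word" where
  "free_reduce w = foldr push w []"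

definition F2 :: "word monoid" where
  "F2 = \<lparr>carrier = {w. reduced w}, monoid.mult = (\<lambda>u v. free_reduce (u @ v)), one = []\<rparr>"


section \<open>Elementary Whitehead automorphisms\<close>

text \<open>
  \<open>auto F2\<close> is the set of automorphisms of \<open>F2\<close>. In the second clause, \<open>x\<close> is the basis
  element different from \<open>a\<close> and its inverse; the four listed words are then reduced, so that
  they are the products \<open>x\<close>, \<open>x a\<close>, \<open>a\<^sup>-\<^sup>1 x\<close>, \<open>a\<^sup>-\<^sup>1 x a\<close> in \<open>F2\<close>.
\<close>

definition whitehead_autos :: "(word \<Rightarrow> word) set" where
  "whitehead_autos = {\<phi> \<in> auto F2.
     \<phi> ` {[a] | a. True} = {[a] | a. True} \<or>
     (\<exists>a. \<phi> [a] = [a] \<and>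
        (\<forall>x. x \<noteq> fst a \<longrightarrow>
           \<phi> [(x, True)] \<in>
             {[(x, True)], [(x, True), a], [inv_letter a, (x, True)],
              [inv_letter a, (x, True), a]}))}"


section \<open>Cost model\<close>

text \<open>
  A timed value is a result together with the number of basic operations spent on it.
  Every call of one of the list functions below is charged one unit; what a call does
  besides further calls is of bounded size: comparing or inverting a letter, taking a list
  cell apart or building one (sharing its tail), and looking up the image of a letter
  under an elementary Whitehead automorphism. These images are words of length at most 3,
  and the automorphisms are used in the computations only through this finite table.
  Lengths are compared without arithmetic, by running along both words.
\<close>

type_synonym 'a timed = "'a \<times> nat"

definition ret :: "'a \<Rightarrow> 'a timed" where
  "ret x = (x, 0)"

definition tick :: "'a timed \<Rightarrow> 'a timed" where
  "tick m = (fst m, Suc (snd m))"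

definition bindT :: "'a timed \<Rightarrow> ('a \<Rightarrow> 'b timed) \<Rightarrow> 'b timed"
    (infixl \<open>\<bind>\<close> 54) where
  "m \<bind> f = (fst (f (fst m)), snd m + snd (f (fst m)))"

primrec prepend_t :: "word \<Rightarrow> word \<Rightarrow> word timed" where
  "prepend_t [] v = tick (ret v)"
| "prepend_t (a # u) v = tick (prepend_t u v \<bind> (\<lambda>z. tick (ret (push a z))))"

primrec apply_t :: "(word \<Rightarrow> word) \<Rightarrow> word \<Rightarrow> word timed" where
  "apply_t \<phi> [] = tick (ret [])"
| "apply_t \<phi> (a # w) = tick (apply_t \<phi> w \<bind> (\<lambda>v. prepend_t (\<phi> [a]) v))"

fun shorter_t :: "word \<Rightarrow> word \<Rightarrow> bool timed" where
  "shorter_t u [] = tick (ret False)"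
| "shorter_t [] (b # v) = tick (ret True)"
| "shorter_t (a # u) (b # v) = tick (shorter_t u v)"

fun same_length_t :: "word \<Rightarrow> word \<Rightarrow> bool timed" where
  "same_length_t [] [] = tick (ret True)"
| "same_length_t [] (b # v) = tick (ret False)"
| "same_length_t (a # u) [] = tick (ret False)"
| "same_length_t (a # u) (b # v) = tick (same_length_t u v)"

fun equal_t :: "word \<Rightarrow> word \<Rightarrow> bool timed" where
  "equal_t [] [] = tick (ret True)"
| "equal_t [] (b # v) = tick (ret False)"
| "equal_t (a # u) [] = tick (ret False)"
| "equal_t (a # u) (b # v) = tick (if a = b then equal_t u v else ret False)"

text \<open>
  The search tree is the list of its nodes, most recent first: each recorded word with the
  word it is connected to, i.e. the preceding word in the tree (\<open>None\<close> at the root).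
\<close>

type_synonym tree = "(word \<times> word option) list"

primrec recorded_t :: "word \<Rightarrow> tree \<Rightarrow> bool timed" where
  "recorded_t w [] = tick (ret False)"
| "recorded_t w (e # T) =
     tick (equal_t w (fst e) \<bind> (\<lambda>b. if b then ret True else recorded_t w T))"

primrec preceding_t :: "word \<Rightarrow> tree \<Rightarrow> word option timed" where
  "preceding_t w [] = tick (ret None)"
| "preceding_t w (e # T) =
     tick (equal_t w (fst e) \<bind> (\<lambda>b. if b then ret (snd e) else preceding_t w T))"


section \<open>Whitehead's algorithm\<close>

text \<open>
  \<open>find_shorter_t \<phi>s w\<close> tries the automorphisms \<open>\<phi>s\<close> in turn, until one of them shortens \<open>w\<close>;
  \<open>find_new_t \<phi>s u T w\<close> tries them in turn, until one of them takes \<open>w\<close> to a word that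
  has the length of \<open>u\<close> and is not recorded in \<open>T\<close>.
\<close>

primrec find_shorter_t :: "(word \<Rightarrow> word) list \<Rightarrow> word \<Rightarrow> word option timed" where
  "find_shorter_t [] w = tick (ret None)"
| "find_shorter_t (\<phi> # \<phi>s) w =
     tick (apply_t \<phi> w \<bind> (\<lambda>w'. shorter_t w' w \<bind> (\<lambda>b.
       if b then ret (Some w') else find_shorter_t \<phi>s w)))"

primrec find_new_t ::
    "(word \<Rightarrow> word) list \<Rightarrow> word \<Rightarrow> tree \<Rightarrow> word \<Rightarrow> word option timed" where
  "find_new_t [] u T w = tick (ret None)"
| "find_new_t (\<phi> # \<phi>s) u T w =
     tick (apply_t \<phi> w \<bind> (\<lambda>w'. same_length_t w' u \<bind> (\<lambda>b.
       if b then recorded_t w' T \<bind> (\<lambda>r.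
         if r then find_new_t \<phi>s u T w else ret (Some w'))
       else find_new_t \<phi>s u T w)))"

text \<open>
  \<open>MinimizeU u v\<close> and \<open>MinimizeV u' v\<close> are the two halves of the first part, with current
  word \<open>u\<close> and \<open>v\<close> respectively. In \<open>Search u' v' T w\<close>, the tree built so far is \<open>T\<close> and the
  current word is \<open>w\<close>.
\<close>

datatype state =
    MinimizeU word word
  | MinimizeV word word
  | Compare word word
  | Search word word tree word
  | Check word tree
  | Answer bool

text \<open>
  The algorithm does not prescribe the order in which the elementary Whitehead
  automorphisms are tried. Accordingly, each pass may go through them in an arbitrary
  order, chosen anew: the transition relation is nondeterministic. Its second argument is
  the cost of the transition.
\<close>

definition enumeration :: "(word \<Rightarrow> word) list \<Rightarrow> bool" where
  "enumeration \<phi>s \<longleftrightarrow> distinct \<phi>s \<and> set \<phi>s = whitehead_autos"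

inductive step :: "state \<Rightarrow> nat \<Rightarrow> state \<Rightarrow> bool" where
  minU: "\<lbrakk>enumeration \<phi>s; find_shorter_t \<phi>s u = (Some u', c)\<rbrakk>
    \<Longrightarrow> step (MinimizeU u v) c (MinimizeU u' v)"
| minU_done: "\<lbrakk>enumeration \<phi>s; find_shorter_t \<phi>s u = (None, c)\<rbrakk>
    \<Longrightarrow> step (MinimizeU u v) c (MinimizeV u v)"
| minV: "\<lbrakk>enumeration \<phi>s; find_shorter_t \<phi>s v = (Some v', c)\<rbrakk>
    \<Longrightarrow> step (MinimizeV u v) c (MinimizeV u v')"
| minV_done: "\<lbrakk>enumeration \<phi>s; find_shorter_t \<phi>s v = (None, c)\<rbrakk>
    \<Longrightarrow> step (MinimizeV u v) c (Compare u v)"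
| compare_no: "same_length_t u v = (False, c)
    \<Longrightarrow> step (Compare u v) c (Answer False)"
| compare_eq: "same_length_t u v = (True, c)
    \<Longrightarrow> step (Compare u v) c (Search u v [(u, None)] u)"
| extend: "\<lbrakk>enumeration \<phi>s; find_new_t \<phi>s u T w = (Some w', c)\<rbrakk>
    \<Longrightarrow> step (Search u v T w) c (Search u v ((w', Some w) # T) w')"
| backtrack: "\<lbrakk>enumeration \<phi>s; find_new_t \<phi>s u T w = (None, c);
      preceding_t w T = (Some w', d)\<rbrakk>
    \<Longrightarrow> step (Search u v T w) (c + d) (Search u v T w')"
| search_done: "\<lbrakk>enumeration \<phi>s; find_new_t \<phi>s u T w = (None, c);
      preceding_t w T = (None, d)\<rbrakk>
    \<Longrightarrow> step (Search u v T w) (c + d) (Check v T)"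
| check: "recorded_t v T = (b, c) \<Longrightarrow> step (Check v T) c (Answer b)"

inductive run :: "state \<Rightarrow> nat \<Rightarrow> state \<Rightarrow> bool" where
  run_refl: "run s 0 s"
| run_step: "\<lbrakk>run s c s'; step s' d s''\<rbrakk> \<Longrightarrow> run s (c + d) s''"

text \<open>
  \<open>terminates_within s t\<close>: every run from \<open>s\<close>, whatever the choices made, stops after
  finitely many transitions of total cost at most \<open>t\<close>, and it stops with an answer. As the
  predicate is inductive, infinite runs are excluded.
\<close>

inductive terminates_within :: "state \<Rightarrow> nat \<Rightarrow> bool" where
  answered: "terminates_within (Answer b) t"
| transition: "\<lbrakk>\<exists>c s'. step s c s';
      \<And>c s'. step s c s' \<Longrightarrow> c \<le> t \<and> terminates_within s' (t - c)\<rbrakk>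
    \<Longrightarrow> terminates_within s t"

definition whitehead_algorithm :: "word \<Rightarrow> word \<Rightarrow> state" where
  "whitehead_algorithm u v = MinimizeU u v"

end

theory Submission
  imports Defs
begin

text \<open>
  Write \<open>x\<close>, \<open>y\<close> for the basis. Up to inner automorphisms, the automorphism group is generated by
  the signed permutations \<open>\<pi>\<close> of the letters and the one transvection \<open>tv : x \<mapsto> x y, y \<mapsto> y\<close>
  (Nielsen; \<open>iso_F2_generated\<close>). Measure a word \<open>w\<close> by the length \<open>clen w\<close> of its cyclically
  reduced conjugate, and let \<open>X\<close>, \<open>Y\<close>, \<open>p\<close>, \<open>q\<close> be the numbers of cyclic digrams \<open>x x\<close>, \<open>y y\<close>,
  \<open>x y\<^sup>-\<^sup>1\<close>, \<open>x y\<close>, each counted together with its inverse. Since every letter of a cyclic word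
  has one predecessor and one successor, \<open>y\<^sup>-\<^sup>1 x\<close> is as frequent as \<open>x y\<^sup>-\<^sup>1\<close> and \<open>y x\<close> as
  frequent as \<open>x y\<close>. Hence \<open>tv \<circ> \<pi>\<close> changes \<open>clen\<close> by one of the four numbers
  \<open>X + q - p\<close>, \<open>Y + q - p\<close>, \<open>X + p - q\<close>, \<open>Y + p - q\<close>.

  Geometrically, bases modulo conjugation and signed permutations are the edges of the Farey
  graph. An edge lies in two triangles; its two neighbours in one triangle belong to the first two
  numbers, those in the other triangle to the last two. Since \<open>X, Y \<ge> 0\<close>, if one neighbour is
  shorter and another one is not longer, then both lie in the same triangle and are neighbours of
  each other or equal (\<open>peak\<close>). It follows that the words reachable from a locally minimal word
  \<open>u\<close> without ever decreasing the length are closed under all generators (\<open>ascent_closed\<close>): they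
  are the whole orbit. So \<open>u\<close> is minimal in its orbit, and it is joined to every other minimal word
  by steps that preserve the length. This is the correctness of the two parts of the algorithm.

  The running time needs a polynomial bound for the number of minimal words. Steps of
  constant length preserve the numbers of letters \<open>x\<^sup>\<plusminus>\<^sup>1\<close> and \<open>y\<^sup>\<plusminus>\<^sup>1\<close>, up to exchange. If \<open>x\<close> is the rarer
  one, then only \<open>x\<close> can be replaced, and up to conjugation and signed permutations the minimal words
  are the images of one or two words under powers of \<open>tv\<close>; the
  \<open>k\<close>-th power adds \<open>k\<close> to the exponent of \<open>y\<close> between two neighbouring \<open>x\<close>, so that either \<open>k\<close> is at
  most linear in the length, or there are no such neighbours and \<open>tv\<close> fixes the cyclic word
  (\<open>unbalanced_family_bounded\<close>). If both are equally frequent, then the triangle can only be changed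
  at a word in which \<open>x\<^sup>\<plusminus>\<^sup>1\<close> and \<open>y\<^sup>\<plusminus>\<^sup>1\<close> alternate, and two such words are never properly adjacent,
  so that two steps lead everywhere (\<open>balanced_family\<close>). Thus there are linearly many minimal cyclic
  words and quadratically many minimal words (\<open>card_level\<close>).

  Cyclic words are related to words as follows: a rotation is the conjugation by a letter, hence
  elementary, and one of the two elementary automorphisms \<open>x \<mapsto> x y\<close> and \<open>x \<mapsto> y x\<close> always
  produces a word as short as the cyclic one (\<open>length_tv_or_tvl\<close>). Finally, the depth-first search
  stops because the number of words still missing, counted twice, plus the depth of the current
  word decreases with each transition (\<open>search_inv\<close>).
\<close>

section \<open>Free reduction\<close>

lemma inv_letter_inv_letter [simp]: "inv_letter (inv_letter a) = a"
  by (cases a) (simp add: inv_letter_def)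

lemma inv_letter_neq [simp]: "inv_letter a \<noteq> a" "a \<noteq> inv_letter a"
  by (cases a; simp add: inv_letter_def)+

lemma inv_letter_eq_iff [simp]: "inv_letter a = inv_letter b \<longleftrightarrow> a = b"
  by (cases a; cases b) (auto simp add: inv_letter_def)

lemma fst_inv_letter [simp]: "fst (inv_letter a) = fst a"
  by (simp add: inv_letter_def)

lemma inv_letter_swap: "inv_letter a = b \<longleftrightarrow> a = inv_letter b"
  by auto

lemma reduced_Nil [simp]: "reduced []"
  by (simp add: reduced_def)

lemma reduced_single [simp]: "reduced [a]"
  by (simp add: reduced_def)

lemma reduced_Cons: "reduced (a # w) \<longleftrightarrow> reduced w \<and> (w = [] \<or> hd w \<noteq> inv_letter a)"
  by (cases w) (auto simp: reduced_def)

lemma reduced_append: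
  "reduced (u @ v) \<longleftrightarrow> reduced u \<and> reduced v \<and> (u = [] \<or> v = [] \<or> hd v \<noteq> inv_letter (last u))"
  by (auto simp: reduced_def successively_append_iff)

lemma reduced_push: "reduced w \<Longrightarrow> reduced (push a w)"
  by (cases w) (auto simp: reduced_Cons)

lemma reduced_free_reduce [simp]: "reduced (free_reduce w)"
  by (induction w) (auto simp: free_reduce_def reduced_push)

lemma free_reduce_Nil [simp]: "free_reduce [] = []"
  by (simp add: free_reduce_def)

lemma free_reduce_Cons: "free_reduce (a # w) = push a (free_reduce w)"
  by (simp add: free_reduce_def)

lemma free_reduce_id [simp]: "reduced w \<Longrightarrow> free_reduce w = w"
proof (induction w)
  case (Cons a w)
  then show ?case by (cases w) (auto simp: free_reduce_Cons reduced_Cons)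
qed simp

lemma push_inv_letter: "reduced w \<Longrightarrow> push (inv_letter a) (push a w) = w"
proof (cases w)
  case (Cons b v)
  assume "reduced w"
  then show ?thesis using Cons by (cases v) (auto simp: reduced_Cons)
qed simp

lemma push_inv_letter': "reduced w \<Longrightarrow> push a (push (inv_letter a) w) = w"
  using push_inv_letter[of w "inv_letter a"] by simp

lemma reduced_foldr_push: "reduced w \<Longrightarrow> reduced (foldr push u w)"
  by (induction u) (auto simp: reduced_push)

lemma free_reduce_append: "free_reduce (u @ v) = foldr push u (free_reduce v)"
  by (simp add: free_reduce_def)

lemma foldr_push_push: "reduced w \<Longrightarrow> foldr push (push a u) w = push a (foldr push u w)"
  by (cases u) (auto simp: push_inv_letter' reduced_foldr_push)

lemma foldr_push_free_reduce: "reduced w \<Longrightarrow> foldr push (free_reduce u) w = foldr push u w"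
  by (induction u) (auto simp: free_reduce_Cons foldr_push_push)

lemma free_reduce_right [simp]: "free_reduce (u @ free_reduce v) = free_reduce (u @ v)"
  by (simp add: free_reduce_append)

lemma free_reduce_left [simp]: "free_reduce (free_reduce u @ v) = free_reduce (u @ v)"
  by (simp add: free_reduce_append foldr_push_free_reduce)

lemma free_reduce_mid [simp]: "free_reduce (u @ free_reduce v @ w) = free_reduce (u @ v @ w)"
  by (metis free_reduce_left free_reduce_right)

text \<open>Equality in the free group. Working with it instead of reduced words frees most computations from
  reducedness hypotheses.\<close>

abbreviation eqF :: "word \<Rightarrow> word \<Rightarrow> bool" (infix \<open>\<equiv>F\<close> 50) where
  "u \<equiv>F v \<equiv> free_reduce u = free_reduce v"

lemma eqF_append: "u \<equiv>F u' \<Longrightarrow> v \<equiv>F v' \<Longrightarrow> u @ v \<equiv>F u' @ v'"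
  by (metis free_reduce_left free_reduce_right)

lemma eqF_cancel_letter [simp]:
  "inv_letter a # a # w \<equiv>F w" "a # inv_letter a # w \<equiv>F w"
  by (simp_all add: free_reduce_Cons push_inv_letter push_inv_letter')

lemma length_free_reduce: "length (free_reduce w) \<le> length w"
proof (induction w)
  case (Cons a w)
  have "length (push a v) \<le> Suc (length v)" for v by (cases v) auto
  with Cons show ?case by (simp add: free_reduce_Cons) (meson le_SucI le_trans not_less_eq_eq)
qed simp

definition winv :: "word \<Rightarrow> word" where
  "winv w = rev (map inv_letter w)"

lemma winv_simps [simp]:
  "winv [] = []" "winv (a # w) = winv w @ [inv_letter a]" "winv (u @ v) = winv v @ winv u"
  "winv (winv w) = w" "length (winv w) = length w" "winv w = [] \<longleftrightarrow> w = []"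
  by (auto simp: winv_def rev_map o_def)

lemma last_winv: "w \<noteq> [] \<Longrightarrow> last (winv w) = inv_letter (hd w)"
  by (simp add: winv_def last_rev hd_map)

lemma reduced_winv [simp]: "reduced (winv w) \<longleftrightarrow> reduced w"
proof -
  have "reduced w \<Longrightarrow> reduced (winv w)" for w
    by (induction w) (auto simp: reduced_append reduced_Cons last_winv)
  from this[of w] this[of "winv w"] show ?thesis by auto
qed

lemma eqF_winv_left: "winv u @ u @ w \<equiv>F w"
proof (induction u arbitrary: w)
  case (Cons a u)
  have "winv (a # u) @ (a # u) @ w \<equiv>F winv u @ u @ w"
    using eqF_append[of "winv u" "winv u" "[inv_letter a, a] @ u @ w" "u @ w"] by simp
  then show ?case using Cons by simp
qed simp

lemma eqF_winv_right: "u @ winv u @ w \<equiv>F w"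
  using eqF_winv_left[of "winv u" w] by simp

lemma eqF_winv [simp]: "winv u @ u \<equiv>F []" "u @ winv u \<equiv>F []"
  using eqF_winv_left[of u "[]"] eqF_winv_right[of u "[]"] by simp_all

lemma eqF_winv_mid [simp]:
  "v @ winv u @ u @ w \<equiv>F v @ w" "v @ u @ winv u @ w \<equiv>F v @ w"
  "v @ winv u @ u \<equiv>F v" "v @ u @ winv u \<equiv>F v"
  using eqF_append[OF refl eqF_winv_left, of v u w] eqF_append[OF refl eqF_winv_right, of v u w]
    eqF_append[OF refl eqF_winv(1), of v u] eqF_append[OF refl eqF_winv(2), of v u]
  by simp_all

lemma eqF_winv_cong: assumes "u \<equiv>F v" shows "winv u \<equiv>F winv v"
proof -
  have "winv u @ v @ winv v \<equiv>F winv u @ u @ winv v"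
    by (rule eqF_append[OF refl eqF_append[OF assms[symmetric] refl]])
  then show ?thesis by (simp add: eqF_winv_left)
qed

lemma free_reduce_winv: "free_reduce (winv w) = winv (free_reduce w)"
  using eqF_winv_cong[of "free_reduce w" w] by simp

lemma F2_carrier [simp]: "w \<in> carrier F2 \<longleftrightarrow> reduced w"
  by (simp add: F2_def)

lemma F2_mult: "u \<otimes>\<^bsub>F2\<^esub> v = free_reduce (u @ v)"
  by (simp add: F2_def)

lemma F2_one [simp]: "\<one>\<^bsub>F2\<^esub> = []"
  by (simp add: F2_def)

lemma group_F2: "group F2"
proof (rule groupI)
  fix x y z assume "x \<in> carrier F2" "y \<in> carrier F2" "z \<in> carrier F2"
  show "x \<otimes>\<^bsub>F2\<^esub> y \<otimes>\<^bsub>F2\<^esub> z = x \<otimes>\<^bsub>F2\<^esub> (y \<otimes>\<^bsub>F2\<^esub> z)" by (simp add: F2_mult)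
next
  fix x assume "x \<in> carrier F2"
  then show "\<exists>y\<in>carrier F2. y \<otimes>\<^bsub>F2\<^esub> x = \<one>\<^bsub>F2\<^esub>"
    by (intro bexI[of _ "winv x"]) (auto simp: F2_mult)
qed (auto simp: F2_mult)

section \<open>Homomorphisms given on letters\<close>

text \<open>The condition \<open>sym_map f\<close>, that inverse letters have inverse images, makes \<open>ext f\<close> invariant under
  free reduction, hence a homomorphism.\<close>

definition ext :: "(letter \<Rightarrow> word) \<Rightarrow> word \<Rightarrow> word" where
  "ext f w = free_reduce (concat (map f w))"

definition sym_map :: "(letter \<Rightarrow> word) \<Rightarrow> bool" where
  "sym_map f \<longleftrightarrow> (\<forall>a. f (inv_letter a) \<equiv>F winv (f a))"

lemma reduced_ext [simp]: "reduced (ext f w)"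
  by (simp add: ext_def)

lemma ext_Nil [simp]: "ext f [] = []"
  by (simp add: ext_def)

lemma ext_append: "ext f (u @ v) = free_reduce (ext f u @ ext f v)"
  by (simp add: ext_def)

lemma ext_push: "sym_map f \<Longrightarrow> ext f (push a w) = ext f (a # w)"
proof (cases w)
  case (Cons b v)
  assume f: "sym_map f"
  have "f a @ f (inv_letter a) @ z \<equiv>F z" for z
  proof -
    have "f a @ f (inv_letter a) @ z \<equiv>F f a @ winv (f a) @ z"
      using f by (metis eqF_append sym_map_def)
    then show ?thesis by (simp add: eqF_winv_right)
  qed
  then show ?thesis using Cons by (auto simp: ext_def)
qed simp

lemma ext_free_reduce: "sym_map f \<Longrightarrow> ext f (free_reduce w) = ext f w"
proof (induction w)
  case (Cons a w)
  then have "ext f (free_reduce (a # w)) = ext f ([a] @ free_reduce w)"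
    by (simp add: free_reduce_Cons ext_push)
  also have "\<dots> = ext f ([a] @ w)" unfolding ext_append using Cons by simp
  finally show ?case by simp
qed simp

lemma ext_cong: "sym_map f \<Longrightarrow> u \<equiv>F v \<Longrightarrow> ext f u = ext f v"
  by (metis ext_free_reduce)

lemma ext_in_hom: "sym_map f \<Longrightarrow> ext f \<in> hom F2 F2"
  by (auto simp: hom_def F2_mult ext_free_reduce ext_append)

lemma hom_simps:
  assumes "\<phi> \<in> hom F2 F2"
  shows hom_Nil: "\<phi> [] = []"
    and hom_reduced: "reduced w \<Longrightarrow> reduced (\<phi> w)"
    and hom_mult: "reduced u \<Longrightarrow> reduced v \<Longrightarrow> \<phi> (free_reduce (u @ v)) = free_reduce (\<phi> u @ \<phi> v)"
    and hom_winv: "reduced w \<Longrightarrow> \<phi> (winv w) = winv (\<phi> w)"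
proof -
  show r: "reduced w \<Longrightarrow> reduced (\<phi> w)" for w
    using assms by (auto simp: hom_def)
  show m: "reduced u \<Longrightarrow> reduced v \<Longrightarrow> \<phi> (free_reduce (u @ v)) = free_reduce (\<phi> u @ \<phi> v)" for u v
    using assms by (auto simp: hom_def F2_mult)
  show "\<phi> [] = []"
    using group_hom.hom_one[of F2 F2 \<phi>] group_F2 assms
    by (simp add: group_hom_def group_hom_axioms_def)
  then show "\<phi> (winv w) = winv (\<phi> w)" if "reduced w" for w
  proof -
    have "[] = free_reduce (\<phi> (winv w) @ \<phi> w)" using m[of "winv w" w] that \<open>\<phi> [] = []\<close> by simp
    then have "free_reduce ([] @ winv (\<phi> w)) = free_reduce (free_reduce (\<phi> (winv w) @ \<phi> w) @ winv (\<phi> w))"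
      by simp
    then show ?thesis using that r by simp
  qed
qed

lemma hom_eq_ext:
  assumes "\<phi> \<in> hom F2 F2" "reduced w"
  shows "\<phi> w = ext (\<lambda>a. \<phi> [a]) w"
  using assms(2)
proof (induction w)
  case (Cons a w)
  then have r: "reduced w" by (simp add: reduced_Cons)
  have "\<phi> (a # w) = \<phi> (free_reduce ([a] @ w))" using Cons by simp
  also have "\<dots> = free_reduce (\<phi> [a] @ \<phi> w)"
    using hom_mult[OF assms(1), of "[a]" w] r by simp
  also have "\<dots> = ext (\<lambda>a. \<phi> [a]) (a # w)" using Cons r by (simp add: ext_def)
  finally show ?case .
qed (simp add: hom_Nil[OF assms(1)])

lemma ext_Cons: "ext f (a # w) = free_reduce (f a @ ext f w)"
  by (simp add: ext_def)

section \<open>Conjugacy and cyclically reduced words\<close>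

definition cyc_reduced :: "word \<Rightarrow> bool" where
  "cyc_reduced c \<longleftrightarrow> reduced c \<and> (c = [] \<or> hd c \<noteq> inv_letter (last c))"

definition conjF :: "word \<Rightarrow> word \<Rightarrow> bool" where
  "conjF u v \<longleftrightarrow> (\<exists>g. v \<equiv>F winv g @ u @ g)"

lemma conjFI: "v \<equiv>F winv g @ u @ g \<Longrightarrow> conjF u v"
  by (auto simp: conjF_def)

lemma conjF_refl [simp]: "conjF u u"
  by (rule conjFI[of _ "[]"]) simp

lemma conjF_eqF: "u \<equiv>F v \<Longrightarrow> conjF u v"
  by (rule conjFI[of _ "[]"]) simp

lemma conjF_sym: assumes "conjF u v" shows "conjF v u"
proof -
  obtain g where g: "v \<equiv>F winv g @ u @ g" using assms by (auto simp: conjF_def)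
  have "g @ v @ winv g \<equiv>F g @ (winv g @ u @ g) @ winv g"
    by (rule eqF_append[OF refl eqF_append[OF g refl]])
  then have "g @ v @ winv g \<equiv>F u" by (simp add: eqF_winv_right)
  then show ?thesis by (intro conjFI[of _ "winv g"]) simp
qed

lemma conjF_trans [trans]: assumes "conjF u v" "conjF v w" shows "conjF u w"
proof -
  obtain g where g: "v \<equiv>F winv g @ u @ g" using assms by (auto simp: conjF_def)
  obtain h where h: "w \<equiv>F winv h @ v @ h" using assms by (auto simp: conjF_def)
  have "w \<equiv>F winv h @ (winv g @ u @ g) @ h"
    unfolding h by (rule eqF_append[OF refl eqF_append[OF g refl]])
  then show ?thesis by (intro conjFI[of _ "g @ h"]) simp
qed

lemma conjF_swap: "conjF (u @ v) (v @ u)"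
  by (rule conjFI[of _ "u"]) (simp add: eqF_winv_left)

lemma conjF_hom_ext: assumes "sym_map f" "conjF u v" shows "conjF (ext f u) (ext f v)"
proof -
  obtain g where g: "v \<equiv>F winv g @ u @ g" using assms by (auto simp: conjF_def)
  have w: "ext f (winv g) = winv (ext f g)"
    using hom_winv[OF ext_in_hom[OF assms(1)], of "free_reduce g"] assms(1)
    by (simp add: free_reduce_winv[symmetric] ext_free_reduce)
  have "ext f v = ext f (winv g @ u @ g)" by (rule ext_cong[OF assms(1) g])
  also have "\<dots> = free_reduce (winv (ext f g) @ ext f u @ ext f g)"
    by (simp add: ext_append w)
  finally show ?thesis by (intro conjFI[of _ "ext f g"]) simp
qed

lemma cyc_reduced_rotate1: "cyc_reduced c \<Longrightarrow> cyc_reduced (rotate1 c)"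
  by (cases c; cases "tl c") (auto simp: cyc_reduced_def reduced_append reduced_Cons split: if_splits)

lemma cyc_reduced_rotate: "cyc_reduced c \<Longrightarrow> cyc_reduced (rotate n c)"
  by (induction n) (auto simp: cyc_reduced_rotate1)

lemma conjF_rotate: "conjF c (rotate n c)"
proof (induction n)
  case (Suc n)
  have "conjF d (rotate1 d)" for d
    using conjF_swap[of "[hd d]" "tl d"] by (cases d) auto
  then show ?case using Suc conjF_trans by auto
qed simp

text \<open>Conjugating by one more letter either rotates the middle part, or shortens or extends
  the conjugating word; hence a conjugate of a cyclically reduced word \<open>c\<close> is a rotation of \<open>c\<close>
  with a conjugating word around it, without cancellation.\<close>

lemma conj_letter_form:
  assumes c: "cyc_reduced c" and w: "reduced (winv h @ c @ h)"
  shows "\<exists>k n. free_reduce (inv_letter a # (winv h @ c @ h) @ [a]) = winv k @ rotate n c @ k"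
proof (cases h rule: rev_cases)
  case (snoc h' b)
  show ?thesis
  proof (cases "b = inv_letter a")
    case True
    have "inv_letter a # (winv h @ c @ h) @ [a] \<equiv>F winv h' @ c @ h' @ [inv_letter a, a]"
      using snoc True by simp
    also have "winv h' @ c @ h' @ [inv_letter a, a] \<equiv>F winv h' @ c @ h'"
      using eqF_append[OF refl eqF_cancel_letter(1)[of a "[]"], of "winv h' @ c @ h'"] by simp
    also have "free_reduce (winv h' @ c @ h') = winv h' @ c @ h'"
    proof (rule free_reduce_id)
      have "reduced ([inv_letter b] @ (winv h' @ c @ h') @ [b])" using w snoc by simp
      then show "reduced (winv h' @ c @ h')" by (metis reduced_append)
    qed
    finally have "free_reduce (inv_letter a # (winv h @ c @ h) @ [a]) = winv h' @ rotate 0 c @ h'"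
      by simp
    then show ?thesis by blast
  next
    case False
    obtain z where z: "winv h @ c @ h = z" "z \<noteq> []" "hd z = inv_letter b" "last z = b"
      using snoc by simp
    then have "reduced (inv_letter a # (winv h @ c @ h) @ [a])"
      using w False by (auto simp: reduced_append reduced_Cons inv_letter_swap)
    then have "free_reduce (inv_letter a # (winv h @ c @ h) @ [a]) = winv (h @ [a]) @ rotate 0 c @ h @ [a]"
      by simp
    then show ?thesis by blast
  qed
next
  case Nil
  show ?thesis
  proof (cases "c = []")
    case True
    then have "free_reduce (inv_letter a # (winv h @ c @ h) @ [a]) = winv [] @ rotate 0 c @ []"
      using Nil eqF_cancel_letter(1)[of a "[]"] by simp
    then show ?thesis by blast
  next
    case ne: False
    consider (hd) "hd c = a" | (last) "last c = inv_letter a" | (none) "hd c \<noteq> a" "last c \<noteq> inv_letter a"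
      by blast
    then show ?thesis
    proof cases
      case hd
      then have "free_reduce (inv_letter a # (winv h @ c @ h) @ [a]) = free_reduce (rotate1 c)"
        using Nil ne by (cases c) auto
      also have "\<dots> = winv [] @ rotate 1 c @ []"
        using cyc_reduced_rotate1[OF c] by (simp add: cyc_reduced_def)
      finally show ?thesis by blast
    next
      case last
      then obtain r where r: "c = r @ [inv_letter a]"
        using ne by (metis append_butlast_last_id)
      have rot: "rotate (length r) c = inv_letter a # r"
        using r by (simp add: rotate_append)
      have "inv_letter a # (winv h @ c @ h) @ [a] \<equiv>F inv_letter a # r @ [inv_letter a, a]"
        using Nil r by simp
      also have "inv_letter a # r @ [inv_letter a, a] \<equiv>F inv_letter a # r"
        using eqF_append[OF refl eqF_cancel_letter(1)[of a "[]"], of "inv_letter a # r"] by simp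
      also have "free_reduce (inv_letter a # r) = winv [] @ rotate (length r) c @ []"
        using cyc_reduced_rotate[OF c, of "length r"] unfolding rot by (simp add: cyc_reduced_def)
      finally show ?thesis by blast
    next
      case none
      have "reduced (inv_letter a # c @ [a])"
        using none ne c by (auto simp: reduced_append reduced_Cons cyc_reduced_def inv_letter_swap)
      then have "free_reduce (inv_letter a # (winv h @ c @ h) @ [a]) = winv [a] @ rotate 0 c @ [a]"
        using Nil by simp
      then show ?thesis by blast
    qed
  qed
qed

lemma conj_form:
  assumes c: "cyc_reduced c"
  shows "\<exists>h n. free_reduce (winv g @ c @ g) = winv h @ rotate n c @ h"
proof (induction g rule: rev_induct)
  case Nil
  have "free_reduce (winv [] @ c @ []) = winv [] @ rotate 0 c @ []"
    using c by (simp add: cyc_reduced_def)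
  then show ?case by blast
next
  case (snoc a g)
  then obtain h n where h: "free_reduce (winv g @ c @ g) = winv h @ rotate n c @ h" by blast
  have "winv (g @ [a]) @ c @ g @ [a] \<equiv>F [inv_letter a] @ (winv g @ c @ g) @ [a]" by simp
  also have "\<dots> = free_reduce ([inv_letter a] @ (winv h @ rotate n c @ h) @ [a])"
    by (rule eqF_append[OF refl eqF_append[OF _ refl]]) (metis h free_reduce_right append_Nil)
  finally have "free_reduce (winv (g @ [a]) @ c @ g @ [a])
      = free_reduce (inv_letter a # (winv h @ rotate n c @ h) @ [a])" by simp
  moreover have "reduced (winv h @ rotate n c @ h)" unfolding h[symmetric] by simp
  ultimately show ?case
    using conj_letter_form[OF cyc_reduced_rotate[OF c], of h n a] rotate_rotate by metis
qed

lemma conjF_cyc_reducedD: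
  assumes "cyc_reduced c" "reduced w" "conjF c w"
  shows "\<exists>h n. w = winv h @ rotate n c @ h"
  using assms conj_form[OF assms(1)] by (auto simp: conjF_def)

lemma conjF_cyc_reduced_rotate:
  assumes "cyc_reduced c" "cyc_reduced d" "conjF c d"
  shows "\<exists>n. d = rotate n c"
proof -
  obtain h n where "d = winv h @ rotate n c @ h"
    using conjF_cyc_reducedD[OF assms(1) _ assms(3)] assms(2) by (auto simp: cyc_reduced_def)
  moreover have "h = []"
    using assms(2) calculation by (cases h rule: rev_cases) (auto simp: cyc_reduced_def)
  ultimately show ?thesis by auto
qed

lemma ex_cyc_reduced: "reduced w \<Longrightarrow> \<exists>c. cyc_reduced c \<and> conjF w c"
proof (induction w rule: length_induct)
  case (1 w)
  show ?case
  proof (cases "cyc_reduced w")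
    case True
    then show ?thesis by (intro exI[of _ w]) simp
  next
    case False
    then have ne: "w \<noteq> []" and h: "hd w = inv_letter (last w)"
      using 1 by (auto simp: cyc_reduced_def)
    obtain v a where v: "w = v @ [a]" using ne by (cases w rule: rev_cases) auto
    with h obtain u where w: "w = inv_letter a # u @ [a]"
      by (cases v) auto
    then have "reduced u" using 1 by (auto simp: reduced_append reduced_Cons)
    moreover have "conjF w u"
    proof (rule conjFI[of _ "[inv_letter a]"])
      have "u @ [a, inv_letter a] \<equiv>F u"
        using eqF_append[OF refl eqF_cancel_letter(2)[of a "[]"], of u] by simp
      then have "winv [inv_letter a] @ w @ [inv_letter a] \<equiv>F u"
        using w by simp
      then show "u \<equiv>F winv [inv_letter a] @ w @ [inv_letter a]" by simp
    qed
    ultimately show ?thesis using 1 w conjF_trans by (metis length_append_singleton length_Cons lessI less_SucI)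
  qed
qed

text \<open>A cyclically reduced conjugate is unique only up to rotation. As the choice depends on the
  conjugacy class alone, conjugacy is equality of cores, and whatever is defined from the core
  depends on the class only.\<close>

definition core :: "word \<Rightarrow> word" where
  "core w = (SOME c. cyc_reduced c \<and> conjF w c)"

abbreviation clen :: "word \<Rightarrow> nat" where
  "clen w \<equiv> length (core w)"

lemma core: "cyc_reduced (core w)" "conjF w (core w)"
proof -
  have "\<exists>c. cyc_reduced c \<and> conjF w c"
    using ex_cyc_reduced[of "free_reduce w"] conjF_trans[OF conjF_eqF[of w "free_reduce w"]] by auto
  from someI_ex[OF this] show "cyc_reduced (core w)" "conjF w (core w)"
    unfolding core_def by auto
qed

lemma core_eq_iff: "core u = core v \<longleftrightarrow> conjF u v"
proof
  assume "core u = core v"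
  then show "conjF u v" using core(2)[of u] core(2)[of v] conjF_trans conjF_sym by metis
next
  assume "conjF u v"
  then have "conjF u c \<longleftrightarrow> conjF v c" for c using conjF_trans conjF_sym by metis
  then show "core u = core v" by (simp add: core_def)
qed

lemma core_rotate: "cyc_reduced c \<Longrightarrow> \<exists>n. core c = rotate n c"
  by (intro conjF_cyc_reduced_rotate core) auto

lemma clen_cyc_reduced: "cyc_reduced c \<Longrightarrow> clen c = length c"
  using core_rotate[of c] by auto

lemma reduced_core_form:
  assumes "reduced w"
  shows "\<exists>h n. w = winv h @ rotate n (core w) @ h"
  using conjF_cyc_reducedD[OF core(1) assms conjF_sym[OF core(2)]] .

lemma clen_le_length: "reduced w \<Longrightarrow> clen w \<le> length w"
  by (drule reduced_core_form) (metis le_add1 le_add2 length_append length_rotate le_trans)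

lemma cyc_reduced_iff_clen: assumes "reduced w" shows "cyc_reduced w \<longleftrightarrow> clen w = length w"
proof
  assume "clen w = length w"
  moreover obtain h n where "w = winv h @ rotate n (core w) @ h" using reduced_core_form[OF assms] by blast
  moreover have "h = []"
  proof -
    have "length w = length h + length (core w) + length h"
      by (subst calculation(2)) simp
    then show ?thesis using calculation by simp
  qed
  ultimately have "w = rotate n (core w)" by simp
  then show "cyc_reduced w" by (metis core(1) cyc_reduced_rotate)
qed (simp add: clen_cyc_reduced)

section \<open>Signed permutations and the transvection\<close>

abbreviation px :: letter where "px \<equiv> (X1, True)"
abbreviation nx :: letter where "nx \<equiv> (X1, False)"
abbreviation py :: letter where "py \<equiv> (X2, True)"
abbreviation ny :: letter where "ny \<equiv> (X2, False)"

lemma inv_letter_Pair [simp]: "inv_letter (g, s) = (g, \<not> s)"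
  by (simp add: inv_letter_def)

lemma letter_cases: obtains "a = px" | "a = nx" | "a = py" | "a = ny"
proof -
  obtain g s where "a = (g, s)" by (cases a)
  then show thesis using that by (cases g; cases s) auto
qed

lemma UNIV_letter: "(UNIV :: letter set) = {px, nx, py, ny}"
  by (auto intro: letter_cases)

definition signed_perm :: "(letter \<Rightarrow> letter) \<Rightarrow> bool" where
  "signed_perm \<pi> \<longleftrightarrow> inj \<pi> \<and> (\<forall>a. \<pi> (inv_letter a) = inv_letter (\<pi> a))"

lemma signed_perm_inv: "signed_perm \<pi> \<Longrightarrow> \<pi> (inv_letter a) = inv_letter (\<pi> a)"
  unfolding signed_perm_def by blast

text \<open>The signed permutation with \<open>x \<mapsto> a\<close> and \<open>y \<mapsto> b\<close>; all of them have this form.\<close>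

definition sp :: "letter \<Rightarrow> letter \<Rightarrow> letter \<Rightarrow> letter" where
  "sp a b c = (if c = px then a else if c = nx then inv_letter a
               else if c = py then b else inv_letter b)"

lemma signed_perm_sp: assumes "fst a \<noteq> fst b" shows "signed_perm (sp a b)"
proof -
  have "inj_on (sp a b) {px, nx, py, ny}"
    using assms by (cases a rule: letter_cases; cases b rule: letter_cases) (auto simp: sp_def)
  moreover have "sp a b (inv_letter c) = inv_letter (sp a b c)" for c
    by (cases c rule: letter_cases) (auto simp: sp_def)
  ultimately show ?thesis unfolding signed_perm_def UNIV_letter by blast
qed

lemma signed_perm_eq_sp: "signed_perm \<pi> \<Longrightarrow> \<pi> = sp (\<pi> px) (\<pi> py)"
proof
  fix c assume "signed_perm \<pi>"
  then have "\<pi> nx = inv_letter (\<pi> px)" "\<pi> ny = inv_letter (\<pi> py)"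
    using signed_perm_inv[of \<pi> px] signed_perm_inv[of \<pi> py] by simp_all
  then show "\<pi> c = sp (\<pi> px) (\<pi> py) c"
    by (cases c rule: letter_cases) (auto simp: sp_def)
qed

lemma signed_perm_fst: assumes "signed_perm \<pi>" shows "fst (\<pi> px) \<noteq> fst (\<pi> py)"
proof
  assume "fst (\<pi> px) = fst (\<pi> py)"
  then have "\<pi> py = \<pi> px \<or> \<pi> py = inv_letter (\<pi> px)"
    by (cases "\<pi> px"; cases "\<pi> py") auto
  then have "\<pi> py = \<pi> px \<or> \<pi> py = \<pi> nx"
    using signed_perm_inv[OF assms, of px] by simp
  then show False using assms unfolding signed_perm_def inj_def by blast
qed

lemma signed_perm_cases:
  assumes "signed_perm \<pi>"
  obtains s t where "\<pi> = sp (X1, s) (X2, t)" | s t where "\<pi> = sp (X2, s) (X1, t)"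
proof -
  obtain g s h t where "\<pi> px = (g, s)" "\<pi> py = (h, t)" by (metis surj_pair)
  then show thesis
    using signed_perm_fst[OF assms] signed_perm_eq_sp[OF assms] that by (cases g; cases h) auto
qed

lemma finite_signed_perm: "finite {\<pi>. signed_perm \<pi>}"
proof (rule finite_subset)
  show "{\<pi>. signed_perm \<pi>} \<subseteq> (\<lambda>(a, b). sp a b) ` (UNIV \<times> UNIV)"
  proof
    fix \<pi> assume "\<pi> \<in> {\<pi>. signed_perm \<pi>}"
    then have "\<pi> = (\<lambda>(a, b). sp a b) (\<pi> px, \<pi> py)" using signed_perm_eq_sp by simp
    then show "\<pi> \<in> (\<lambda>(a, b). sp a b) ` (UNIV \<times> UNIV)" by (rule image_eqI) simp
  qed
  show "finite ((\<lambda>(a, b). sp a b) ` (UNIV \<times> UNIV))"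
    by (intro finite_imageI finite_cartesian_product) (simp_all add: UNIV_letter)
qed

lemma signed_perm_comp: "signed_perm \<pi> \<Longrightarrow> signed_perm \<rho> \<Longrightarrow> signed_perm (\<pi> \<circ> \<rho>)"
  unfolding signed_perm_def by (simp add: inj_compose del: split_paired_All)

lemma signed_perm_id: "signed_perm id"
  by (auto simp: signed_perm_def)

lemma signed_perm_inv_letter: "signed_perm inv_letter"
  by (auto simp: signed_perm_def inj_def)

lemma signed_perm_bij: assumes "signed_perm \<pi>" shows "bij \<pi>"
proof -
  have "finite (UNIV :: letter set)" by (simp add: UNIV_letter)
  then show ?thesis using assms finite_UNIV_inj_surj by (auto simp: signed_perm_def bij_def)
qed

lemma signed_perm_the_inv: assumes "signed_perm \<pi>" shows "signed_perm (inv_into UNIV \<pi>)"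
proof -
  note b = signed_perm_bij[OF assms]
  have "inv_into UNIV \<pi> (inv_letter a) = inv_letter (inv_into UNIV \<pi> a)" for a
    using assms b unfolding signed_perm_def by (metis bij_inv_eq_iff)
  then show ?thesis using b by (auto simp: signed_perm_def bij_imp_bij_inv bij_is_inj)
qed

lemma map_inv_signed_perm: assumes "signed_perm \<pi>"
  shows "map (inv_into UNIV \<pi>) (map \<pi> w) = w" "map \<pi> (map (inv_into UNIV \<pi>) w) = w"
  using signed_perm_bij[OF assms]
  by (auto simp: bij_is_surj surj_f_inv_f bij_is_inj inv_f_f o_def map_idI)

lemma signed_perm_eq_inv_letter:
  "signed_perm \<pi> \<Longrightarrow> \<pi> b = inv_letter (\<pi> a) \<longleftrightarrow> b = inv_letter a"
  unfolding signed_perm_def inj_def by metis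

lemma reduced_map [simp]: "signed_perm \<pi> \<Longrightarrow> reduced (map \<pi> w) \<longleftrightarrow> reduced w"
  by (induction w) (auto simp: reduced_Cons hd_map signed_perm_eq_inv_letter)

lemma push_map: "signed_perm \<pi> \<Longrightarrow> push (\<pi> a) (map \<pi> w) = map \<pi> (push a w)"
  by (cases w) (auto simp: signed_perm_eq_inv_letter)

lemma free_reduce_map: "signed_perm \<pi> \<Longrightarrow> free_reduce (map \<pi> w) = map \<pi> (free_reduce w)"
  by (induction w) (auto simp: free_reduce_Cons push_map)

lemma winv_map: "signed_perm \<pi> \<Longrightarrow> winv (map \<pi> w) = map \<pi> (winv w)"
  by (induction w) (auto simp: signed_perm_def)

lemma conjF_map: assumes "signed_perm \<pi>" "conjF u v" shows "conjF (map \<pi> u) (map \<pi> v)"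
proof -
  obtain g where "v \<equiv>F winv g @ u @ g" using assms by (auto simp: conjF_def)
  then have "map \<pi> v \<equiv>F map \<pi> (winv g @ u @ g)" using assms by (simp add: free_reduce_map del: map_append)
  then show ?thesis by (intro conjFI[of _ "map \<pi> g"]) (simp add: winv_map assms)
qed

lemma cyc_reduced_map: "signed_perm \<pi> \<Longrightarrow> cyc_reduced (map \<pi> c) \<longleftrightarrow> cyc_reduced c"
  by (auto simp: cyc_reduced_def hd_map last_map signed_perm_eq_inv_letter)

text \<open>The transvection \<open>x \<mapsto> x y\<close>, \<open>y \<mapsto> y\<close> on letters and, as \<open>tv\<close>, on words.\<close>

definition tmap :: "letter \<Rightarrow> word" where
  "tmap c = (if c = px then [px, py] else if c = nx then [ny, nx] else [c])"

lemma tmap_simps [simp]: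
  "tmap px = [px, py]" "tmap nx = [ny, nx]" "tmap py = [py]" "tmap ny = [ny]"
  by (simp_all add: tmap_def)

definition tv :: "word \<Rightarrow> word" where
  "tv = ext tmap"

lemma sym_map_tmap: "sym_map tmap"
  unfolding sym_map_def
proof
  fix a show "tmap (inv_letter a) \<equiv>F winv (tmap a)"
    by (cases a rule: letter_cases) (auto simp: tmap_def)
qed

lemma reduced_tv [simp]: "reduced (tv w)" and tv_Nil [simp]: "tv [] = []"
  by (simp_all add: tv_def)

lemma conjF_tv: "conjF u v \<Longrightarrow> conjF (tv u) (tv v)"
  unfolding tv_def by (rule conjF_hom_ext[OF sym_map_tmap])

lemma tv_cong: "u \<equiv>F v \<Longrightarrow> tv u = tv v"
  unfolding tv_def by (rule ext_cong[OF sym_map_tmap])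

lemma tv_free_reduce: "tv (free_reduce u) = tv u"
  by (rule tv_cong) simp

text \<open>In the image of a reduced word under \<open>tv\<close>, cancellation only occurs at the digrams \<open>x y\<^sup>-\<^sup>1\<close> and
  \<open>y x\<^sup>-\<^sup>1\<close>, and these do not overlap. So one pass computes the reduced image, and the length of the
  image can be read off the digrams.\<close>

fun tr :: "word \<Rightarrow> word" where
  "tr [] = []"
| "tr [a] = tmap a"
| "tr (a # b # w) = (if a = px \<and> b = ny then px # tr w
     else if a = py \<and> b = nx then nx # tr w else tmap a @ tr (b # w))"

lemma tr_hd:
  "tr w = [] \<longleftrightarrow> w = []"
  "w \<noteq> [] \<Longrightarrow> hd (tr w) = (if hd w = px then px else if hd w = nx then ny else
     if hd w = py \<and> tl w \<noteq> [] \<and> hd (tl w) = nx then nx else hd w)"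
proof -
  show "tr w = [] \<longleftrightarrow> w = []" by (cases w rule: tr.cases) (auto simp: tmap_def)
  assume "w \<noteq> []"
  then show "hd (tr w) = (if hd w = px then px else if hd w = nx then ny else
     if hd w = py \<and> tl w \<noteq> [] \<and> hd (tl w) = nx then nx else hd w)"
  proof (cases w rule: tr.cases)
    case (2 a)
    then show ?thesis by (cases a rule: letter_cases) (auto simp: tmap_def)
  next
    case (3 a b v)
    then show ?thesis
      by (cases a rule: letter_cases) (auto simp: tmap_def)
  qed simp
qed

lemma reduced_tr: "reduced w \<Longrightarrow> reduced (tr w)"
proof (induction w rule: tr.induct)
  case (2 a)
  then show ?case by (cases a rule: letter_cases) (auto simp: tmap_def reduced_Cons)
next
  case (3 a b w)
  then have r: "reduced w" "reduced (b # w)" "b \<noteq> inv_letter a" "w \<noteq> [] \<longrightarrow> hd w \<noteq> inv_letter b"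
    by (auto simp: reduced_Cons)
  consider "a = px \<and> b = ny" | "a = py \<and> b = nx" | "\<not> (a = px \<and> b = ny)" "\<not> (a = py \<and> b = nx)"
    by blast
  then show ?case
  proof cases
    case 3
    then have "reduced (tr (b # w))" using "3.IH"(3) r by blast
    moreover have "tr (b # w) \<noteq> []" by (simp add: tr_hd)
    moreover have "hd (tr (b # w)) = (if b = px then px else if b = nx then ny else
     if b = py \<and> w \<noteq> [] \<and> hd w = nx then nx else b)" by (simp add: tr_hd)
    ultimately show ?thesis using 3 r
      by (cases a rule: letter_cases; cases b rule: letter_cases)
        (auto simp: tmap_def reduced_Cons split: if_splits)
  qed (use "3.IH" r in \<open>auto simp: reduced_Cons tr_hd split: if_splits\<close>)
qed simp

lemma tr_eqF: "concat (map tmap w) \<equiv>F tr w"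
proof (induction w rule: tr.induct)
  case (3 a b w)
  consider "a = px \<and> b = ny" | "a = py \<and> b = nx" | "\<not> (a = px \<and> b = ny)" "\<not> (a = py \<and> b = nx)"
    by blast
  then show ?case
  proof cases
    case 1
    have "px # py # ny # concat (map tmap w) \<equiv>F [px] @ concat (map tmap w)"
      using eqF_append[OF refl eqF_cancel_letter(2)[of py], of "[px]" "concat (map tmap w)"] by simp
    also have "\<dots> = free_reduce (px # tr w)" using 3 1 by (simp add: free_reduce_Cons)
    finally show ?thesis using 1 by simp
  next
    case 2
    have "py # ny # nx # concat (map tmap w) \<equiv>F nx # concat (map tmap w)"
      using eqF_cancel_letter(2)[of py] by simp
    also have "\<dots> = free_reduce (nx # tr w)" using 3 2 by (simp add: free_reduce_Cons)
    finally show ?thesis using 2 by simp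
  next
    case 3
    then have "concat (map tmap (b # w)) \<equiv>F tr (b # w)" using "3.IH"(3) by blast
    then have "tmap a @ concat (map tmap (b # w)) \<equiv>F tmap a @ tr (b # w)" by (rule eqF_append[OF refl])
    then show ?thesis using 3 by auto
  qed
qed simp_all

lemma tv_eq_tr: "reduced w \<Longrightarrow> tv w = tr w"
  by (simp add: tv_def ext_def tr_eqF reduced_tr)

abbreviation adj_count :: "word \<Rightarrow> letter \<Rightarrow> letter \<Rightarrow> nat" where
  "adj_count w a b \<equiv> count_list (zip w (tl w)) (a, b)"

abbreviation cyc_count :: "word \<Rightarrow> letter \<Rightarrow> letter \<Rightarrow> nat" where
  "cyc_count w a b \<equiv> count_list (zip w (rotate1 w)) (a, b)"

definition num_x :: "word \<Rightarrow> nat" where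
  "num_x w = count_list w px + count_list w nx"

definition num_y :: "word \<Rightarrow> nat" where
  "num_y w = count_list w py + count_list w ny"

lemma length_num: "length w = num_x w + num_y w"
proof (induction w)
  case (Cons a w)
  then show ?case by (cases a rule: letter_cases) (auto simp: num_x_def num_y_def)
qed (simp add: num_x_def num_y_def)

lemma num_x_tr: "num_x (tr w) = num_x w"
proof (induction w rule: tr.induct)
  case (3 a b w)
  then show ?case by (cases a rule: letter_cases) (auto simp: num_x_def tmap_def)
qed (auto simp: num_x_def tmap_def)

lemma length_tr:
  "length (tr w) + 2 * (adj_count w px ny + adj_count w py nx) = length w + num_x w"
proof (induction w rule: tr.induct)
  case (2 a)
  then show ?case by (cases a rule: letter_cases) (auto simp: num_x_def tmap_def)
next
  case (3 a b w)
  consider "a = px \<and> b = ny" | "a = py \<and> b = nx" | "\<not> (a = px \<and> b = ny)" "\<not> (a = py \<and> b = nx)"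
    by blast
  then show ?case
  proof cases
    case 3
    then have "length (tr (b # w)) + 2 * (adj_count (b # w) px ny + adj_count (b # w) py nx)
      = length (b # w) + num_x (b # w)" using "3.IH"(3) by blast
    then show ?thesis using 3
      by (cases a rule: letter_cases; cases b rule: letter_cases) (auto simp: num_x_def tmap_def)
  qed (use "3.IH" in \<open>cases w; auto simp: num_x_def\<close>)+
qed (auto simp: num_x_def)

section \<open>Counting cyclic digrams\<close>

lemma zip_rotate1: "length u = length v \<Longrightarrow> zip (rotate1 u) (rotate1 v) = rotate1 (zip u v)"
  by (cases u; cases v) auto

lemma count_list_rotate1 [simp]: "count_list (rotate1 w) a = count_list w a"
  by (cases w) auto

lemma cyc_count_rotate: "cyc_count (rotate n w) a b = cyc_count w a b"
  by (induction n) (simp_all add: zip_rotate1)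

lemma num_x_rotate: "num_x (rotate n w) = num_x w"
  by (induction n) (simp_all add: num_x_def)

lemma cyc_count_out:
  "cyc_count w a px + cyc_count w a nx + cyc_count w a py + cyc_count w a ny = count_list w a"
proof -
  have "count_list ps (a, px) + count_list ps (a, nx) + count_list ps (a, py) + count_list ps (a, ny)
      = count_list (map fst ps) a" for ps :: "(letter \<times> letter) list"
  proof (induction ps)
    case (Cons p ps)
    then show ?case by (cases p; cases "snd p" rule: letter_cases) auto
  qed simp
  from this[of "zip w (rotate1 w)"] show ?thesis by simp
qed

lemma cyc_count_in:
  "cyc_count w px a + cyc_count w nx a + cyc_count w py a + cyc_count w ny a = count_list w a"
proof -
  have "count_list ps (px, a) + count_list ps (nx, a) + count_list ps (py, a) + count_list ps (ny, a)
      = count_list (map snd ps) a" for ps :: "(letter \<times> letter) list"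
  proof (induction ps)
    case (Cons p ps)
    then show ?case by (cases p; cases "fst p" rule: letter_cases) auto
  qed simp
  from this[of "zip w (rotate1 w)"] show ?thesis by simp
qed

lemma cyc_count_adj:
  "w \<noteq> [] \<Longrightarrow> cyc_count w a b = adj_count w a b + (if last w = a \<and> hd w = b then 1 else 0)"
proof -
  have "zip (c # v) (v @ [d]) = zip (c # v) v @ [(last (c # v), d)]" for c d and v :: word
    by (induction v arbitrary: c) auto
  moreover assume "w \<noteq> []"
  ultimately show ?thesis by (cases w) auto
qed

lemma adj_count_inv_letter: "reduced w \<Longrightarrow> adj_count w a (inv_letter a) = 0"
proof (induction w)
  case (Cons b w)
  then show ?case by (cases w) (auto simp: reduced_Cons)
qed simp

lemma cyc_count_inv_letter: "cyc_reduced c \<Longrightarrow> cyc_count c a (inv_letter a) = 0"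
  by (cases "c = []") (auto simp: cyc_count_adj adj_count_inv_letter cyc_reduced_def)

lemma count_list_map_inj: "inj f \<Longrightarrow> count_list (map f ws) (f a) = count_list ws a"
  by (induction ws) (auto simp: inj_def)

lemma cyc_count_map:
  assumes "signed_perm \<pi>"
  shows "cyc_count (map \<pi> w) (\<pi> a) (\<pi> b) = cyc_count w a b"
proof -
  have "inj (map_prod \<pi> \<pi>)" using assms by (auto simp: signed_perm_def prod.inj_map)
  from count_list_map_inj[OF this, of "zip w (rotate1 w)" "(a, b)"]
  show ?thesis by (simp add: zip_map_map map_prod_def rotate1_map case_prod_beta)
qed

lemma tmap_neq_Nil [simp]: "tmap a \<noteq> []"
  by (simp add: tmap_def)

lemma tr_last: "w \<noteq> [] \<Longrightarrow> last (tr w) = nx \<longleftrightarrow> last w = nx"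
proof (induction w rule: tr.induct)
  case (2 a)
  then show ?case by (cases a rule: letter_cases) auto
next
  case (3 a b w)
  consider "a = px \<and> b = ny" | "a = py \<and> b = nx" | "\<not> (a = px \<and> b = ny)" "\<not> (a = py \<and> b = nx)"
    by blast
  then show ?case
  proof cases
    case 3
    then show ?thesis using "3.IH"(3) by (auto simp: tr_hd)
  qed (use "3.IH" in \<open>cases "w = []"; auto simp: tr_hd\<close>)+
qed simp

lemma tr_no_x: "num_x w = 0 \<Longrightarrow> tr w = w"
proof (induction w rule: tr.induct)
  case (3 a b w)
  then show ?case by (cases a rule: letter_cases) (auto simp: num_x_def split: if_splits)
next
  case (2 a)
  then show ?case by (cases a rule: letter_cases) (auto simp: num_x_def split: if_splits)
qed simp

text \<open>If the cyclic word is cut before an \<open>x\<close> or after an \<open>x\<^sup>-\<^sup>1\<close>, then nothing cancels across the cut,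
  and the digram at the cut is not among those that shorten the word. Every cyclic word that contains
  \<open>x\<^sup>\<plusminus>\<^sup>1\<close> can be cut in this way.\<close>

lemma cyc_reduced_tr:
  assumes "cyc_reduced d" "d \<noteq> []" "hd d = px \<or> last d = nx"
  shows "cyc_reduced (tr d)"
    and "length (tr d) + 2 * (cyc_count d px ny + cyc_count d py nx) = length d + num_x d"
proof -
  have "hd (tr d) \<noteq> inv_letter (last (tr d))"
  proof (cases "hd d = px")
    case True
    then have "last d \<noteq> nx" using assms by (auto simp: cyc_reduced_def)
    then have "last (tr d) \<noteq> nx" using tr_last assms by blast
    moreover have "hd (tr d) = px" using True assms by (simp add: tr_hd)
    ultimately show ?thesis by (metis inv_letter_Pair inv_letter_swap)
  next
    case False
    then have "last (tr d) = nx" using tr_last assms by blast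
    moreover have "hd (tr d) \<noteq> px" using False assms by (simp add: tr_hd)
    ultimately show ?thesis by simp
  qed
  then show "cyc_reduced (tr d)" using assms reduced_tr by (auto simp: cyc_reduced_def)
  show "length (tr d) + 2 * (cyc_count d px ny + cyc_count d py nx) = length d + num_x d"
    using length_tr[of d] assms by (auto simp: cyc_count_adj)
qed

lemma tv_cyc_reduced:
  assumes c: "cyc_reduced c"
  shows "\<exists>d. cyc_reduced d \<and> conjF (tv c) d \<and> num_x d = num_x c \<and>
    length d + 2 * (cyc_count c px ny + cyc_count c py nx) = length c + num_x c"
proof (cases "num_x c = 0")
  case True
  have "cyc_count c px ny = 0" "cyc_count c py nx = 0"
    using True cyc_count_out[of c px] cyc_count_in[of c nx] by (auto simp: num_x_def)
  moreover have "tv c = c" using c tv_eq_tr tr_no_x[OF True] by (simp add: cyc_reduced_def)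
  ultimately show ?thesis using True c by (intro exI[of _ c]) auto
next
  case False
  have "\<exists>n. rotate n c \<noteq> [] \<and> (hd (rotate n c) = px \<or> last (rotate n c) = nx)"
  proof (cases "px \<in> set c")
    case True
    then obtain u v where "c = u @ px # v" by (meson split_list)
    then show ?thesis by (intro exI[of _ "length u"]) (simp add: rotate_append)
  next
    case False
    then have "nx \<in> set c" using \<open>num_x c \<noteq> 0\<close> by (metis add_is_0 count_list_0_iff num_x_def)
    then obtain u v where "c = (u @ [nx]) @ v" by (auto dest: split_list)
    moreover have "rotate (length (u @ [nx])) ((u @ [nx]) @ v) = v @ u @ [nx]"
      by (subst rotate_append) simp
    ultimately have "rotate (length (u @ [nx])) c \<noteq> []" "last (rotate (length (u @ [nx])) c) = nx"
      by simp_all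
    then show ?thesis by blast
  qed
  then obtain n where n: "rotate n c \<noteq> []" "hd (rotate n c) = px \<or> last (rotate n c) = nx" by blast
  let ?d = "rotate n c"
  have d: "cyc_reduced ?d" using c by (rule cyc_reduced_rotate)
  have "conjF (tv c) (tv ?d)" by (intro conjF_tv conjF_rotate)
  moreover have "tv ?d = tr ?d" using d by (simp add: tv_eq_tr cyc_reduced_def)
  ultimately show ?thesis
    using cyc_reduced_tr[OF d n] by (intro exI[of _ "tr ?d"]) (simp add: num_x_tr num_x_rotate cyc_count_rotate)
qed

text \<open>Digrams and letters of the cyclic word of \<open>w\<close>; these are class functions.\<close>

abbreviation kc :: "word \<Rightarrow> letter \<Rightarrow> letter \<Rightarrow> nat" where
  "kc w a b \<equiv> cyc_count (core w) a b"

abbreviation kx :: "word \<Rightarrow> nat" where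
  "kx w \<equiv> num_x (core w)"

abbreviation ky :: "word \<Rightarrow> nat" where
  "ky w \<equiv> num_y (core w)"

lemma kc_cyc_reduced: "cyc_reduced c \<Longrightarrow> kc c a b = cyc_count c a b"
  using core_rotate[of c] by (auto simp: cyc_count_rotate)

lemma kx_cyc_reduced: "cyc_reduced c \<Longrightarrow> kx c = num_x c"
  using core_rotate[of c] by (auto simp: num_x_rotate)

lemma core_map:
  assumes "signed_perm \<pi>"
  shows "\<exists>n. core (map \<pi> w) = rotate n (map \<pi> (core w))"
  using assms by (intro conjF_cyc_reduced_rotate)
    (auto simp: cyc_reduced_map core intro: conjF_trans[OF conjF_sym[OF conjF_map[OF assms core(2)]]])

lemma clen_map: "signed_perm \<pi> \<Longrightarrow> clen (map \<pi> w) = clen w"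
  using core_map[of \<pi> w] by auto

lemma kc_map: "signed_perm \<pi> \<Longrightarrow> kc (map \<pi> w) (\<pi> a) (\<pi> b) = kc w a b"
  using core_map[of \<pi> w] cyc_count_map[of \<pi> "core w" a b] by (auto simp: cyc_count_rotate)

lemma clen_tv: "clen (tv w) + 2 * (kc w px ny + kc w py nx) = clen w + kx w"
  and kx_tv: "kx (tv w) = kx w"
proof -
  obtain d where d: "cyc_reduced d" "conjF (tv (core w)) d" "num_x d = num_x (core w)"
    "length d + 2 * (kc w px ny + kc w py nx) = clen w + kx w"
    using tv_cyc_reduced[OF core(1)] by metis
  have "core (tv w) = core d"
    using conjF_trans[OF conjF_tv[OF core(2)] d(2)] by (simp add: core_eq_iff)
  then show "clen (tv w) + 2 * (kc w px ny + kc w py nx) = clen w + kx w" "kx (tv w) = kx w"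
    using d clen_cyc_reduced kx_cyc_reduced by auto
qed

lemma clen_sum: "clen w = kx w + ky w"
  by (rule length_num)

text \<open>Every letter of a cyclic word has one predecessor and one successor.\<close>

lemma kc_balance:
  "kc w px nx = 0" "kc w nx px = 0" "kc w py ny = 0" "kc w ny py = 0"
  "kc w px py + kc w px ny = kc w py px + kc w ny px"
  "kc w nx py + kc w nx ny = kc w py nx + kc w ny nx"
  "kc w py px + kc w py nx = kc w px py + kc w nx py"
  "kc w ny px + kc w ny nx = kc w px ny + kc w nx ny"
  "kx w = kc w px px + kc w nx nx + (kc w px py + kc w px ny) + (kc w nx py + kc w nx ny)"
  "ky w = kc w py py + kc w ny ny + (kc w py px + kc w py nx) + (kc w ny px + kc w ny nx)"
proof -
  note z = cyc_count_inv_letter[OF core(1)[of w]]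
  show z1: "kc w px nx = 0" "kc w nx px = 0" "kc w py ny = 0" "kc w ny py = 0"
    using z[of px] z[of nx] z[of py] z[of ny] by simp_all
  note s = cyc_count_in[of "core w" px] cyc_count_in[of "core w" nx]
    cyc_count_in[of "core w" py] cyc_count_in[of "core w" ny]
    cyc_count_out[of "core w" px] cyc_count_out[of "core w" nx]
    cyc_count_out[of "core w" py] cyc_count_out[of "core w" ny]
  show
  "kc w px py + kc w px ny = kc w py px + kc w ny px"
  "kc w nx py + kc w nx ny = kc w py nx + kc w ny nx"
  "kc w py px + kc w py nx = kc w px py + kc w nx py"
  "kc w ny px + kc w ny nx = kc w px ny + kc w nx ny"
  "kx w = kc w px px + kc w nx nx + (kc w px py + kc w px ny) + (kc w nx py + kc w nx ny)"
  "ky w = kc w py py + kc w ny ny + (kc w py px + kc w py nx) + (kc w ny px + kc w ny nx)"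
    unfolding num_x_def num_y_def using s z1 by linarith+
qed

lemma kx_ky_map:
  "kx (map (sp (X1, s) (X2, t)) w) = kx w" "ky (map (sp (X1, s) (X2, t)) w) = ky w"
  "kx (map (sp (X2, s) (X1, t)) w) = ky w" "ky (map (sp (X2, s) (X1, t)) w) = kx w"
proof -
  have *: "num_x (map \<pi> v) = count_list v a + count_list v (inv_letter a)"
    if "signed_perm \<pi>" "\<pi> a = px" for \<pi> v a
  proof -
    have "\<pi> (inv_letter a) = nx" using signed_perm_inv[OF that(1), of a] that(2) by simp
    then show ?thesis
      using count_list_map_inj[of \<pi> v a] count_list_map_inj[of \<pi> v "inv_letter a"] that
      by (simp add: num_x_def signed_perm_def)
  qed
  have 1: "signed_perm (sp (X1, s) (X2, t))" "signed_perm (sp (X2, s) (X1, t))"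
    by (simp_all add: signed_perm_sp)
  show kx: "kx (map (sp (X1, s) (X2, t)) w) = kx w"
    using core_map[OF 1(1), of w] *[OF 1(1), of "(X1, s)" "core w"]
    by (cases s) (auto simp: num_x_rotate sp_def num_x_def[of "core w"])
  show ky: "kx (map (sp (X2, s) (X1, t)) w) = ky w"
    using core_map[OF 1(2), of w] *[OF 1(2), of "(X2, t)" "core w"]
    by (cases t) (auto simp: num_x_rotate sp_def num_y_def[of "core w"])
  show "ky (map (sp (X1, s) (X2, t)) w) = ky w"
    using clen_map[OF 1(1), of w] kx clen_sum[of w] clen_sum[of "map (sp (X1, s) (X2, t)) w"] by linarith
  show "ky (map (sp (X2, s) (X1, t)) w) = kx w"
    using clen_map[OF 1(2), of w] ky clen_sum[of w] clen_sum[of "map (sp (X2, s) (X1, t)) w"] by linarith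
qed

section \<open>Triangles of transvections\<close>

lemma core_free_reduce [simp]: "core (free_reduce w) = core w"
  by (simp add: core_eq_iff conjF_eqF)

lemma ext_conj:
  assumes "\<And>a. f a \<equiv>F winv h @ g a @ h"
  shows "conjF (ext f w) (ext g w)"
proof -
  have "concat (map f w) \<equiv>F winv h @ concat (map g w) @ h"
  proof (induction w)
    case (Cons a w)
    have "f a @ concat (map f w) \<equiv>F (winv h @ g a @ h) @ (winv h @ concat (map g w) @ h)"
      by (rule eqF_append[OF assms Cons])
    also have "\<dots> = free_reduce ((winv h @ g a) @ h @ winv h @ (concat (map g w) @ h))"
      by simp
    also have "\<dots> = free_reduce ((winv h @ g a) @ (concat (map g w) @ h))"
      by (rule eqF_winv_mid)
    finally show ?case by simp
  qed simp
  then have "conjF (concat (map g w)) (concat (map f w))" by (rule conjFI)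
  then have "core (ext g w) = core (ext f w)"
    unfolding ext_def by (simp add: core_free_reduce core_eq_iff)
  then show ?thesis by (simp add: core_eq_iff[symmetric])
qed

lemma tv_map_tv:
  assumes "signed_perm \<pi>"
  shows "tv (map \<pi> (tv w)) = ext (\<lambda>a. concat (map tmap (map \<pi> (tmap a)))) w"
proof -
  have "map \<pi> (tv w) = free_reduce (map \<pi> (concat (map tmap w)))"
    by (simp add: tv_def ext_def free_reduce_map assms)
  then have "tv (map \<pi> (tv w)) = tv (map \<pi> (concat (map tmap w)))"
    by (simp add: tv_free_reduce)
  also have "concat (map tmap (map \<pi> (concat (map tmap w))))
      = concat (map (\<lambda>a. concat (map tmap (map \<pi> (tmap a)))) w)"
    by (induction w) auto
  then have "tv (map \<pi> (concat (map tmap w))) = ext (\<lambda>a. concat (map tmap (map \<pi> (tmap a)))) w"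
    by (simp add: tv_def ext_def)
  finally show ?thesis .
qed

lemma map_tv_map:
  assumes "signed_perm \<rho>"
  shows "map \<rho> (tv (map \<sigma> w)) = ext (\<lambda>a. map \<rho> (tmap (\<sigma> a))) w"
proof -
  have "map \<rho> (tv (map \<sigma> w)) = free_reduce (map \<rho> (concat (map tmap (map \<sigma> w))))"
    by (simp add: tv_def ext_def free_reduce_map assms)
  also have "map \<rho> (concat (map tmap (map \<sigma> w))) = concat (map (\<lambda>a. map \<rho> (tmap (\<sigma> a))) w)"
    by (induction w) auto
  finally show ?thesis by (simp add: ext_def)
qed

lemma map_eq_ext: "free_reduce (map \<rho> w) = ext (\<lambda>a. [\<rho> a]) w"
proof -
  have "map \<rho> w = concat (map (\<lambda>a. [\<rho> a]) w)" by (induction w) auto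
  then show ?thesis by (simp add: ext_def)
qed

text \<open>Four of the words \<open>tv \<pi> tv w\<close> are, up to conjugation and signed permutations, the word \<open>w\<close> itself or another image of
  \<open>w\<close> under a single transvection. In the first two cases \<open>\<pi>\<close> inverts one generator, which
  turns \<open>tv\<close> into its inverse; in the other two, \<open>\<pi>\<close> is a rotation of order four.\<close>

lemma tv_inv_y_tv: "tv (map (sp px ny) (tv w)) = free_reduce (map (sp px ny) w)"
  unfolding tv_map_tv[OF signed_perm_sp[of px ny, simplified]] map_eq_ext ext_def
proof (induction w)
  case (Cons a w)
  have "concat (map tmap (map (sp px ny) (tmap a))) \<equiv>F [sp px ny a]"
    by (cases a rule: letter_cases) (auto simp: sp_def free_reduce_Cons)
  from eqF_append[OF this Cons] show ?case by simp
qed simp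

lemma tv_inv_x_tv: "conjF (tv (map (sp nx py) (tv w))) (map (sp nx py) w)"
proof -
  have "concat (map tmap (map (sp nx py) (tmap a))) \<equiv>F winv [py] @ [sp nx py a] @ [py]" for a
    by (cases a rule: letter_cases) (auto simp: sp_def free_reduce_Cons)
  then have "conjF (tv (map (sp nx py) (tv w))) (free_reduce (map (sp nx py) w))"
    unfolding tv_map_tv[OF signed_perm_sp[of nx py, simplified]] map_eq_ext by (rule ext_conj)
  then show ?thesis by (simp add: core_eq_iff[symmetric])
qed

lemma tv_rotation_tv:
  "conjF (tv (map (sp py nx) (tv w))) (map (sp ny nx) (tv (map (sp py px) w)))"
proof -
  have "concat (map tmap (map (sp py nx) (tmap a))) \<equiv>F winv [] @ map (sp ny nx) (tmap (sp py px a)) @ []" for a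
    by (cases a rule: letter_cases) (auto simp: sp_def free_reduce_Cons)
  then show ?thesis
    unfolding tv_map_tv[OF signed_perm_sp[of py nx, simplified]]
      map_tv_map[OF signed_perm_sp[of ny nx, simplified]] by (rule ext_conj)
qed

lemma tv_rotation_tv':
  "conjF (tv (map (sp ny px) (tv w))) (map (sp py px) (tv (map (sp py px) w)))"
proof -
  have "concat (map tmap (map (sp ny px) (tmap a))) \<equiv>F winv [py] @ map (sp py px) (tmap (sp py px a)) @ [py]" for a
    by (cases a rule: letter_cases) (auto simp: sp_def free_reduce_Cons)
  then show ?thesis
    unfolding tv_map_tv[OF signed_perm_sp[of ny px, simplified]]
      map_tv_map[OF signed_perm_sp[of py px, simplified]] by (rule ext_conj)
qed

lemma tv_inv_letter: "conjF (tv (map inv_letter w)) (map inv_letter (tv w))"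
proof -
  have 1: "tv (map inv_letter w) = ext (\<lambda>a. tmap (inv_letter a)) w"
    using map_tv_map[OF signed_perm_id, of inv_letter w] by simp
  have 2: "map inv_letter (tv w) = ext (\<lambda>a. map inv_letter (tmap a)) w"
    using map_tv_map[OF signed_perm_inv_letter, of "\<lambda>a. a" w] by simp
  have "tmap (inv_letter a) \<equiv>F winv [py] @ map inv_letter (tmap a) @ [py]" for a
    by (cases a rule: letter_cases) (auto simp: free_reduce_Cons)
  then show ?thesis unfolding 1 2 by (rule ext_conj)
qed

text \<open>The letters \<open>(X1, s)\<close> and \<open>(X2, t)\<close> are mapped to \<open>x\<close> and \<open>y\<close> in some order, so the digrams that
  shorten the image are the same whether or not \<open>\<pi>\<close> interchanges the generators; only the
  letter that is counted changes. For \<open>s = t\<close>, the digrams are \<open>x y\<^sup>-\<^sup>1\<close> and \<open>y x\<^sup>-\<^sup>1\<close>, or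
  \<open>x\<^sup>-\<^sup>1 y\<close> and \<open>y\<^sup>-\<^sup>1 x\<close>, which are equally frequent.\<close>

lemma clen_tv_sp:
  "clen (tv (map (sp (X1, s) (X2, t)) w)) + 2 * (kc w (X1, s) (X2, \<not> t) + kc w (X2, t) (X1, \<not> s))
    = clen w + kx w"
  "clen (tv (map (sp (X2, s) (X1, t)) w)) + 2 * (kc w (X1, s) (X2, \<not> t) + kc w (X2, t) (X1, \<not> s))
    = clen w + ky w"
proof -
  let ?\<pi> = "sp (X1, s) (X2, t)" and ?\<rho> = "sp (X2, s) (X1, t)"
  have \<pi>: "signed_perm ?\<pi>" and \<rho>: "signed_perm ?\<rho>" by (simp_all add: signed_perm_sp)
  have 1: "?\<pi> (X1, s) = px" "?\<pi> (X2, \<not> t) = ny" "?\<pi> (X2, t) = py" "?\<pi> (X1, \<not> s) = nx"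
    and 2: "?\<rho> (X1, s) = py" "?\<rho> (X2, \<not> t) = nx" "?\<rho> (X2, t) = px" "?\<rho> (X1, \<not> s) = ny"
    by (auto simp: sp_def)
  show "clen (tv (map ?\<pi> w)) + 2 * (kc w (X1, s) (X2, \<not> t) + kc w (X2, t) (X1, \<not> s))
    = clen w + kx w"
    using clen_tv[of "map ?\<pi> w"] kc_map[OF \<pi>, of w "(X1, s)" "(X2, \<not> t)"]
      kc_map[OF \<pi>, of w "(X2, t)" "(X1, \<not> s)"] unfolding 1 clen_map[OF \<pi>] kx_ky_map by simp
  show "clen (tv (map ?\<rho> w)) + 2 * (kc w (X1, s) (X2, \<not> t) + kc w (X2, t) (X1, \<not> s))
    = clen w + ky w"
    using clen_tv[of "map ?\<rho> w"] kc_map[OF \<rho>, of w "(X1, s)" "(X2, \<not> t)"]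
      kc_map[OF \<rho>, of w "(X2, t)" "(X1, \<not> s)"] unfolding 2 clen_map[OF \<rho>] kx_ky_map by simp
qed

lemma clen_tv_sp_same:
  "clen (tv (map (sp (X1, s) (X2, s)) w)) + 2 * (kc w px ny + kc w py nx) = clen w + kx w"
  "clen (tv (map (sp (X2, s) (X1, s)) w)) + 2 * (kc w px ny + kc w py nx) = clen w + ky w"
proof -
  have "kc w px ny + kc w py nx = kc w nx py + kc w ny px"
    using kc_balance(5-8)[of w] by linarith
  then have "kc w px ny + kc w py nx = kc w (X1, s) (X2, \<not> s) + kc w (X2, s) (X1, \<not> s)"
    by (cases s) simp_all
  then show
    "clen (tv (map (sp (X1, s) (X2, s)) w)) + 2 * (kc w px ny + kc w py nx) = clen w + kx w"
    "clen (tv (map (sp (X2, s) (X1, s)) w)) + 2 * (kc w px ny + kc w py nx) = clen w + ky w"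
    using clen_tv_sp[of s s w] by simp_all
qed

text \<open>Here \<open>p\<close> and \<open>q\<close> are the two kinds of mixed digrams, \<open>x\<close> and \<open>y\<close> the numbers of squares of the
  two generators, and \<open>a\<close>, \<open>b\<close>, \<open>c\<close> the lengths of \<open>w\<close>, \<open>tv w\<close> and a neighbour of \<open>tv w\<close> in the
  other triangle.\<close>

lemma digram_arith:
  fixes a b c k p q :: nat
  assumes "k = x + p + q"
  shows "a \<le> b \<Longrightarrow> a + 2 * q = b + k \<Longrightarrow> c < b \<Longrightarrow> c + 2 * p = b + k' \<Longrightarrow> k' = y + p + q \<Longrightarrow> False"
    and "a = b \<Longrightarrow> a + 2 * q = b + k \<Longrightarrow> c = b \<Longrightarrow> c + 2 * p = b + k \<Longrightarrow> x = 0"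
proof -
  assume 1: "a \<le> b" "a + 2 * q = b + k" and 2: "c < b" "c + 2 * p = b + k'" "k' = y + p + q"
  from 1 assms have "p \<le> q" by linarith
  moreover from 2 have "q < p" by linarith
  ultimately show False by simp
qed (use assms in linarith)

lemma kx_ky_digrams:
  "kx w = (kc w px px + kc w nx nx) + (kc w px ny + kc w py nx) + (kc w px py + kc w ny nx)"
  "ky w = (kc w py py + kc w ny ny) + (kc w px ny + kc w py nx) + (kc w px py + kc w ny nx)"
  using kc_balance(5-10)[of w] by linarith+

lemma clen_tv_inverse: "clen w + 2 * (kc (tv w) px py + kc (tv w) ny nx) = clen (tv w) + kx (tv w)"
proof -
  have "clen (tv (map (sp px ny) (tv w))) = clen w"
    using clen_map[OF signed_perm_sp[of px ny]] by (simp add: tv_inv_y_tv)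
  then show ?thesis using clen_tv_sp(1)[of True False "tv w"] by simp
qed

text \<open>\<open>same_triangle w v\<close>: up to conjugation and signed permutations, \<open>v\<close> is \<open>w\<close> or a neighbour of
  \<open>w\<close>. It is used for neighbours \<open>v\<close> of \<open>tv w\<close>, where it says that passing through \<open>tv w\<close> can be
  avoided.\<close>

definition same_triangle :: "word \<Rightarrow> word \<Rightarrow> bool" where
  "same_triangle w v \<longleftrightarrow> (\<exists>\<rho>. signed_perm \<rho> \<and> conjF v (map \<rho> w)) \<or>
     (\<exists>\<rho> \<sigma>. signed_perm \<rho> \<and> signed_perm \<sigma> \<and> conjF v (map \<rho> (tv (map \<sigma> w))))"

lemma same_triangleI:
  "s \<noteq> t \<Longrightarrow> same_triangle w (tv (map (sp (X1, s) (X2, t)) (tv w)))"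
  "s \<noteq> t \<Longrightarrow> same_triangle w (tv (map (sp (X2, s) (X1, t)) (tv w)))"
proof -
  assume st: "s \<noteq> t"
  show "same_triangle w (tv (map (sp (X1, s) (X2, t)) (tv w)))"
  proof (cases s)
    case True
    have "conjF (tv (map (sp px ny) (tv w))) (map (sp px ny) w)"
      unfolding tv_inv_y_tv by (rule conjF_eqF) simp
    then show ?thesis unfolding same_triangle_def using True st signed_perm_sp[of px ny] by auto
  next
    case False
    then show ?thesis unfolding same_triangle_def
      using tv_inv_x_tv[of w] st signed_perm_sp[of nx py] by auto
  qed
  show "same_triangle w (tv (map (sp (X2, s) (X1, t)) (tv w)))"
    unfolding same_triangle_def
    using tv_rotation_tv[of w] tv_rotation_tv'[of w] st
      signed_perm_sp[of ny nx] signed_perm_sp[of py px] by (cases s) auto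
qed

text \<open>If \<open>s = t\<close>, the neighbour lies in the triangle at \<open>tv w\<close> that does not contain \<open>w\<close>. Going back to
  \<open>w\<close> does not increase the length, so the mixed digrams of the first kind are at most as frequent as
  those of the second kind, and a step into the other triangle cannot decrease the length.\<close>

lemma peak:
  assumes "clen w \<le> clen (tv w)" "signed_perm \<pi>" "clen (tv (map \<pi> (tv w))) < clen (tv w)"
  shows "same_triangle w (tv (map \<pi> (tv w)))"
  using assms(2)
proof (cases \<pi> rule: signed_perm_cases)
  case (1 s t)
  have "s \<noteq> t"
  proof
    assume st: "s = t"
    show False
      using digram_arith(1)[OF kx_ky_digrams(1)[of "tv w"] assms(1) clen_tv_inverse _
          clen_tv_sp_same(1)[of t "tv w"] kx_ky_digrams(1)[of "tv w"]] assms(3)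
      unfolding 1 st by blast
  qed
  then show ?thesis unfolding 1 by (rule same_triangleI)
next
  case (2 s t)
  have "s \<noteq> t"
  proof
    assume st: "s = t"
    show False
      using digram_arith(1)[OF kx_ky_digrams(1)[of "tv w"] assms(1) clen_tv_inverse _
          clen_tv_sp_same(2)[of t "tv w"] kx_ky_digrams(2)[of "tv w"]] assms(3)
      unfolding 2 st by blast
  qed
  then show ?thesis unfolding 2 by (rule same_triangleI)
qed

text \<open>No generator occurs twice in succession, with equal sign, in the cyclic word; letters \<open>x\<^sup>\<plusminus>\<^sup>1\<close> and
  \<open>y\<^sup>\<plusminus>\<^sup>1\<close> then alternate, because inverse letters are never neighbours.\<close>

definition alternating :: "word \<Rightarrow> bool" where
  "alternating w \<longleftrightarrow> (\<forall>a. kc w a a = 0)"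

lemma alternatingI:
  "kc w px px = 0 \<Longrightarrow> kc w nx nx = 0 \<Longrightarrow> kc w py py = 0 \<Longrightarrow> kc w ny ny = 0 \<Longrightarrow> alternating w"
  unfolding alternating_def
proof
  fix a assume "kc w px px = 0" "kc w nx nx = 0" "kc w py py = 0" "kc w ny ny = 0"
  then show "kc w a a = 0" by (cases a rule: letter_cases) simp_all
qed

text \<open>A path of constant length can leave a triangle only if, in the notation of \<open>digram_arith\<close>, both
  \<open>x + p \<le> q\<close> and \<open>x + q \<le> p\<close>, which forces \<open>x = 0\<close>; as both generators are equally frequent, there
  are no squares of \<open>y\<close> either.\<close>

lemma level_branching:
  assumes "clen w = clen (tv w)" "signed_perm \<pi>" "clen (tv (map \<pi> (tv w))) = clen (tv w)"
    and "kx (tv w) = ky (tv w)"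
  shows "same_triangle w (tv (map \<pi> (tv w))) \<or> alternating (tv w)"
  using assms(2)
proof (cases \<pi> rule: signed_perm_cases)
  case (1 s t)
  have "alternating (tv w)" if "s = t"
  proof -
    have "clen (tv (map \<pi> (tv w))) + 2 * (kc (tv w) px ny + kc (tv w) py nx) = clen (tv w) + kx (tv w)"
      using clen_tv_sp_same(1)[of t "tv w"] assms(4) unfolding 1 that by simp
    from digram_arith(2)[OF kx_ky_digrams(1)[of "tv w"] assms(1) clen_tv_inverse assms(3) this]
    have "kc (tv w) px px + kc (tv w) nx nx = 0" .
    then show ?thesis using kx_ky_digrams[of "tv w"] assms(4) by (intro alternatingI) linarith+
  qed
  then show ?thesis using same_triangleI(1)[of s t w] 1 by blast
next
  case (2 s t)
  have "alternating (tv w)" if "s = t"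
  proof -
    have "clen (tv (map \<pi> (tv w))) + 2 * (kc (tv w) px ny + kc (tv w) py nx) = clen (tv w) + kx (tv w)"
      using clen_tv_sp_same(2)[of t "tv w"] assms(4) unfolding 2 that by simp
    from digram_arith(2)[OF kx_ky_digrams(1)[of "tv w"] assms(1) clen_tv_inverse assms(3) this]
    have "kc (tv w) px px + kc (tv w) nx nx = 0" .
    then show ?thesis using kx_ky_digrams[of "tv w"] assms(4) by (intro alternatingI) linarith+
  qed
  then show ?thesis using same_triangleI(2)[of s t w] 2 by blast
qed

section \<open>Iterating the transvection\<close>

text \<open>The signs of the letters \<open>x\<^sup>\<plusminus>\<^sup>1\<close> alternate, the first one being \<open>b\<close> and the last one negative (\<open>b\<close>
  is positive if there are none). For a cyclic word that starts with \<open>x\<close>, \<open>alternates True\<close> thus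
  says that the signs alternate cyclically.\<close>

fun alternates :: "bool \<Rightarrow> word \<Rightarrow> bool" where
  "alternates b [] = b"
| "alternates b (a # w) =
    (if fst a = X1 then snd a = b \<and> alternates (\<not> b) w else alternates b w)"

text \<open>The letters \<open>y\<close> inserted behind \<open>x\<close> and \<open>y\<^sup>-\<^sup>1\<close> inserted before \<open>x\<^sup>-\<^sup>1\<close> move through the powers of
  \<open>y\<close> between them and cancel. If the word begins with \<open>x\<^sup>-\<^sup>1\<close>, one \<open>y\<^sup>-\<^sup>1\<close> remains.\<close>

lemma alternates_tv:
  "alternates b w \<Longrightarrow> concat (map tmap w) \<equiv>F (if b then w else ny # w)"
proof (induction b w rule: alternates.induct)
  case (2 b a w)
  show ?case
  proof (cases a rule: letter_cases)
    case 1
    then have h: "concat (map tmap w) \<equiv>F ny # w" and b: "b" using 2 by (auto split: if_splits)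
    have "[px, py] @ concat (map tmap w) \<equiv>F [px, py] @ ny # w"
      by (rule eqF_append[OF refl h])
    also have "[px, py] @ ny # w \<equiv>F px # w"
      using eqF_append[OF refl eqF_cancel_letter(2)[of py w], of "[px]"] by simp
    finally show ?thesis using 1 b by simp
  next
    case 2
    then have h: "concat (map tmap w) \<equiv>F w" and b: "\<not> b"
      using "2.prems" "2.IH"(1) by (auto split: if_splits)
    have "[ny, nx] @ concat (map tmap w) \<equiv>F [ny, nx] @ w"
      by (rule eqF_append[OF refl h])
    then show ?thesis using 2 b by simp
  next
    case 3
    then have h: "concat (map tmap w) \<equiv>F (if b then w else ny # w)"
      using "2.prems" "2.IH"(2) by auto
    have "[py] @ concat (map tmap w) \<equiv>F [py] @ (if b then w else ny # w)"
      by (rule eqF_append[OF refl h])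
    also have "[py] @ (if b then w else ny # w) \<equiv>F (if b then py # w else ny # py # w)"
      using eqF_cancel_letter(1)[of py w] eqF_cancel_letter(2)[of py w] by simp
    finally show ?thesis using 3 by simp
  next
    case 4
    then have h: "concat (map tmap w) \<equiv>F (if b then w else ny # w)"
      using "2.prems" "2.IH"(2) by auto
    have "[ny] @ concat (map tmap w) \<equiv>F [ny] @ (if b then w else ny # w)"
      by (rule eqF_append[OF refl h])
    then show ?thesis using 4 by simp
  qed
qed simp

abbreviation only_y :: "word \<Rightarrow> bool" where
  "only_y m \<equiv> \<forall>a\<in>set m. fst a = X2"

lemma not_alternates:
  "\<not> alternates b w \<Longrightarrow>
    (\<exists>m v. w = m @ (X1, \<not> b) # v \<and> only_y m) \<or>
    (\<exists>u s m v. w = u @ (X1, s) # m @ (X1, s) # v \<and> only_y m) \<or>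
    (\<not> b \<and> only_y w) \<or> (\<exists>u m. w = u @ px # m \<and> only_y m)"
    (is "_ \<Longrightarrow> ?S b w \<or> ?M w \<or> ?Y b w \<or> ?E w")
proof (induction b w rule: alternates.induct)
  case (2 b a w)
  have M: ?case if M: "?M w"
  proof -
    obtain u s m v where "w = u @ (X1, s) # m @ (X1, s) # v" "only_y m" using M by blast
    then have "?M (a # w)"
      by (intro exI[of _ "a # u"] exI[of _ s] exI[of _ m] exI[of _ v]) simp
    then show ?thesis by (rule disjI2[OF disjI1])
  qed
  have E: ?case if E: "?E w"
  proof -
    obtain u m where "w = u @ px # m" "only_y m" using E by blast
    then have "?E (a # w)" by (intro exI[of _ "a # u"] exI[of _ m]) simp
    then show ?thesis by (rule disjI2[OF disjI2[OF disjI2]])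
  qed
  show ?case
  proof (cases "fst a = X1")
    case False
    then have a: "fst a = X2" using gen.exhaust by blast
    then have "?S b w \<or> ?M w \<or> ?Y b w \<or> ?E w" using 2 by simp
    then show ?thesis
    proof (elim disjE)
      assume "\<exists>m v. w = m @ (X1, \<not> b) # v \<and> only_y m"
      then obtain m v where "w = m @ (X1, \<not> b) # v" "only_y m" by blast
      then have "?S b (a # w)" using a by (intro exI[of _ "a # m"] exI[of _ v]) simp
      then show ?thesis by (rule disjI1)
    next
      assume "\<not> b \<and> only_y w"
      then have "?Y b (a # w)" using a by simp
      then show ?thesis by (rule disjI2[OF disjI2[OF disjI1]])
    qed (fact M, fact E)
  next
    case x: True
    show ?thesis
    proof (cases "snd a = b")
      case False
      then have "?S b (a # w)" using x by (intro exI[of _ "[]"] exI[of _ w]) (cases a; auto)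
      then show ?thesis by (rule disjI1)
    next
      case b: True
      then have "?S (\<not> b) w \<or> ?M w \<or> ?Y (\<not> b) w \<or> ?E w" using 2 x by simp
      then show ?thesis
      proof (elim disjE)
        assume "\<exists>m v. w = m @ (X1, \<not> \<not> b) # v \<and> only_y m"
        then obtain m v where "w = m @ (X1, b) # v" "only_y m" by auto
        then have "?M (a # w)" using b x
          by (intro exI[of _ "[]"] exI[of _ b] exI[of _ m] exI[of _ v]) (cases a; auto)
        then show ?thesis by (rule disjI2[OF disjI1])
      next
        assume "\<not> \<not> b \<and> only_y w"
        then have "?E (a # w)" using b x by (intro exI[of _ "[]"] exI[of _ w]) (cases a; auto)
        then show ?thesis by (rule disjI2[OF disjI2[OF disjI2]])
      qed (fact M, fact E)
    qed
  qed
qed simp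

text \<open>The cyclic word is cut before an \<open>x\<close> that is followed, after a power \<open>m\<close> of \<open>y\<close>, by another \<open>x\<close>,
  or by the same one if \<open>r\<close> is empty.\<close>

definition gap_form :: "word \<Rightarrow> bool" where
  "gap_form w \<longleftrightarrow> cyc_reduced w \<and>
     (\<exists>m r. w = px # m @ r \<and> only_y m \<and> (r = [] \<or> hd r = px))"

text \<open>Either two occurrences of \<open>x\<^sup>\<plusminus>\<^sup>1\<close> with the same sign follow each other in the cyclic word, or the
  signs alternate and the letters inserted by the transvection cancel. Inverting all letters
  makes the common sign positive.\<close>

lemma gap_form_or_fixed:
  assumes "\<not> conjF (tv c) c"
  shows "\<exists>w. gap_form w \<and> (conjF c w \<or> conjF (map inv_letter c) w)"
proof -
  let ?d = "core c"
  note pi = signed_perm_inv_letter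
  have "num_x ?d \<noteq> 0"
  proof
    assume "num_x ?d = 0"
    then have "tv ?d = ?d" using core(1)[of c] by (simp add: tv_eq_tr tr_no_x cyc_reduced_def)
    then show False using assms conjF_tv[OF core(2)[of c]] core(2)[of c] by (metis core_eq_iff)
  qed
  then have "px \<in> set ?d \<or> nx \<in> set ?d" by (metis add_is_0 count_list_0_iff num_x_def)
  then obtain a u v where d: "?d = u @ a # v" "a = px \<or> a = nx" by (metis split_list)
  then have rot: "rotate (length u) ?d = a # v @ u" by (simp add: rotate_append)
  have c1: "cyc_reduced (a # v @ u)" "conjF c (a # v @ u)"
    using cyc_reduced_rotate[OF core(1)[of c], of "length u"]
      conjF_trans[OF core(2) conjF_rotate[of ?d "length u"]] unfolding rot by auto
  define S where "S = {w. conjF c w \<or> conjF (map inv_letter c) w}"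
  have S_conj: "w' \<in> S" if "w \<in> S" "conjF w w'" for w w'
    using that conjF_trans by (auto simp: S_def)
  have S_map: "map inv_letter w \<in> S" if "w \<in> S" for w
    using that conjF_map[OF pi, of c w] conjF_map[OF pi, of "map inv_letter c" w]
    by (auto simp: S_def o_def)
  have fixed: "\<not> conjF (tv w) w" if "w \<in> S" for w
  proof
    assume w: "conjF (tv w) w"
    from that consider "core c = core w" | "core (map inv_letter c) = core w"
      by (auto simp: S_def core_eq_iff)
    then show False
    proof cases
      case 1
      then have "core (tv c) = core (tv w)" using conjF_tv by (simp add: core_eq_iff)
      then show False using w 1 assms by (simp add: core_eq_iff[symmetric])
    next
      case 2
      then have "core (tv (map inv_letter c)) = core (tv w)" using conjF_tv by (simp add: core_eq_iff)
      then have "conjF (map inv_letter (tv c)) (map inv_letter c)"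
        using w 2 tv_inv_letter[of c] by (simp add: core_eq_iff[symmetric])
      from conjF_map[OF pi this] show False using assms by (simp add: o_def)
    qed
  qed
  have "\<exists>e\<in>S. cyc_reduced e \<and> e \<noteq> [] \<and> hd e = px"
  proof (cases "a = px")
    case True
    then show ?thesis using c1 by (intro bexI[of _ "a # v @ u"]) (auto simp: S_def)
  next
    case False
    then show ?thesis using c1 d S_map[of "a # v @ u"] cyc_reduced_map[OF pi, of "a # v @ u"]
      by (intro bexI[of _ "map inv_letter (a # v @ u)"]) (auto simp: S_def)
  qed
  then obtain e where e: "e \<in> S" "cyc_reduced e" "e \<noteq> []" "hd e = px" by blast
  have "\<not> alternates True e"
  proof
    assume "alternates True e"
    from alternates_tv[OF this] have "tv e = free_reduce e" by (simp add: tv_def ext_def)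
    then have "tv e = e" using e(2) by (simp add: cyc_reduced_def)
    then show False using fixed[OF e(1)] by simp
  qed
  from not_alternates[OF this]
  consider (s) m v where "e = m @ nx # v" "only_y m"
    | (mid) u s m v where "e = u @ (X1, s) # m @ (X1, s) # v" "only_y m"
    | (e) u m where "e = u @ px # m" "only_y m" by auto
  then have "\<exists>w\<in>S. gap_form w"
  proof cases
    case s
    then show ?thesis using e by (cases m) auto
  next
    case mid
    let ?w = "(X1, s) # m @ (X1, s) # v @ u"
    have r: "rotate (length u) e = ?w" using mid by (simp add: rotate_append)
    have w: "?w \<in> S" "cyc_reduced ?w"
      using S_conj[OF e(1) conjF_rotate, of "length u"] cyc_reduced_rotate[OF e(2), of "length u"]
      unfolding r by auto
    show ?thesis
    proof (cases s)
      case True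
      then have "gap_form ?w" using w mid unfolding gap_form_def by (metis list.sel(1))
      then show ?thesis using w by blast
    next
      case False
      then have eq: "map inv_letter ?w = px # map inv_letter m @ map inv_letter ((X1, s) # v @ u)" by simp
      have "cyc_reduced (map inv_letter ?w)" using w cyc_reduced_map[OF pi] by blast
      moreover have "only_y (map inv_letter m)" using mid by auto
      moreover have "hd (map inv_letter ((X1, s) # v @ u)) = px" using False by simp
      ultimately have "gap_form (map inv_letter ?w)"
        unfolding gap_form_def
        by (intro conjI exI[of _ "map inv_letter m"] exI[of _ "map inv_letter ((X1, s) # v @ u)"] eq disjI2)
      then show ?thesis using S_map w by blast
    qed
  next
    case e': e
    let ?w = "px # m @ u"
    have r: "rotate (length u) e = ?w" using e' by (simp add: rotate_append)
    have w: "?w \<in> S" "cyc_reduced ?w"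
      using S_conj[OF e(1) conjF_rotate, of "length u"] cyc_reduced_rotate[OF e(2), of "length u"]
      unfolding r by auto
    moreover have "u = [] \<or> hd u = px" using e e' by (cases u) auto
    ultimately have "gap_form ?w" using e' unfolding gap_form_def by blast
    then show ?thesis using w by blast
  qed
  then show ?thesis by (auto simp: S_def)
qed

text \<open>The reduced word of \<open>y\<close> to the power \<open>j\<close>.\<close>

definition ypow :: "int \<Rightarrow> word" where
  "ypow j = (if j \<ge> 0 then replicate (nat j) py else replicate (nat (- j)) ny)"

lemma length_ypow [simp]: "length (ypow j) = nat \<bar>j\<bar>"
  by (simp add: ypow_def)

lemma reduced_only_y: "reduced m \<Longrightarrow> only_y m \<Longrightarrow> \<exists>j. m = ypow j"
proof (induction m)
  case Nil
  show ?case by (intro exI[of _ 0]) (simp add: ypow_def)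
next
  case (Cons a m)
  then obtain j where j: "m = ypow j" by (auto simp: reduced_Cons)
  have a: "a = py \<or> a = ny" using Cons.prems by (cases a rule: letter_cases) auto
  show ?case
  proof (cases "m = []")
    case True
    then show ?thesis using a by (intro exI[of _ "if a = py then 1 else -1"]) (auto simp: ypow_def)
  next
    case False
    then have "hd m \<noteq> inv_letter a" using Cons by (simp add: reduced_Cons)
    moreover have "j \<noteq> 0" using False j by (auto simp: ypow_def)
    moreover have "hd m = (if j > 0 then py else ny)"
      using j False \<open>j \<noteq> 0\<close> by (auto simp: ypow_def)
    ultimately have "a = (if j > 0 then py else ny)" using a by (auto split: if_splits)
    moreover have "nat (j + 1) = Suc (nat j)" if "j > 0" using that by linarith
    moreover have "nat (- (j - 1)) = Suc (nat (- j))" if "\<not> j > 0" using that by linarith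
    ultimately have "a # m = ypow (if j > 0 then j + 1 else j - 1)"
      using j \<open>j \<noteq> 0\<close> unfolding ypow_def by (cases "j > 0") simp_all
    then show ?thesis by blast
  qed
qed

lemma tr_replicate:
  "r = [] \<or> hd r = px \<Longrightarrow> tr (replicate n py @ r) = replicate n py @ tr r"
  "r = [] \<or> hd r = px \<Longrightarrow> tr (replicate n ny @ r) = replicate n ny @ tr r"
proof -
  assume r: "r = [] \<or> hd r = px"
  have "tr (py # w) = py # tr w" if "w = [] \<or> hd w \<noteq> nx" for w using that by (cases w) auto
  moreover have "replicate n py @ r = [] \<or> hd (replicate n py @ r) \<noteq> nx" for n using r by (cases n) auto
  ultimately show "tr (replicate n py @ r) = replicate n py @ tr r" by (induction n) auto
  have "tr (ny # w) = ny # tr w" for w by (cases w) auto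
  then show "tr (replicate n ny @ r) = replicate n ny @ tr r" by (induction n) auto
qed

lemma tr_gap:
  assumes r: "r = [] \<or> hd r = px"
  shows "tr (px # ypow j @ r) = px # ypow (j + 1) @ tr r"
proof (cases "j \<ge> 0")
  case True
  have "tr (px # w) = px # py # tr w" if "w = [] \<or> hd w \<noteq> ny" for w using that by (cases w) auto
  moreover have "replicate n py @ r = [] \<or> hd (replicate n py @ r) \<noteq> ny" for n using r by (cases n) auto
  ultimately have "tr (px # replicate n py @ r) = px # py # tr (replicate n py @ r)" for n
    by blast
  moreover have "nat (j + 1) = Suc (nat j)" using True by linarith
  ultimately show ?thesis using True by (simp add: ypow_def tr_replicate(1)[OF r])
next
  case False
  then obtain n where n: "nat (- j) = Suc n" by (cases "nat (- j)") auto
  then have "nat (- (j + 1)) = n" "j + 1 = 0 \<longleftrightarrow> n = 0" by linarith+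
  then show ?thesis using False r n by (auto simp: ypow_def tr_replicate)
qed

text \<open>The \<open>k\<close>-th iterate adds \<open>k\<close> to the exponent of the first gap, whose absolute value is at most
  \<open>length w\<close> at the beginning.\<close>

lemma gap_form_iterate:
  assumes "gap_form w"
  shows "int k \<le> int (clen ((tv ^^ k) w)) + int (length w)"
proof -
  obtain m r where w: "w = px # m @ r" "only_y m" "r = [] \<or> hd r = px" "cyc_reduced w"
    using assms by (auto simp: gap_form_def)
  then have "reduced m" by (auto simp: cyc_reduced_def reduced_append reduced_Cons)
  then obtain j where j: "m = ypow j" using w reduced_only_y by blast
  have "\<exists>r. (tv ^^ k) w = px # ypow (j + int k) @ r \<and> (r = [] \<or> hd r = px) \<and> cyc_reduced ((tv ^^ k) w)"
  proof (induction k)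
    case 0
    then show ?case using w j by auto
  next
    case (Suc k)
    then obtain r' where r': "(tv ^^ k) w = px # ypow (j + int k) @ r'" "r' = [] \<or> hd r' = px"
      "cyc_reduced ((tv ^^ k) w)" by blast
    have "(tv ^^ Suc k) w = tr (px # ypow (j + int k) @ r')"
      using r' tv_eq_tr by (simp add: cyc_reduced_def)
    then have "(tv ^^ Suc k) w = px # ypow (j + int k + 1) @ tr r'" using tr_gap[OF r'(2)] by simp
    moreover have "tr r' = [] \<or> hd (tr r') = px" using r'(2) by (cases "r' = []") (auto simp: tr_hd)
    moreover have "cyc_reduced ((tv ^^ Suc k) w)"
      using cyc_reduced_tr(1)[OF r'(3)] r'(1) tv_eq_tr r'(3) by (simp add: cyc_reduced_def)
    ultimately show ?case by (auto simp: algebra_simps)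
  qed
  then obtain r' where r': "(tv ^^ k) w = px # ypow (j + int k) @ r'" "cyc_reduced ((tv ^^ k) w)" by blast
  have "clen ((tv ^^ k) w) \<ge> nat \<bar>j + int k\<bar>" using clen_cyc_reduced[OF r'(2)] r'(1) by simp
  moreover have "length w \<ge> nat \<bar>j\<bar>" using w j by simp
  ultimately show ?thesis by linarith
qed

lemma conjF_tv_iterate: "conjF u v \<Longrightarrow> conjF ((tv ^^ k) u) ((tv ^^ k) v)"
  by (induction k) (auto intro: conjF_tv)

lemma conjF_tv_fixed: "conjF (tv w) w \<Longrightarrow> conjF ((tv ^^ k) w) w"
  by (induction k) (auto intro: conjF_tv conjF_trans)

lemma conjF_tv_iterate_inv_letter: "conjF ((tv ^^ k) (map inv_letter w)) (map inv_letter ((tv ^^ k) w))"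
proof (induction k)
  case (Suc k)
  then show ?case using conjF_trans[OF conjF_tv[OF Suc] tv_inv_letter] by simp
qed simp

lemma clen_tv_iterate:
  assumes "\<not> conjF (tv c) c" "2 * clen c < k"
  shows "clen ((tv ^^ k) c) > clen c"
proof -
  obtain w where w: "gap_form w" "conjF c w \<or> conjF (map inv_letter c) w"
    using gap_form_or_fixed[OF assms(1)] by blast
  have "clen ((tv ^^ k) w) = clen ((tv ^^ k) c) \<and> clen w = clen c"
    using w(2)
  proof
    assume "conjF c w"
    then show ?thesis using conjF_tv_iterate[of c w k] by (simp add: core_eq_iff[symmetric])
  next
    assume 1: "conjF (map inv_letter c) w"
    then have "core ((tv ^^ k) w) = core (map inv_letter ((tv ^^ k) c))"
      using conjF_tv_iterate[OF 1, of k] conjF_tv_iterate_inv_letter[of k c]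
      by (simp add: core_eq_iff[symmetric])
    moreover have "core w = core (map inv_letter c)" using 1 by (simp add: core_eq_iff conjF_sym)
    ultimately show ?thesis using clen_map[OF signed_perm_inv_letter] by simp
  qed
  moreover have "clen w = length w" using w clen_cyc_reduced by (simp add: gap_form_def)
  ultimately show ?thesis using gap_form_iterate[OF w(1), of k] assms(2) by simp
qed

lemma alternating_cong: "conjF u v \<Longrightarrow> alternating u \<longleftrightarrow> alternating v"
  by (simp add: alternating_def core_eq_iff[symmetric])

lemma alternating_map: assumes "signed_perm \<pi>" shows "alternating (map \<pi> w) \<longleftrightarrow> alternating w"
proof -
  have "(\<forall>a. kc (map \<pi> w) a a = 0) \<longleftrightarrow> (\<forall>a. kc (map \<pi> w) (\<pi> a) (\<pi> a) = 0)"
    using signed_perm_bij[OF assms] by (metis bij_pointE)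
  then show ?thesis unfolding alternating_def using kc_map[OF assms] by metis
qed

lemma alternating_gap:
  assumes "cyc_reduced w" "alternating w" "w = px # ypow j @ r" "r = [] \<or> hd r = px"
  shows "\<bar>j\<bar> = 1"
proof -
  have z: "cyc_count w a a = 0" for a
    using assms(2) kc_cyc_reduced[OF assms(1), of a a] unfolding alternating_def by metis
  have "j \<noteq> 0"
    using z[of px] assms(3,4) by (cases r) (auto simp: ypow_def cyc_count_adj)
  moreover have "\<not> \<bar>j\<bar> \<ge> 2"
  proof
    assume "\<bar>j\<bar> \<ge> 2"
    define n where "n = nat \<bar>j\<bar> - 2"
    then have n: "nat \<bar>j\<bar> = Suc (Suc n)" using \<open>\<bar>j\<bar> \<ge> 2\<close> by linarith
    define b where "b = (if j \<ge> 0 then py else ny)"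
    have "ypow j = b # b # replicate n b" using n by (auto simp: ypow_def b_def)
    then show False using z[of b] assms(3) by (simp add: cyc_count_adj split: if_splits)
  qed
  ultimately show ?thesis by linarith
qed

text \<open>In an alternating cyclic word all gaps between neighbouring occurrences of \<open>x\<^sup>\<plusminus>\<^sup>1\<close> are \<open>y\<^sup>\<plusminus>\<^sup>1\<close>. The
  transvection would change the exponent of a gap between equal signs by one.\<close>

lemma alternating_tv_fixed:
  assumes "alternating c" "alternating (tv c)"
  shows "conjF (tv c) c"
proof (rule ccontr)
  assume "\<not> conjF (tv c) c"
  then obtain w where w: "gap_form w" "conjF c w \<or> conjF (map inv_letter c) w"
    using gap_form_or_fixed by blast
  note pi = signed_perm_inv_letter
  have a: "alternating w \<and> alternating (tv w)"
    using w(2)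
  proof
    assume "conjF c w"
    then show ?thesis using assms alternating_cong conjF_tv by blast
  next
    assume "conjF (map inv_letter c) w"
    then show ?thesis using assms alternating_cong conjF_tv alternating_map[OF pi] tv_inv_letter by blast
  qed
  obtain m r where m: "w = px # m @ r" "only_y m" "r = [] \<or> hd r = px" "cyc_reduced w"
    using w(1) by (auto simp: gap_form_def)
  then have "reduced m" by (auto simp: cyc_reduced_def reduced_append reduced_Cons)
  then obtain j where j: "m = ypow j" using m reduced_only_y by blast
  have tw: "tv w = tr w" using m(4) tv_eq_tr by (simp add: cyc_reduced_def)
  have "\<bar>j\<bar> = 1" using alternating_gap[OF m(4)] a m j by blast
  moreover have "\<bar>j + 1\<bar> = 1"
  proof (rule alternating_gap)
    show "cyc_reduced (tv w)" unfolding tw using cyc_reduced_tr(1)[OF m(4)] m(1) by simp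
    show "tv w = px # ypow (j + 1) @ tr r" using tr_gap[OF m(3), of j] tw m(1) j by simp
    show "tr r = [] \<or> hd (tr r) = px" using m(3) by (cases "r = []") (auto simp: tr_hd)
  qed (use a in blast)
  ultimately show False by linarith
qed

section \<open>Generators of the automorphism group\<close>

definition closed_pred :: "(word \<Rightarrow> bool) \<Rightarrow> bool" where
  "closed_pred P \<longleftrightarrow>
     (\<forall>\<pi> w. signed_perm \<pi> \<longrightarrow> reduced w \<longrightarrow> P w \<longrightarrow> P (map \<pi> w)) \<and>
     (\<forall>g w. reduced w \<longrightarrow> P w \<longrightarrow> P (free_reduce (winv g @ w @ g))) \<and>
     (\<forall>w. reduced w \<longrightarrow> P w \<longrightarrow> P (tv w))"

text \<open>In place of the subgroup generated by signed permutations, inner automorphisms and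
  transvections, it is convenient to speak about the predicates closed under these maps.\<close>

definition generated :: "(word \<Rightarrow> word) \<Rightarrow> bool" where
  "generated \<phi> \<longleftrightarrow> (\<forall>P w. closed_pred P \<longrightarrow> reduced w \<longrightarrow> P w \<longrightarrow> P (\<phi> w))"

lemma closed_predD:
  assumes "closed_pred P"
  shows "signed_perm \<pi> \<Longrightarrow> reduced w \<Longrightarrow> P w \<Longrightarrow> P (map \<pi> w)"
    and "reduced w \<Longrightarrow> P w \<Longrightarrow> P (free_reduce (winv g @ w @ g))"
    and "reduced w \<Longrightarrow> P w \<Longrightarrow> P (tv w)"
  using assms unfolding closed_pred_def by blast+

lemma iso_F2I:
  assumes "\<phi> \<in> hom F2 F2" "\<And>w. reduced w \<Longrightarrow> reduced (\<psi> w)"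
    "\<And>w. reduced w \<Longrightarrow> \<psi> (\<phi> w) = w" "\<And>w. reduced w \<Longrightarrow> \<phi> (\<psi> w) = w"
  shows "\<phi> \<in> iso F2 F2"
  unfolding iso_def using assms hom_reduced[OF assms(1)]
  by (auto intro!: bij_betw_byWitness[where f' = \<psi>])

lemma iso_F2D:
  assumes "\<phi> \<in> iso F2 F2"
  shows "\<phi> \<in> hom F2 F2"
    and "reduced u \<Longrightarrow> reduced v \<Longrightarrow> \<phi> u = \<phi> v \<Longrightarrow> u = v"
    and "reduced v \<Longrightarrow> \<exists>u. reduced u \<and> \<phi> u = v"
proof -
  have b: "bij_betw \<phi> (carrier F2) (carrier F2)" and h: "\<phi> \<in> hom F2 F2"
    using assms by (auto simp: iso_def)
  show "\<phi> \<in> hom F2 F2" by (rule h)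
  show "reduced u \<Longrightarrow> reduced v \<Longrightarrow> \<phi> u = \<phi> v \<Longrightarrow> u = v"
    using b by (auto simp: bij_betw_def inj_on_def)
  show "reduced v \<Longrightarrow> \<exists>u. reduced u \<and> \<phi> u = v"
    using b unfolding bij_betw_def by (metis F2_carrier imageE)
qed

lemma iso_comp: "\<phi> \<in> iso F2 F2 \<Longrightarrow> \<psi> \<in> iso F2 F2 \<Longrightarrow> (\<lambda>w. \<psi> (\<phi> w)) \<in> iso F2 F2"
  unfolding iso_def using hom_compose[of \<phi> F2 F2 \<psi> F2] bij_betw_trans[of \<phi> _ _ \<psi>]
  by (auto simp: comp_def)

lemma map_iso: assumes "signed_perm \<pi>" shows "map \<pi> \<in> iso F2 F2"
proof (rule iso_F2I[where \<psi> = "map (inv_into UNIV \<pi>)"])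
  show "map \<pi> \<in> hom F2 F2" using assms by (auto simp: hom_def F2_mult free_reduce_map[symmetric])
qed (simp_all only: map_inv_signed_perm[OF assms] reduced_map[OF signed_perm_the_inv[OF assms]])

lemma sp_px_ny_involution: "map (sp px ny) (map (sp px ny) w) = w"
proof -
  have "sp px ny (sp px ny a) = a" for a by (cases a rule: letter_cases) (auto simp: sp_def)
  then show ?thesis by (simp add: map_idI)
qed

lemma tv_left_inverse: "reduced w \<Longrightarrow> map (sp px ny) (tv (map (sp px ny) (tv w))) = w"
  using sp_px_ny_involution signed_perm_sp[of px ny] by (simp add: tv_inv_y_tv)

lemma tv_right_inverse: "reduced w \<Longrightarrow> tv (map (sp px ny) (tv (map (sp px ny) w))) = w"
  using sp_px_ny_involution signed_perm_sp[of px ny] by (simp add: tv_inv_y_tv)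

lemma tv_hom: "tv \<in> hom F2 F2"
  unfolding tv_def by (rule ext_in_hom[OF sym_map_tmap])

lemma tv_iso: "tv \<in> iso F2 F2"
  by (rule iso_F2I[where \<psi> = "\<lambda>w. map (sp px ny) (tv (map (sp px ny) w))"])
    (auto simp: tv_left_inverse tv_right_inverse tv_hom signed_perm_sp)

lemma inner_iso: "(\<lambda>w. free_reduce (winv g @ w @ g)) \<in> iso F2 F2"
proof (rule iso_F2I[where \<psi> = "\<lambda>w. free_reduce (g @ w @ winv g)"])
  have "free_reduce (winv g @ u @ v @ g) = free_reduce ((winv g @ u) @ g @ winv g @ (v @ g))" for u v
    using eqF_winv_mid(2)[of "winv g @ u" g "v @ g"] by simp
  then show "(\<lambda>w. free_reduce (winv g @ w @ g)) \<in> hom F2 F2"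
    by (auto simp: hom_def F2_mult)
  show "free_reduce (g @ free_reduce (winv g @ w @ g) @ winv g) = w" if "reduced w" for w
    using that by (simp add: eqF_winv_right)
  show "free_reduce (winv g @ free_reduce (g @ w @ winv g) @ g) = w" if "reduced w" for w
    using that by (simp add: eqF_winv_left)
qed auto

definition total :: "(word \<Rightarrow> word) \<Rightarrow> nat" where
  "total \<phi> = length (\<phi> [px]) + length (\<phi> [py])"

lemma total_eq:
  assumes "\<phi> \<in> hom F2 F2" "fst c \<noteq> fst d"
  shows "total \<phi> = length (\<phi> [c]) + length (\<phi> [d])"
proof -
  have "length (\<phi> [nx]) = length (\<phi> [px])" "length (\<phi> [ny]) = length (\<phi> [py])"
    using hom_winv[OF assms(1), of "[px]"] hom_winv[OF assms(1), of "[py]"] by simp_all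
  then show ?thesis using assms(2)
    by (cases c rule: letter_cases; cases d rule: letter_cases) (auto simp: total_def)
qed

text \<open>The automorphism \<open>c \<mapsto> c d\<close>, \<open>d \<mapsto> d\<close>.\<close>

definition transv :: "letter \<Rightarrow> letter \<Rightarrow> word \<Rightarrow> word" where
  "transv c d w = map (sp c d) (tv (map (inv_into UNIV (sp c d)) w))"

lemma transv_letters:
  assumes "fst c \<noteq> fst d"
  shows "transv c d [c] = [c, d]" "transv c d [d] = [d]"
proof -
  have "inv_into UNIV (sp c d) (sp c d px) = px" "inv_into UNIV (sp c d) (sp c d py) = py"
    using signed_perm_bij[OF signed_perm_sp[OF assms]] by (simp_all add: bij_is_inj)
  then have "inv_into UNIV (sp c d) c = px" "inv_into UNIV (sp c d) d = py"
    by (simp_all add: sp_def)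
  then show "transv c d [c] = [c, d]" "transv c d [d] = [d]"
    by (simp_all add: transv_def tv_eq_tr sp_def)
qed

lemma transv_iso: "fst c \<noteq> fst d \<Longrightarrow> transv c d \<in> iso F2 F2"
  unfolding transv_def
  using iso_comp[OF iso_comp[OF map_iso[OF signed_perm_the_inv[OF signed_perm_sp]] tv_iso]
      map_iso[OF signed_perm_sp]] by simp

text \<open>A closed predicate is also closed under the inverse of a transvection, which is the conjugate of
  the transvection by the involution \<open>y \<mapsto> y\<^sup>-\<^sup>1\<close>.\<close>

lemma generated_transv_cancel:
  assumes cd: "fst c \<noteq> fst d" and \<phi>: "\<phi> \<in> iso F2 F2" "generated (\<lambda>w. \<phi> (transv c d w))"
  shows "generated \<phi>"
  unfolding generated_def
proof (intro allI impI)
  fix P w assume P: "closed_pred P" and w: "reduced w" "P w"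
  let ?\<sigma> = "sp c d" and ?\<iota> = "sp px ny"
  have \<sigma>: "signed_perm ?\<sigma>" and \<iota>: "signed_perm ?\<iota>" using cd by (simp_all add: signed_perm_sp)
  note \<sigma>' = signed_perm_the_inv[OF \<sigma>]
  define z where "z = map ?\<iota> (tv (map ?\<iota> (map (inv_into UNIV ?\<sigma>) w)))"
  have z: "reduced z" "P z"
    unfolding z_def using w \<sigma>' \<iota>
    by (simp_all only: reduced_map reduced_tv closed_predD(1,3)[OF P])
  then have "P (map ?\<sigma> z)" using closed_predD(1)[OF P \<sigma>] by blast
  moreover have "reduced (map ?\<sigma> z)" using z \<sigma> by simp
  ultimately have "P (\<phi> (transv c d (map ?\<sigma> z)))"
    using \<phi>(2) P unfolding generated_def by blast
  moreover have "transv c d (map ?\<sigma> z) = w"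
    unfolding transv_def map_inv_signed_perm[OF \<sigma>] z_def
    using tv_right_inverse[of "map (inv_into UNIV ?\<sigma>) w"] w \<sigma>' by (simp add: map_inv_signed_perm[OF \<sigma>] del: map_map)
  ultimately show "P (\<phi> w)" by simp
qed

lemma generated_inner_cancel:
  assumes \<phi>: "\<phi> \<in> iso F2 F2" "generated (\<lambda>w. free_reduce (winv g @ \<phi> w @ g))"
  shows "generated \<phi>"
  unfolding generated_def
proof (intro allI impI)
  fix P w assume P: "closed_pred P" and w: "reduced w" "P w"
  have r: "reduced (\<phi> w)" using hom_reduced[OF iso_F2D(1)[OF \<phi>(1)] w(1)] .
  have "P (free_reduce (winv g @ \<phi> w @ g))"
    using \<phi>(2) P w unfolding generated_def by blast
  then have "P (free_reduce (winv (winv g) @ free_reduce (winv g @ \<phi> w @ g) @ winv g))"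
    by (rule closed_predD(2)[OF P reduced_free_reduce])
  then show "P (\<phi> w)" using r by (simp add: eqF_winv_right)
qed

section \<open>Cancellation in products\<close>

fun lcp :: "word \<Rightarrow> word \<Rightarrow> nat" where
  "lcp (a # u) (b # v) = (if a = b then Suc (lcp u v) else 0)"
| "lcp _ _ = 0"

lemma lcp_take: "take (lcp u v) u = take (lcp u v) v"
  by (induction u v rule: lcp.induct) auto

lemma lcp_le: "lcp u v \<le> length u" "lcp u v \<le> length v"
  by (induction u v rule: lcp.induct) auto

lemma lcp_cong_take:
  "take m v = take m v' \<Longrightarrow> lcp u v < m \<Longrightarrow> m \<le> length v \<Longrightarrow> m \<le> length v' \<Longrightarrow> lcp u v' = lcp u v"
proof (induction u v arbitrary: m v' rule: lcp.induct)
  case (1 a u b v)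
  then obtain k b' v'' where k: "m = Suc k" "v' = b' # v''"
  proof -
    have "0 < m" using "1.prems"(2) by linarith
    moreover from this have "0 < length v'" using "1.prems"(4) by linarith
    ultimately show thesis using that by (metis gr0_implies_Suc length_greater_0_conv neq_Nil_conv)
  qed
  then have b': "b' = b" "take k v = take k v''" using "1.prems"(1) by simp_all
  show ?case
  proof (cases "a = b")
    case True
    then have "lcp u v'' = lcp u v" using "1.IH"[OF True b'(2)] "1.prems" k by simp
    then show ?thesis using True k b' by simp
  next
    case False
    then show ?thesis using k b' by simp
  qed
qed (auto split: list.splits)

lemma lcp_ge: "take m u = take m v \<Longrightarrow> m \<le> length u \<Longrightarrow> m \<le> length v \<Longrightarrow> m \<le> lcp u v"
proof (induction u v arbitrary: m rule: lcp.induct)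
  case (1 a u b v)
  then show ?case by (cases m) auto
qed auto

text \<open>What cancels in \<open>u\<^sup>-\<^sup>1 v\<close> is exactly the longest common prefix of \<open>u\<close> and \<open>v\<close>.\<close>

lemma free_reduce_lcp:
  "reduced u \<Longrightarrow> reduced v \<Longrightarrow>
    free_reduce (winv u @ v) = winv (drop (lcp u v) u) @ drop (lcp u v) v"
proof (induction u v rule: lcp.induct)
  case (1 a u b v)
  show ?case
  proof (cases "a = b")
    case True
    have "free_reduce (winv (a # u) @ b # v) = free_reduce (winv u @ v)"
      using eqF_append[OF refl eqF_cancel_letter(1)[of a v], of "winv u"] True by simp
    then show ?thesis using 1 True by (simp add: reduced_Cons)
  next
    case False
    have "reduced (winv (a # u))" using 1 by (simp only: reduced_winv)
    then have "reduced (winv (a # u) @ b # v)"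
      using 1 False unfolding reduced_append by simp
    then show ?thesis using False by simp
  qed
qed auto

lemma length_lcp:
  "reduced u \<Longrightarrow> reduced v \<Longrightarrow> length (free_reduce (winv u @ v)) + 2 * lcp u v = length u + length v"
  using lcp_le[of u v] by (simp add: free_reduce_lcp)

text \<open>Write \<open>u = h\<^sup>-\<^sup>1 c h\<close> with \<open>c\<close> cyclically reduced and nonempty; only \<open>h\<close> cancels in \<open>u u\<close>.\<close>

lemma lcp_self:
  assumes "reduced u" "u \<noteq> []"
  shows "2 * lcp (winv u) u < length u"
proof -
  obtain h n where h: "u = winv h @ rotate n (core u) @ h" using reduced_core_form[OF assms(1)] by blast
  let ?c = "rotate n (core u)"
  have "?c \<noteq> []"
  proof
    assume "?c = []"
    then have "u = free_reduce (winv h @ h)" using h assms(1) by (metis append_Nil free_reduce_id)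
    then show False using assms by simp
  qed
  moreover have "cyc_reduced ?c" by (intro cyc_reduced_rotate core)
  ultimately have "reduced (winv h @ ?c @ ?c @ h)"
    using assms(1) by (subst (asm) h) (auto simp: reduced_append cyc_reduced_def)
  moreover have "free_reduce (u @ u) = free_reduce (winv h @ ?c @ ?c @ h)"
    using eqF_winv_mid(2)[of "winv h @ ?c" h "?c @ h"] by (subst (1 2) h) simp
  ultimately have "length (free_reduce (u @ u)) = 2 * length h + 2 * length ?c" by simp
  moreover have "length u = 2 * length h + length ?c" by (subst h) simp
  moreover have "length ?c > 0" using \<open>?c \<noteq> []\<close> by blast
  moreover have "length (free_reduce (u @ u)) + 2 * lcp (winv u) u = length u + length u"
    using length_lcp[of "winv u" u] assms by simp
  ultimately show ?thesis by linarith
qed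

section \<open>Nielsen reduction\<close>

text \<open>An automorphism whose total length cannot be reduced by a transvection of its argument, even if
  this is combined with an inner automorphism. Nielsen's method shows that it is a signed
  permutation.\<close>

locale minimal_iso =
  fixes \<phi> :: "word \<Rightarrow> word"
  assumes iso: "\<phi> \<in> iso F2 F2"
    and transv_ge: "fst c \<noteq> fst d \<Longrightarrow> total \<phi> \<le> total (\<lambda>w. \<phi> (transv c d w))"
    and inner_ge: "fst c \<noteq> fst d \<Longrightarrow>
      total \<phi> \<le> total (\<lambda>w. free_reduce (winv g @ \<phi> (transv c d w) @ g))"
begin

lemmas hom = iso_F2D(1)[OF iso]

lemma red [simp]: "reduced (\<phi> [a])"
  using hom_reduced[OF hom] by simp

lemma inv_image: "\<phi> [inv_letter a] = winv (\<phi> [a])"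
  using hom_winv[OF hom, of "[a]"] by simp

lemma nonempty: "\<phi> [a] \<noteq> []"
  using iso_F2D(2)[OF iso, of "[a]" "[]"] hom_Nil[OF hom] by auto

text \<open>The number of letters that cancel on either side in the product \<open>\<phi> c \<cdot> \<phi> d\<close>.\<close>

definition \<kappa> :: "letter \<Rightarrow> letter \<Rightarrow> nat" where
  "\<kappa> c d = lcp (\<phi> [inv_letter c]) (\<phi> [d])"

lemma image_pair: "d \<noteq> inv_letter c \<Longrightarrow> \<phi> [c, d] = free_reduce (\<phi> [c] @ \<phi> [d])"
  using hom_mult[OF hom, of "[c]" "[d]"] by (simp add: reduced_Cons)

lemma kappa_le_half:
  assumes "fst c \<noteq> fst d"
  shows "2 * \<kappa> c d \<le> length (\<phi> [c])" "2 * \<kappa> c d \<le> length (\<phi> [d])"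
proof -
  have le: "length (\<phi> [c]) \<le> length (\<phi> [c, d])" if "fst c \<noteq> fst d" for c d
  proof -
    have "(\<lambda>w. \<phi> (transv c d w)) \<in> hom F2 F2"
      using iso_comp[OF transv_iso[OF that] iso] iso_F2D(1) by blast
    from total_eq[OF this that] total_eq[OF hom that] transv_ge[OF that]
    show ?thesis by (simp add: transv_letters[OF that])
  qed
  have ne: "d \<noteq> inv_letter c" using assms by auto
  have len: "length (\<phi> [c, d]) + 2 * \<kappa> c d = length (\<phi> [c]) + length (\<phi> [d])"
    using length_lcp[of "\<phi> [inv_letter c]" "\<phi> [d]"]
    by (simp add: \<kappa>_def image_pair[OF ne] inv_image)
  have "length (\<phi> [inv_letter d, inv_letter c]) = length (\<phi> [c, d])"
    using hom_winv[OF hom, of "[c, d]"] ne by (simp add: reduced_Cons)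
  then have "length (\<phi> [d]) \<le> length (\<phi> [c, d])"
    using le[of "inv_letter d" "inv_letter c"] assms by (simp add: inv_image)
  then show "2 * \<kappa> c d \<le> length (\<phi> [c])" using len by linarith
  show "2 * \<kappa> c d \<le> length (\<phi> [d])" using len le[OF assms] by linarith
qed

lemma kappa_self: "2 * \<kappa> c c < length (\<phi> [c])"
  unfolding \<kappa>_def inv_image by (rule lcp_self) (simp_all add: nonempty)

lemma kappa_le_half':
  assumes "d \<noteq> inv_letter c"
  shows "2 * \<kappa> c d \<le> length (\<phi> [c])" "2 * \<kappa> c d \<le> length (\<phi> [d])"
proof -
  have "c = d" if "fst c = fst d"
    using that assms by (cases c; cases d) auto
  then show "2 * \<kappa> c d \<le> length (\<phi> [c])" "2 * \<kappa> c d \<le> length (\<phi> [d])"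
    using kappa_le_half[of c d] kappa_self[of c] by fastforce+
qed

text \<open>If both halves of \<open>\<phi> e = p q\<^sup>-\<^sup>1\<close> cancelled between two copies of \<open>\<phi> d = q z p\<^sup>-\<^sup>1\<close>, then
  \<open>\<phi> e \<cdot> \<phi> d\<close> would be \<open>p z p\<^sup>-\<^sup>1\<close>, and conjugating by \<open>p\<close> would shorten the pair: the lengths would
  become those of \<open>z\<close> and \<open>q\<^sup>-\<^sup>1 p\<close>. This is the case in which no single transvection reduces
  the total length.\<close>

lemma kappa_both_halves:
  assumes "fst d \<noteq> fst e" "2 * \<kappa> d e = length (\<phi> [e])" "2 * \<kappa> e d = length (\<phi> [e])"
  shows False
proof -
  define k where "k = \<kappa> e d"
  define p where "p = take k (\<phi> [e])"
  define q where "q = take k (\<phi> [d])"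
  have ke: "length (\<phi> [e]) = 2 * k" "\<kappa> d e = k" using assms(2,3) by (auto simp: k_def)
  have kd: "2 * k \<le> length (\<phi> [d])" using kappa_le_half(1)[OF assms(1)] ke by simp
  have k: "k > 0" using ke nonempty[of e] by (metis length_0_conv mult_0_right neq0_conv)
  have p: "take k (\<phi> [inv_letter d]) = p"
    using lcp_take[of "\<phi> [inv_letter d]" "\<phi> [e]"] ke(2) by (simp add: \<kappa>_def p_def)
  have q: "take k (\<phi> [inv_letter e]) = q"
    using lcp_take[of "\<phi> [inv_letter e]" "\<phi> [d]"] by (simp add: \<kappa>_def k_def q_def)
  have suffix: "drop (length v - k) v = winv (take k (winv v))" for v
    unfolding winv_def take_rev take_map drop_map rev_map by (simp add: o_def)
  have e: "\<phi> [e] = p @ winv q"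
    using suffix[of "\<phi> [e]"] q ke by (simp add: p_def inv_image) (metis append_take_drop_id)
  define z where "z = take (length (\<phi> [d]) - 2 * k) (drop k (\<phi> [d]))"
  have d: "\<phi> [d] = q @ z @ winv p"
  proof -
    have "length (\<phi> [d]) - 2 * k + k = length (\<phi> [d]) - k" using kd by linarith
    then have "drop (length (\<phi> [d]) - 2 * k) (drop k (\<phi> [d])) = drop (length (\<phi> [d]) - k) (\<phi> [d])"
      by simp
    also have "\<dots> = winv p" using suffix[of "\<phi> [d]"] p by (simp add: inv_image)
    finally have "drop (length (\<phi> [d]) - 2 * k) (drop k (\<phi> [d])) = winv p" .
    then have "drop k (\<phi> [d]) = z @ winv p"
      unfolding z_def by (metis append_take_drop_id)
    then show ?thesis by (simp add: q_def) (metis append_take_drop_id)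
  qed
  have lp: "length p = k" "length q = k" "length z + 2 * k = length (\<phi> [d])"
    using ke kd by (auto simp: p_def q_def z_def)
  \<comment> \<open>The pair of \<open>e\<close> and \<open>e d\<close>: inverting both letters turns left into right multiplication.\<close>
  define c where "c = inv_letter d"
  define f where "f = inv_letter e"
  have cf: "fst c \<noteq> fst f" "f \<noteq> inv_letter c" using assms(1) by (auto simp: c_def f_def)
  let ?\<chi> = "\<lambda>w. free_reduce (winv p @ \<phi> (transv c f w) @ p)"
  have \<chi>: "?\<chi> \<in> hom F2 F2"
    using iso_comp[OF iso_comp[OF transv_iso[OF cf(1)] iso] inner_iso[of p]] iso_F2D(1) by blast
  have "?\<chi> [c] = free_reduce (winv p @ (p @ winv z @ winv q @ q @ winv p) @ p)"
    by (simp add: transv_letters[OF cf(1)] image_pair[OF cf(2)])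
      (simp add: c_def f_def inv_image d e)
  also have "\<dots> = free_reduce (winv z)" by (simp add: eqF_winv_left)
  finally have 1: "length (?\<chi> [c]) \<le> length z" using length_free_reduce[of "winv z"] by simp
  have "?\<chi> [f] = free_reduce ((winv p @ q) @ winv p @ p)"
    by (simp add: transv_letters[OF cf(1)]) (simp add: f_def inv_image e)
  also have "\<dots> = free_reduce (winv p @ q)" by (rule eqF_winv_mid)
  finally have "?\<chi> [f] = free_reduce (winv p @ q)" .
  then have 2: "length (?\<chi> [f]) \<le> 2 * k" using length_free_reduce[of "winv p @ q"] lp by simp
  have "total \<phi> \<le> length (?\<chi> [c]) + length (?\<chi> [f])"
    using inner_ge[OF cf(1), of p] total_eq[OF \<chi> cf(1)] by simp
  moreover have "total \<phi> = length (\<phi> [d]) + length (\<phi> [e])"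
    using total_eq[OF hom assms(1)] .
  ultimately show False using 1 2 ke lp k by linarith
qed

text \<open>At most one half of \<open>\<phi> e\<close> cancels on either side, and less than one half against \<open>\<phi> e\<close> itself. If both
  halves cancelled, the neighbours \<open>c\<close>, \<open>d\<close> would come from the other generator. For \<open>c = d\<close> this is
  excluded above; for \<open>c = d\<^sup>-\<^sup>1\<close> both halves would be equal, and half of \<open>\<phi> e\<close> would cancel
  against \<open>\<phi> e\<close>.\<close>

lemma kappa_no_dissolution:
  assumes "e \<noteq> inv_letter c" "d \<noteq> inv_letter e"
  shows "\<kappa> c e + \<kappa> e d < length (\<phi> [e])"
proof (rule ccontr)
  assume "\<not> ?thesis"
  moreover note kappa_le_half'(2)[OF assms(1)] kappa_le_half'(1)[OF assms(2)]
  ultimately have k: "2 * \<kappa> c e = length (\<phi> [e])" "2 * \<kappa> e d = length (\<phi> [e])" by linarith+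
  have "fst c \<noteq> fst e"
  proof
    assume "fst c = fst e"
    then have "c = e" using assms by (cases c; cases e) auto
    then show False using k kappa_self[of e] by simp
  qed
  have "fst d \<noteq> fst e"
  proof
    assume "fst d = fst e"
    then have "d = e" using assms by (cases d; cases e) auto
    then show False using k kappa_self[of e] by simp
  qed
  then have "fst c = fst d" using \<open>fst c \<noteq> fst e\<close> gen.exhaust by metis
  then consider "c = d" | "c = inv_letter d" by (cases c; cases d) auto
  then show False
  proof cases
    case 1
    then show False using kappa_both_halves[OF \<open>fst d \<noteq> fst e\<close>] k by simp
  next
    case 2
    let ?k = "\<kappa> e d"
    have le: "?k \<le> length (\<phi> [e])" using k by linarith
    have eq: "\<kappa> c e = ?k" using k by simp
    have "take ?k (\<phi> [d]) = take ?k (\<phi> [e])"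
      using lcp_take[of "\<phi> [inv_letter c]" "\<phi> [e]"] 2 unfolding eq[symmetric] by (simp add: \<kappa>_def)
    moreover have "take ?k (\<phi> [inv_letter e]) = take ?k (\<phi> [d])"
      using lcp_take[of "\<phi> [inv_letter e]" "\<phi> [d]"] by (simp add: \<kappa>_def)
    ultimately have "take ?k (\<phi> [inv_letter e]) = take ?k (\<phi> [e])" by simp
    then have "?k \<le> \<kappa> e e"
      unfolding \<kappa>_def[of e e] by (rule lcp_ge) (use le in \<open>simp_all add: inv_image\<close>)
    then show False using kappa_self[of e] k by linarith
  qed
qed

text \<open>As no factor dissolves, a reduced product of images keeps a nonempty part of each factor,
  and it begins with the remaining part of the first one.\<close>

lemma image_prefix:
  assumes "reduced (e # w)"
  defines "m \<equiv> \<lambda>e w. length (\<phi> [e]) - (if w = [] then 0 else \<kappa> e (hd w))"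
  shows "take (m e w) (\<phi> (e # w)) = take (m e w) (\<phi> [e]) \<and> m e w + length w \<le> length (\<phi> (e # w))"
  using assms(1)
proof (induction w arbitrary: e)
  case Nil
  then show ?case by (simp add: m_def)
next
  case (Cons f w)
  then have r: "reduced (f # w)" "f \<noteq> inv_letter e" by (auto simp: reduced_Cons)
  let ?v = "\<phi> (f # w)" and ?k = "\<kappa> e f"
  have IH: "take (m f w) ?v = take (m f w) (\<phi> [f])" "m f w + length w \<le> length ?v"
    using Cons.IH[OF r(1)] by auto
  have "?k < m f w"
  proof (cases "w = []")
    case True
    have "2 * ?k \<le> length (\<phi> [f])" by (rule kappa_le_half'(2)[OF r(2)])
    moreover have "length (\<phi> [f]) > 0" using nonempty by blast
    ultimately have "?k < length (\<phi> [f])" by linarith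
    then show ?thesis using True by (simp add: m_def)
  next
    case False
    then have "hd w \<noteq> inv_letter f" using r(1) by (simp add: reduced_Cons)
    from kappa_no_dissolution[OF r(2) this] show ?thesis using False by (simp add: m_def)
  qed
  have lcp: "lcp (\<phi> [inv_letter e]) ?v = ?k"
    unfolding \<kappa>_def
  proof (rule lcp_cong_take)
    show "take (m f w) (\<phi> [f]) = take (m f w) ?v" using IH by simp
    show "lcp (\<phi> [inv_letter e]) (\<phi> [f]) < m f w" using \<open>?k < m f w\<close> by (simp add: \<kappa>_def)
    show "m f w \<le> length (\<phi> [f])" by (simp add: m_def)
    show "m f w \<le> length ?v" using IH by simp
  qed
  have rv: "reduced ?v" using hom_reduced[OF hom r(1)] .
  have "\<phi> (e # f # w) = free_reduce (\<phi> [e] @ ?v)"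
    using hom_mult[OF hom, of "[e]" "f # w"] Cons.prems r by simp
  also have "\<dots> = free_reduce (winv (\<phi> [inv_letter e]) @ ?v)" by (simp add: inv_image)
  also have "\<dots> = winv (drop ?k (\<phi> [inv_letter e])) @ drop ?k ?v"
    using free_reduce_lcp[of "\<phi> [inv_letter e]" ?v] rv by (simp add: lcp)
  also have "winv (drop ?k (\<phi> [inv_letter e])) = take (m e (f # w)) (\<phi> [e])"
    by (simp add: inv_image winv_def m_def drop_rev drop_map rev_map o_def take_map)
  finally have eq: "\<phi> (e # f # w) = take (m e (f # w)) (\<phi> [e]) @ drop ?k ?v" .
  have "length (take (m e (f # w)) (\<phi> [e])) = m e (f # w)" by (simp add: m_def)
  moreover have "length (drop ?k ?v) \<ge> Suc (length w)" using IH(2) \<open>?k < m f w\<close> by simp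
  ultimately show ?case unfolding eq by simp
qed

lemma length_image: "reduced w \<Longrightarrow> length w \<le> length (\<phi> w)"
proof (cases w)
  case (Cons e v)
  assume r: "reduced w"
  have "length (\<phi> [e]) - (if v = [] then 0 else \<kappa> e (hd v)) > 0"
  proof (cases "v = []")
    case True
    then show ?thesis using nonempty by simp
  next
    case False
    then have "hd v \<noteq> inv_letter e" using r Cons by (simp add: reduced_Cons)
    from kappa_le_half'(1)[OF this] have "2 * \<kappa> e (hd v) \<le> length (\<phi> [e])" .
    moreover have "length (\<phi> [e]) > 0" using nonempty by blast
    ultimately have "\<kappa> e (hd v) < length (\<phi> [e])" by linarith
    then show ?thesis using False by simp
  qed
  moreover have "length (\<phi> [e]) - (if v = [] then 0 else \<kappa> e (hd v)) + length v \<le> length (\<phi> (e # v))"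
    using image_prefix[of e v] r Cons by blast
  ultimately show ?thesis unfolding Cons length_Cons by linarith
qed simp

text \<open>Each letter is the image of a word, which by \<open>length_image\<close> has length one.\<close>

lemma signed_perm: "\<exists>\<pi>. signed_perm \<pi> \<and> (\<forall>w. reduced w \<longrightarrow> \<phi> w = map \<pi> w)"
proof -
  have "\<exists>b. \<phi> [b] = [a]" for a
  proof -
    obtain w where w: "reduced w" "\<phi> w = [a]" using iso_F2D(3)[OF iso, of "[a]"] by auto
    then have "length w \<le> 1" "w \<noteq> []" using length_image[of w] hom_Nil[OF hom] by auto
    then obtain b where "w = [b]" by (cases w) auto
    then show ?thesis using w by blast
  qed
  then obtain \<rho> where \<rho>: "\<phi> [\<rho> a] = [a]" for a by metis
  have "inj \<rho>" by (rule injI) (metis \<rho> list.inject)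
  then have "surj \<rho>" using finite_UNIV_inj_surj[of \<rho>] by (simp add: UNIV_letter)
  define \<pi> where "\<pi> = inv_into UNIV \<rho>"
  have \<pi>: "\<phi> [b] = [\<pi> b]" for b
    using \<rho>[of "\<pi> b"] \<open>surj \<rho>\<close> by (simp add: \<pi>_def surj_f_inv_f)
  have "inj \<pi>" using \<open>surj \<rho>\<close> by (simp add: \<pi>_def surj_imp_inj_inv)
  moreover have "\<pi> (inv_letter b) = inv_letter (\<pi> b)" for b
    using inv_image[of b] by (simp add: \<pi>)
  ultimately have s: "signed_perm \<pi>" unfolding signed_perm_def by blast
  have "\<phi> w = map \<pi> w" if "reduced w" for w
    using hom_eq_ext[OF hom that] map_eq_ext[of \<pi> w] that s by (simp add: \<pi>)
  then show ?thesis using s by blast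
qed

end

text \<open>Descent on the total length.\<close>

theorem iso_F2_generated: "\<phi> \<in> iso F2 F2 \<Longrightarrow> generated \<phi>"
proof (induction "total \<phi>" arbitrary: \<phi> rule: less_induct)
  case less
  show ?case
  proof (cases "minimal_iso \<phi>")
    case True
    then obtain \<pi> where "signed_perm \<pi>" "\<And>w. reduced w \<Longrightarrow> \<phi> w = map \<pi> w"
      using minimal_iso.signed_perm by blast
    then show ?thesis unfolding generated_def by (simp add: closed_predD)
  next
    case False
    then obtain c d where cd: "fst c \<noteq> fst d"
      and *: "total (\<lambda>w. \<phi> (transv c d w)) < total \<phi> \<or>
        (\<exists>g. total (\<lambda>w. free_reduce (winv g @ \<phi> (transv c d w) @ g)) < total \<phi>)"
      using less.prems unfolding minimal_iso_def by (metis not_le_imp_less)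
    have i: "(\<lambda>w. \<phi> (transv c d w)) \<in> iso F2 F2" using iso_comp[OF transv_iso[OF cd] less.prems] .
    from * have "generated (\<lambda>w. \<phi> (transv c d w))"
    proof
      assume "total (\<lambda>w. \<phi> (transv c d w)) < total \<phi>"
      then show ?thesis using less.hyps i by blast
    next
      assume "\<exists>g. total (\<lambda>w. free_reduce (winv g @ \<phi> (transv c d w) @ g)) < total \<phi>"
      then obtain g where g: "total (\<lambda>w. free_reduce (winv g @ \<phi> (transv c d w) @ g)) < total \<phi>" ..
      have "(\<lambda>w. free_reduce (winv g @ \<phi> (transv c d w) @ g)) \<in> iso F2 F2"
        using iso_comp[OF i inner_iso] .
      then show ?thesis using less.hyps[OF g] generated_inner_cancel[OF i] by blast
    qed
    then show ?thesis by (rule generated_transv_cancel[OF cd less.prems])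
  qed
qed

section \<open>Peak reduction\<close>

text \<open>No neighbour has a shorter cyclic word.\<close>

definition loc_min :: "word \<Rightarrow> bool" where
  "loc_min u \<longleftrightarrow> (\<forall>\<pi>. signed_perm \<pi> \<longrightarrow> clen u \<le> clen (tv (map \<pi> u)))"

text \<open>Paths from \<open>u\<close> on which \<open>clen\<close> never decreases, and those on which it is constant.\<close>

inductive ascent :: "word \<Rightarrow> word \<Rightarrow> bool" for u where
  ascent_refl: "ascent u u"
| ascent_map: "ascent u v \<Longrightarrow> signed_perm \<pi> \<Longrightarrow> ascent u (map \<pi> v)"
| ascent_conj: "ascent u v \<Longrightarrow> conjF v w \<Longrightarrow> ascent u w"
| ascent_tv: "ascent u v \<Longrightarrow> clen v \<le> clen (tv v) \<Longrightarrow> ascent u (tv v)"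

inductive level :: "word \<Rightarrow> word \<Rightarrow> bool" for u where
  level_refl: "level u u"
| level_map: "level u v \<Longrightarrow> signed_perm \<pi> \<Longrightarrow> level u (map \<pi> v)"
| level_conj: "level u v \<Longrightarrow> conjF v w \<Longrightarrow> level u w"
| level_tv: "level u v \<Longrightarrow> clen (tv v) = clen v \<Longrightarrow> level u (tv v)"

lemma conjF_tv_map: "signed_perm \<pi> \<Longrightarrow> conjF v w \<Longrightarrow> conjF (tv (map \<pi> v)) (tv (map \<pi> w))"
  by (intro conjF_tv conjF_map)

text \<open>Induction along the path. If a step from its last word \<open>tv v\<close> decreases the length, then by \<open>peak\<close> it
  leads to \<open>v\<close> or to a neighbour of \<open>v\<close>, to which the induction hypothesis for \<open>v\<close> applies.
  At the start of the path there is no decreasing step.\<close>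

lemma ascent_closed:
  assumes "loc_min u"
  shows "ascent u v \<Longrightarrow> signed_perm \<pi> \<Longrightarrow> ascent u (tv (map \<pi> v))"
proof (induction v arbitrary: \<pi> rule: ascent.induct)
  case ascent_refl
  then show ?case using assms unfolding loc_min_def
    by (intro ascent_tv ascent_map ascent.ascent_refl) (auto simp: clen_map)
next
  case (ascent_map v \<rho>)
  then show ?case using signed_perm_comp[of \<pi> \<rho>] by simp
next
  case (ascent_conj v w)
  then show ?case using conjF_tv_map ascent.ascent_conj by blast
next
  case (ascent_tv v)
  show ?case
  proof (cases "clen (tv v) \<le> clen (tv (map \<pi> (tv v)))")
    case True
    then show ?thesis using ascent_tv
      by (intro ascent.ascent_tv ascent_map) (auto simp: clen_map)
  next
    case False
    then have "same_triangle v (tv (map \<pi> (tv v)))"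
      using peak[OF ascent_tv.hyps(2) ascent_tv.prems] by simp
    then show ?thesis
      unfolding same_triangle_def
    proof (elim disjE exE conjE)
      fix \<rho> assume "signed_perm \<rho>" "conjF (tv (map \<pi> (tv v))) (map \<rho> v)"
      then show ?thesis using ascent_map[OF ascent_tv.hyps(1)] ascent_conj conjF_sym by blast
    next
      fix \<rho> \<sigma> assume "signed_perm \<rho>" "signed_perm \<sigma>"
        "conjF (tv (map \<pi> (tv v))) (map \<rho> (tv (map \<sigma> v)))"
      then show ?thesis using ascent_map[OF ascent_tv.IH] ascent_conj conjF_sym by blast
    qed
  qed
qed

lemma ascent_iso:
  assumes "loc_min u" "ascent u v" "reduced v" "\<phi> \<in> iso F2 F2"
  shows "ascent u (\<phi> v)"
proof -
  have "closed_pred (ascent u)"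
    unfolding closed_pred_def
  proof (intro conjI allI impI)
    show "ascent u (free_reduce (winv g @ w @ g))" if "ascent u w" for g w
      using that by (rule ascent_conj) (rule conjFI[of _ g], simp)
    show "ascent u (tv w)" if "ascent u w" for w
      using ascent_closed[OF assms(1) that signed_perm_id] by simp
  qed (rule ascent_map)
  then show ?thesis using iso_F2_generated[OF assms(4)] assms(2,3) unfolding generated_def by blast
qed

lemma ascent_level: "ascent u v \<Longrightarrow> clen u \<le> clen v \<and> (clen v = clen u \<longrightarrow> level u v)"
proof (induction v rule: ascent.induct)
  case (ascent_conj v w)
  then show ?case using level_conj by (auto simp: core_eq_iff[symmetric])
next
  case (ascent_tv v)
  then show ?case using level_tv by fastforce
qed (auto intro: level.intros simp: clen_map)

lemma level_ascent: "level u v \<Longrightarrow> ascent u v \<and> clen v = clen u"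
proof (induction v rule: level.induct)
  case (level_conj v w)
  then show ?case using ascent_conj by (auto simp: core_eq_iff[symmetric])
qed (auto intro: ascent.intros simp: clen_map)

theorem clen_loc_min:
  assumes "loc_min u" "reduced u" "\<phi> \<in> iso F2 F2"
  shows "clen u \<le> clen (\<phi> u)" "clen (\<phi> u) = clen u \<Longrightarrow> level u (\<phi> u)"
  using ascent_level[OF ascent_iso[OF assms(1) ascent_refl assms(2,3)]] by blast+

lemma level_loc_min: "loc_min u \<Longrightarrow> level u v \<Longrightarrow> loc_min v"
  unfolding loc_min_def[of v]
  using ascent_closed[of u v] level_ascent[of u v] ascent_level by metis

section \<open>Counting the words of minimal length\<close>

text \<open>If \<open>x\<close> is less frequent than \<open>y\<close>, then replacing \<open>y\<close> cannot preserve the minimal length: the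
  replacement of \<open>x\<close> that profits from the same digrams would reduce it.\<close>

lemma unbalanced_level:
  assumes "loc_min v" "kx v < ky v" "signed_perm \<pi>" "clen (tv (map \<pi> v)) = clen v"
  shows "\<exists>s t. \<pi> = sp (X1, s) (X2, t)"
  using assms(3)
proof (cases \<pi> rule: signed_perm_cases)
  case (2 s t)
  have "clen v \<le> clen (tv (map (sp (X1, s) (X2, t)) v))"
    using assms(1) signed_perm_sp by (simp add: loc_min_def)
  then have "2 * (kc v (X1, s) (X2, \<not> t) + kc v (X2, t) (X1, \<not> s)) \<le> kx v"
    using clen_tv_sp(1)[of s t v] by linarith
  then have False using clen_tv_sp(2)[of s t v] assms(2) assms(4)[unfolded 2] by linarith
  then show ?thesis ..
qed blast

lemma tv_sp_tv:
  "s \<noteq> t \<Longrightarrow> conjF (tv (map (sp (X1, s) (X2, t)) (tv w))) (map (sp (X1, s) (X2, t)) w)"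
  using tv_inv_y_tv[of w] tv_inv_x_tv[of w] conjF_eqF by (cases s; cases t) auto

lemma ky_tv: "clen (tv w) = clen w \<Longrightarrow> ky (tv w) = ky w"
  using clen_sum[of w] clen_sum[of "tv w"] kx_tv[of w] by simp

lemma clen_conjF: "conjF v w \<Longrightarrow> clen v = clen w"
  by (simp add: core_eq_iff[symmetric])

text \<open>By \<open>unbalanced_level\<close>, a step of constant length from \<open>tv\<^sup>k \<sigma> u\<close> is preceded by a signed
  permutation that does not interchange the generators; it increases or decreases \<open>k\<close> by one.
  The direction is chosen by \<open>\<sigma>\<close> when \<open>k = 0\<close>. Which generator is less frequent is part of the claim
  because it has to be known at each step.\<close>

lemma unbalanced_family:
  assumes "loc_min u" "kx u \<noteq> ky u" "level u v"
  shows "\<exists>\<rho> k \<sigma>. signed_perm \<rho> \<and> signed_perm \<sigma> \<and> conjF v (map \<rho> ((tv ^^ k) (map \<sigma> u))) \<and>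
    kx ((tv ^^ k) (map \<sigma> u)) < ky ((tv ^^ k) (map \<sigma> u))"
  using assms(3)
proof (induction v rule: level.induct)
  case level_refl
  have "\<exists>\<sigma>. signed_perm \<sigma> \<and> kx (map \<sigma> u) < ky (map \<sigma> u)"
  proof (cases "kx u < ky u")
    case True
    then show ?thesis using signed_perm_id by (intro exI[of _ id]) simp
  next
    case False
    then show ?thesis using assms(2) kx_ky_map(3,4)[of True True u] signed_perm_sp[of py px]
      by (intro exI[of _ "sp py px"]) simp
  qed
  then obtain \<sigma> where \<sigma>: "signed_perm \<sigma>" "kx (map \<sigma> u) < ky (map \<sigma> u)" by blast
  have "conjF u (map (inv_into UNIV \<sigma>) ((tv ^^ 0) (map \<sigma> u)))"
    using map_inv_signed_perm(1)[OF \<sigma>(1), of u] by (simp del: map_map)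
  then show ?case using \<sigma> signed_perm_the_inv[OF \<sigma>(1)]
    by (intro exI[of _ "inv_into UNIV \<sigma>"] exI[of _ 0] exI[of _ \<sigma>]) simp
next
  case (level_map v \<pi>)
  then obtain \<rho> k \<sigma> where *: "signed_perm \<rho>" "signed_perm \<sigma>" "conjF v (map \<rho> ((tv ^^ k) (map \<sigma> u)))"
    "kx ((tv ^^ k) (map \<sigma> u)) < ky ((tv ^^ k) (map \<sigma> u))" by blast
  have "conjF (map \<pi> v) (map (\<pi> \<circ> \<rho>) ((tv ^^ k) (map \<sigma> u)))"
    using conjF_map[OF level_map.hyps(2) *(3)] by simp
  then show ?case using * signed_perm_comp[OF level_map.hyps(2) *(1)] by blast
next
  case (level_conj v w)
  then show ?case using conjF_trans[OF conjF_sym[OF level_conj.hyps(2)]] by blast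
next
  case (level_tv v)
  then obtain \<rho> k \<sigma> where *: "signed_perm \<rho>" "signed_perm \<sigma>" "conjF v (map \<rho> ((tv ^^ k) (map \<sigma> u)))"
    "kx ((tv ^^ k) (map \<sigma> u)) < ky ((tv ^^ k) (map \<sigma> u))" by blast
  define z where "z = (tv ^^ k) (map \<sigma> u)"
  have vz: "conjF v (map \<rho> z)" and k: "kx z < ky z" using * by (simp_all add: z_def)
  have tvv: "conjF (tv v) (tv (map \<rho> z))" using conjF_tv[OF vz] .
  have cz: "clen (tv (map \<rho> z)) = clen z"
    using clen_conjF[OF tvv] clen_conjF[OF vz] clen_map[OF *(1)] level_tv.hyps(2) by simp
  have "level u z"
  proof -
    have "level u (map (inv_into UNIV \<rho>) (map \<rho> z))"
      using level_map[OF level_conj[OF level_tv.hyps(1) vz] signed_perm_the_inv[OF *(1)]] .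
    then show ?thesis using map_inv_signed_perm(1)[OF *(1)] by simp
  qed
  then have "loc_min z" using level_loc_min assms(1) by blast
  from unbalanced_level[OF this k *(1) cz] obtain s t where \<rho>: "\<rho> = sp (X1, s) (X2, t)" by blast
  show ?case
  proof (cases "s = t")
    case True
    have "conjF (tv (map \<rho> z)) (map \<rho> (tv z))"
    proof (cases s)
      case True
      then have "\<rho> = id" using \<open>s = t\<close> signed_perm_eq_sp[OF signed_perm_id] \<rho> by simp
      then show ?thesis by simp
    next
      case False
      then have "\<rho> = inv_letter" using \<open>s = t\<close> signed_perm_eq_sp[OF signed_perm_inv_letter] \<rho> by simp
      then show ?thesis using tv_inv_letter by simp
    qed
    then have c: "conjF (tv v) (map \<rho> ((tv ^^ Suc k) (map \<sigma> u)))"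
      using conjF_trans[OF tvv] by (simp add: z_def)
    have "clen (tv z) = clen z"
      using cz clen_conjF[OF \<open>conjF (tv (map \<rho> z)) (map \<rho> (tv z))\<close>] clen_map[OF *(1)] by simp
    then have "kx ((tv ^^ Suc k) (map \<sigma> u)) < ky ((tv ^^ Suc k) (map \<sigma> u))"
      using k kx_tv[of z] ky_tv[of z] by (simp add: z_def)
    then show ?thesis using c *(1,2) by blast
  next
    case st: False
    show ?thesis
    proof (cases k)
      case 0
      then have z: "z = map \<sigma> u" by (simp add: z_def)
      \<comment> \<open>At \<open>k = 0\<close> the direction is still open, and \<open>\<rho>\<close> is absorbed into \<open>\<sigma>\<close>.\<close>
      let ?\<sigma> = "\<rho> \<circ> \<sigma>"
      have eq: "(tv ^^ Suc 0) (map ?\<sigma> u) = tv (map \<rho> z)" by (simp add: z)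
      have "conjF (tv v) (map id ((tv ^^ Suc 0) (map ?\<sigma> u)))" using tvv eq by simp
      moreover have "kx (tv (map \<rho> z)) < ky (tv (map \<rho> z))"
        using k kx_tv[of "map \<rho> z"] ky_tv[of "map \<rho> z"] cz clen_map[OF *(1)] kx_ky_map(1,2) by (simp add: \<rho>)
      ultimately show ?thesis
        using signed_perm_id signed_perm_comp[OF *(1,2)] unfolding eq[symmetric] by blast
    next
      case (Suc j)
      \<comment> \<open>The step undoes the last transvection.\<close>
      define y where "y = (tv ^^ j) (map \<sigma> u)"
      have z: "z = tv y" by (simp add: z_def y_def Suc)
      have c: "conjF (tv (map \<rho> z)) (map \<rho> y)" unfolding z \<rho> by (rule tv_sp_tv[OF st])
      then have "clen y = clen (tv y)" using cz clen_conjF[OF c] clen_map[OF *(1)] z by simp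
      then have "kx y < ky y" using k kx_tv[of y] ky_tv[of y] by (simp add: z)
      then show ?thesis using conjF_trans[OF tvv c] *(1,2) unfolding y_def by blast
    qed
  qed
qed

lemma unbalanced_family_bounded:
  assumes "loc_min u" "kx u \<noteq> ky u" "level u v"
  shows "\<exists>\<rho> k \<sigma>. signed_perm \<rho> \<and> signed_perm \<sigma> \<and> k \<le> 2 * clen u + 1 \<and>
    conjF v (map \<rho> ((tv ^^ k) (map \<sigma> u)))"
proof -
  obtain \<rho> k \<sigma> where *: "signed_perm \<rho>" "signed_perm \<sigma>" "conjF v (map \<rho> ((tv ^^ k) (map \<sigma> u)))"
    using unbalanced_family[OF assms] by blast
  show ?thesis
  proof (cases "k \<le> 2 * clen u + 1")
    case True
    then show ?thesis using * by blast
  next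
    case False
    let ?c = "map \<sigma> u"
    have "conjF (tv ?c) ?c"
    proof (rule ccontr)
      assume "\<not> conjF (tv ?c) ?c"
      from clen_tv_iterate[OF this, of k] False have "clen ((tv ^^ k) ?c) > clen u"
        using clen_map[OF *(2)] by simp
      moreover have "clen ((tv ^^ k) ?c) = clen v" using clen_conjF[OF *(3)] clen_map[OF *(1)] by simp
      ultimately show False using level_ascent[OF assms(3)] by simp
    qed
    from conjF_map[OF *(1) conjF_tv_fixed[OF this, of k]]
    have "conjF v (map \<rho> ((tv ^^ 0) ?c))" using conjF_trans[OF *(3)] by simp
    then show ?thesis using *(1,2) by (metis le0)
  qed
qed

lemma kx_ky_map_eq: assumes "signed_perm \<pi>" "kx w = ky w" shows "kx (map \<pi> w) = ky (map \<pi> w)"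
  using assms(1) by (cases \<pi> rule: signed_perm_cases) (use assms(2) kx_ky_map in auto)

text \<open>It has to be shown that a third step leads to nothing new. The path visits \<open>w\<close>, \<open>tv w\<close>, \<open>tv y\<close> and the
  word after the third step. By \<open>level_branching\<close>, unless three successive words lie in one triangle,
  so that a step can be saved, both \<open>tv w\<close> and \<open>tv y\<close> are alternating; but then they are the same
  cyclic word up to a signed permutation, by \<open>alternating_tv_fixed\<close>.\<close>

lemma balanced_family:
  assumes "kx u = ky u" "level u v"
  shows "\<exists>\<rho>. signed_perm \<rho> \<and> (conjF v (map \<rho> u) \<or>
    (\<exists>\<sigma>. signed_perm \<sigma> \<and> conjF v (map \<rho> (tv (map \<sigma> u)))) \<or>
    (\<exists>\<sigma> \<pi>. signed_perm \<sigma> \<and> signed_perm \<pi> \<and> clen (tv (map \<sigma> u)) = clen u \<and>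
       conjF v (map \<rho> (tv (map \<pi> (tv (map \<sigma> u)))))))"
    (is "\<exists>\<rho>. signed_perm \<rho> \<and> ?Q v \<rho>")
  using assms(2)
proof (induction v rule: level.induct)
  case level_refl
  have "?Q u id" by simp
  then show ?case using signed_perm_id by blast
next
  case (level_map v \<tau>)
  then obtain \<rho> where \<rho>: "signed_perm \<rho>" "?Q v \<rho>" by blast
  have "conjF (map \<tau> v) (map (\<tau> \<circ> \<rho>) y)" if "conjF v (map \<rho> y)" for y
    using conjF_map[OF level_map.hyps(2) that] by simp
  then have "?Q (map \<tau> v) (\<tau> \<circ> \<rho>)" using \<rho>(2) by blast
  then show ?case using signed_perm_comp[OF level_map.hyps(2) \<rho>(1)] by blast
next
  case (level_conj v w)
  then show ?case using conjF_trans[OF conjF_sym[OF level_conj.hyps(2)]] by meson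
next
  case (level_tv v)
  then obtain \<rho> where \<rho>: "signed_perm \<rho>" "?Q v \<rho>" by blast
  have n: "clen v = clen u" "clen (tv v) = clen u"
    using level_ascent[OF level_tv.hyps(1)] level_tv.hyps(2) by auto
  have zero: ?case if "signed_perm \<sigma>" "conjF (tv v) (tv (map \<sigma> u))" for \<sigma>
  proof -
    have "conjF (tv v) (map id (tv (map \<sigma> u)))" using that by simp
    then show ?thesis using signed_perm_id that(1) by blast
  qed
  have two: ?case if \<sigma>: "signed_perm \<sigma>" and \<pi>: "signed_perm \<pi>" "signed_perm \<tau>"
    and "clen (tv (map \<sigma> u)) = clen u" "conjF (tv v) (map \<tau> (tv (map \<pi> (tv (map \<sigma> u)))))" for \<sigma> \<pi> \<tau>
    using that by blast
  have one: ?case if "signed_perm \<tau>" "signed_perm \<sigma>" "conjF (tv v) (map \<tau> (tv (map \<sigma> u)))" for \<tau> \<sigma>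
    using that by blast
  consider "conjF v (map \<rho> u)"
    | \<sigma> where "signed_perm \<sigma>" "conjF v (map \<rho> (tv (map \<sigma> u)))"
    | \<sigma> \<pi> where "signed_perm \<sigma>" "signed_perm \<pi>" "clen (tv (map \<sigma> u)) = clen u"
       "conjF v (map \<rho> (tv (map \<pi> (tv (map \<sigma> u)))))"
    using \<rho>(2) by blast
  then show ?case
  proof cases
    case 1
    then show ?thesis using zero[OF \<rho>(1)] conjF_tv by blast
  next
    case (2 \<sigma>)
    have "clen (tv (map \<sigma> u)) = clen u" using clen_conjF[OF 2(2)] clen_map[OF \<rho>(1)] n by simp
    moreover have "conjF (tv v) (map id (tv (map \<rho> (tv (map \<sigma> u)))))" using conjF_tv[OF 2(2)] by simp
    ultimately show ?thesis using two[OF 2(1) \<rho>(1) signed_perm_id] by blast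
  next
    case (3 \<sigma> \<pi>)
    define w where "w = map \<sigma> u"
    define y where "y = map \<pi> (tv w)"
    have vy: "conjF v (map \<rho> (tv y))" using 3 by (simp add: w_def y_def)
    have tvy: "conjF (tv v) (tv (map \<rho> (tv y)))" using conjF_tv[OF vy] .
    have cw: "clen w = clen u" "clen (tv w) = clen u" "clen y = clen u" "clen (tv y) = clen u"
      "clen (tv (map \<rho> (tv y))) = clen u"
      using clen_map 3 clen_conjF[OF vy] clen_conjF[OF tvy] n \<rho>(1) by (simp_all add: w_def y_def)
    have kw: "kx (tv w) = ky (tv w)"
      using kx_ky_map_eq[OF 3(1) assms(1)] kx_tv[of w] ky_tv[of w] cw by (simp add: w_def)
    have ky: "kx (tv y) = ky (tv y)"
      using kx_ky_map_eq[OF 3(2) kw] kx_tv[of y] ky_tv[of y] cw by (simp add: y_def)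
    have "same_triangle w (tv y) \<or> alternating (tv w)"
      unfolding y_def by (rule level_branching[OF _ 3(2) _ kw]) (use cw in \<open>simp_all add: y_def\<close>)
    then show ?thesis
    proof
      assume "same_triangle w (tv y)"
      then show ?thesis unfolding same_triangle_def
      proof (elim disjE exE conjE)
        fix \<tau> assume \<tau>: "signed_perm \<tau>" "conjF (tv y) (map \<tau> w)"
        have "conjF (tv v) (tv (map (\<rho> \<circ> \<tau> \<circ> \<sigma>) u))"
          using conjF_trans[OF tvy conjF_tv_map[OF \<rho>(1) \<tau>(2)]] by (simp add: w_def o_assoc)
        then show ?thesis using zero signed_perm_comp[OF signed_perm_comp[OF \<rho>(1) \<tau>(1)] 3(1)] by blast
      next
        fix \<tau> \<tau>' assume \<tau>: "signed_perm \<tau>" "signed_perm \<tau>'" "conjF (tv y) (map \<tau> (tv (map \<tau>' w)))"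
        have "clen (tv (map (\<tau>' \<circ> \<sigma>) u)) = clen u"
          using clen_conjF[OF \<tau>(3)] clen_map[OF \<tau>(1)] cw by (simp add: w_def)
        moreover have "conjF (tv v) (map id (tv (map (\<rho> \<circ> \<tau>) (tv (map (\<tau>' \<circ> \<sigma>) u)))))"
          using conjF_trans[OF tvy conjF_tv_map[OF \<rho>(1) \<tau>(3)]] by (simp add: w_def)
        ultimately show ?thesis
          using two signed_perm_comp[OF \<tau>(2) 3(1)] signed_perm_comp[OF \<rho>(1) \<tau>(1)] signed_perm_id by blast
      qed
    next
      assume "alternating (tv w)"
      then have ay: "alternating y" using alternating_map[OF 3(2)] by (simp add: y_def)
      have "same_triangle y (tv (map \<rho> (tv y))) \<or> alternating (tv y)"
        by (rule level_branching[OF _ \<rho>(1) _ ky]) (use cw in simp_all)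
      then show ?thesis
      proof
        assume "same_triangle y (tv (map \<rho> (tv y)))"
        then show ?thesis unfolding same_triangle_def
        proof (elim disjE exE conjE)
          fix \<tau> assume \<tau>: "signed_perm \<tau>" "conjF (tv (map \<rho> (tv y))) (map \<tau> y)"
          have "conjF (tv v) (map (\<tau> \<circ> \<pi>) (tv (map \<sigma> u)))"
            using conjF_trans[OF tvy \<tau>(2)] by (simp add: y_def w_def)
          then show ?thesis using one signed_perm_comp[OF \<tau>(1) 3(2)] 3(1) by blast
        next
          fix \<tau> \<tau>' assume \<tau>: "signed_perm \<tau>" "signed_perm \<tau>'"
            "conjF (tv (map \<rho> (tv y))) (map \<tau> (tv (map \<tau>' y)))"
          have "conjF (tv v) (map \<tau> (tv (map (\<tau>' \<circ> \<pi>) (tv (map \<sigma> u)))))"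
            using conjF_trans[OF tvy \<tau>(3)] by (simp add: y_def w_def)
          then show ?thesis using two[OF 3(1) signed_perm_comp[OF \<tau>(2) 3(2)] \<tau>(1) 3(3)] by blast
        qed
      next
        assume "alternating (tv y)"
        then have "conjF (tv y) y" using alternating_tv_fixed[OF ay] by blast
        from conjF_trans[OF tvy conjF_tv_map[OF \<rho>(1) this]]
        have "conjF (tv v) (map id (tv (map (\<rho> \<circ> \<pi>) (tv (map \<sigma> u)))))"
          by (simp add: y_def w_def)
        then show ?thesis using two[OF 3(1) signed_perm_comp[OF \<rho>(1) 3(2)] signed_perm_id 3(3)] by blast
      qed
    qed
  qed
qed

lemma rotations_finite:
  "finite {w. cyc_reduced w \<and> length w = n \<and> conjF f w} \<and>
   card {w. cyc_reduced w \<and> length w = n \<and> conjF f w} \<le> Suc n"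
proof -
  have "{w. cyc_reduced w \<and> length w = n \<and> conjF f w} \<subseteq> (\<lambda>k. rotate k (core f)) ` {..n}"
  proof
    fix w assume w: "w \<in> {w. cyc_reduced w \<and> length w = n \<and> conjF f w}"
    then have "conjF (core f) w" using conjF_trans[OF conjF_sym[OF core(2)]] by blast
    then obtain k where k: "w = rotate k (core f)"
      using conjF_cyc_reduced_rotate[OF core(1)] w by blast
    have "w = rotate (k mod n) (core f)" using k w rotate_conv_mod by auto
    moreover have "k mod n \<le> n \<or> n = 0" by (cases "n = 0") (auto intro: less_imp_le)
    moreover have "n = 0 \<Longrightarrow> w = rotate 0 (core f)" using w k by auto
    ultimately show "w \<in> (\<lambda>k. rotate k (core f)) ` {..n}" by blast
  qed
  moreover have "card ((\<lambda>k. rotate k (core f)) ` {..n}) \<le> Suc n"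
    using card_image_le[of "{..n}"] by simp
  ultimately show ?thesis
    using card_mono[of "(\<lambda>k. rotate k (core f)) ` {..n}"] finite_subset[of _ "(\<lambda>k. rotate k (core f)) ` {..n}"]
    by (meson finite_atMost finite_imageI le_trans)
qed

text \<open>The two families found above have linearly many members, and each cyclic word of length \<open>n\<close> has at most \<open>n + 1\<close>
  rotations.\<close>

theorem card_level:
  "\<exists>K. \<forall>u. loc_min u \<longrightarrow> finite {w. cyc_reduced w \<and> level u w} \<and>
     card {w. cyc_reduced w \<and> level u w} \<le> K * (clen u + 1) ^ 2"
proof -
  define S where "S = {\<pi>. signed_perm \<pi>}"
  have fS: "finite S" unfolding S_def by (rule finite_signed_perm)
  define p where "p = card S"
  show ?thesis
  proof (intro exI allI impI)
    fix u assume u: "loc_min u"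
    let ?n = "clen u"
    define F1 where "F1 = (\<lambda>(\<rho>, k, \<sigma>). map \<rho> ((tv ^^ k) (map \<sigma> u))) ` (S \<times> {..2 * ?n + 1} \<times> S)"
    define F2 where "F2 = (\<lambda>(\<rho>, \<pi>, \<sigma>). map \<rho> (tv (map \<pi> (tv (map \<sigma> u))))) ` (S \<times> S \<times> S)"
    have fin: "finite F1" "finite F2" unfolding F1_def F2_def using fS by simp_all
    have "card F1 \<le> card (S \<times> {..2 * ?n + 1} \<times> S)" unfolding F1_def by (rule card_image_le) (simp add: fS)
    also have "\<dots> = p * ((2 * ?n + 2) * p)" by (simp add: card_cartesian_product p_def)
    finally have c1: "card F1 \<le> p * ((2 * ?n + 2) * p)" .
    have "card F2 \<le> card (S \<times> S \<times> S)" unfolding F2_def by (rule card_image_le) (simp add: fS)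
    also have "\<dots> = p * (p * p)" by (simp add: card_cartesian_product p_def)
    finally have c2: "card F2 \<le> p * (p * p)" .
    let ?R = "\<lambda>f. {w. cyc_reduced w \<and> length w = ?n \<and> conjF f w}"
    have sub: "{w. cyc_reduced w \<and> level u w} \<subseteq> (\<Union>f\<in>F1 \<union> F2. ?R f)"
    proof
      fix w assume "w \<in> {w. cyc_reduced w \<and> level u w}"
      then have w: "cyc_reduced w" "level u w" by auto
      have len: "length w = ?n" using level_ascent[OF w(2)] clen_cyc_reduced[OF w(1)] by simp
      have "\<exists>f\<in>F1 \<union> F2. conjF w f"
      proof (cases "kx u = ky u")
        case False
        from unbalanced_family_bounded[OF u this w(2)] obtain \<rho> k \<sigma> where
          "signed_perm \<rho>" "signed_perm \<sigma>" "k \<le> 2 * ?n + 1" "conjF w (map \<rho> ((tv ^^ k) (map \<sigma> u)))" by blast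
        then have "(\<rho>, k, \<sigma>) \<in> S \<times> {..2 * ?n + 1} \<times> S" by (simp add: S_def)
        then have "map \<rho> ((tv ^^ k) (map \<sigma> u)) \<in> F1" unfolding F1_def by (rule rev_image_eqI) simp
        then show ?thesis using \<open>conjF w _\<close> by blast
      next
        case True
        from balanced_family[OF this w(2)] obtain \<rho> where \<rho>: "signed_perm \<rho>" and
          "conjF w (map \<rho> ((tv ^^ 0) (map id u))) \<or>
          (\<exists>\<sigma>. signed_perm \<sigma> \<and> conjF w (map \<rho> ((tv ^^ 1) (map \<sigma> u)))) \<or>
          (\<exists>\<sigma> \<pi>. signed_perm \<sigma> \<and> signed_perm \<pi> \<and> conjF w (map \<rho> (tv (map \<pi> (tv (map \<sigma> u))))))"
          by auto
        then show ?thesis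
        proof (elim disjE exE conjE)
          assume c: "conjF w (map \<rho> ((tv ^^ 0) (map id u)))"
          have "(\<rho>, 0, id) \<in> S \<times> {..2 * ?n + 1} \<times> S" using \<rho> signed_perm_id by (simp add: S_def)
          then have "map \<rho> ((tv ^^ 0) (map id u)) \<in> F1" unfolding F1_def by (rule rev_image_eqI) simp
          then show ?thesis using c by blast
        next
          fix \<sigma> assume c: "conjF w (map \<rho> ((tv ^^ 1) (map \<sigma> u)))" and \<sigma>: "signed_perm \<sigma>"
          have "(\<rho>, 1, \<sigma>) \<in> S \<times> {..2 * ?n + 1} \<times> S" using \<rho> \<sigma> by (simp add: S_def)
          then have "map \<rho> ((tv ^^ 1) (map \<sigma> u)) \<in> F1" unfolding F1_def by (rule rev_image_eqI) simp
          then show ?thesis using c by blast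
        next
          fix \<sigma> \<pi> assume c: "conjF w (map \<rho> (tv (map \<pi> (tv (map \<sigma> u)))))"
            and \<sigma>: "signed_perm \<sigma>" "signed_perm \<pi>"
          have "(\<rho>, \<pi>, \<sigma>) \<in> S \<times> S \<times> S" using \<rho> \<sigma> by (simp add: S_def)
          then have "map \<rho> (tv (map \<pi> (tv (map \<sigma> u)))) \<in> F2" unfolding F2_def by (rule rev_image_eqI) simp
          then show ?thesis using c by blast
        qed
      qed
      then show "w \<in> (\<Union>f\<in>F1 \<union> F2. ?R f)" using w len conjF_sym by blast
    qed
    have finU: "finite (\<Union>f\<in>F1 \<union> F2. ?R f)" using fin rotations_finite by blast
    then show "finite {w. cyc_reduced w \<and> level u w} \<and>
      card {w. cyc_reduced w \<and> level u w} \<le> (2 * p * p + p * p * p) * (?n + 1) ^ 2"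
    proof (intro conjI)
      show "finite {w. cyc_reduced w \<and> level u w}" using finU sub by (rule rev_finite_subset)
      have "card {w. cyc_reduced w \<and> level u w} \<le> card (\<Union>f\<in>F1 \<union> F2. ?R f)"
        by (rule card_mono[OF finU sub])
      also have "\<dots> \<le> (\<Sum>f\<in>F1 \<union> F2. card (?R f))" by (rule card_UN_le) (simp add: fin)
      also have "\<dots> \<le> (\<Sum>f\<in>F1 \<union> F2. Suc ?n)" by (rule sum_mono) (use rotations_finite in blast)
      also have "\<dots> = card (F1 \<union> F2) * Suc ?n" by simp
      also have "\<dots> \<le> (p * ((2 * ?n + 2) * p) + p * (p * p)) * Suc ?n"
        using card_Un_le[of F1 F2] c1 c2 by (intro mult_right_mono) linarith+
      also have "\<dots> \<le> ((2 * p * p + p * p * p) * (?n + 1)) * (?n + 1)"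
        by (intro mult_mono) (auto simp: algebra_simps)
      also have "\<dots> = (2 * p * p + p * p * p) * (?n + 1) ^ 2" by (simp only: power2_eq_square mult.assoc)
      finally show "card {w. cyc_reduced w \<and> level u w} \<le> (2 * p * p + p * p * p) * (?n + 1) ^ 2" .
    qed
  qed
qed

section \<open>Elementary Whitehead automorphisms\<close>

lemma auto_F2_iff: "\<phi> \<in> auto F2 \<longleftrightarrow> \<phi> \<in> iso F2 F2 \<and> \<phi> \<in> extensional (carrier F2)"
  by (auto simp: auto_def Bij_def iso_def)

lemma whitehead_iso: "\<phi> \<in> whitehead_autos \<Longrightarrow> \<phi> \<in> iso F2 F2"
  by (simp add: whitehead_autos_def auto_F2_iff)

lemma length_whitehead_letter:
  assumes "\<phi> \<in> whitehead_autos"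
  shows "length (\<phi> [c]) \<le> 3"
proof -
  have inv: "length (\<phi> [inv_letter c]) = length (\<phi> [c])" for c
    using hom_winv[OF iso_F2D(1)[OF whitehead_iso[OF assms]], of "[c]"] by simp
  from assms consider "\<phi> ` {[a] | a. True} = {[a] | a. True}"
    | a where "\<phi> [a] = [a]" "\<And>x. x \<noteq> fst a \<Longrightarrow> \<phi> [(x, True)] \<in>
        {[(x, True)], [(x, True), a], [inv_letter a, (x, True)], [inv_letter a, (x, True), a]}"
    unfolding whitehead_autos_def by blast
  then show ?thesis
  proof cases
    case 1
    then have "\<phi> [c] \<in> {[a] | a. True}" by blast
    then show ?thesis by auto
  next
    case (2 a)
    have pos: "length (\<phi> [(fst c, True)]) \<le> 3"
    proof (cases "fst c = fst a")
      case True
      then have "(fst c, True) = a \<or> (fst c, True) = inv_letter a" by (cases a) auto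
      then show ?thesis using 2(1) inv[of a] by auto
    next
      case False
      from 2(2)[OF this] show ?thesis by auto
    qed
    show ?thesis
    proof (cases "snd c")
      case True
      then show ?thesis using pos by (cases c) auto
    next
      case False
      then have "inv_letter c = (fst c, True)" by (cases c) auto
      then show ?thesis using pos inv[of c] by simp
    qed
  qed
qed

lemma finite_whitehead_autos: "finite whitehead_autos"
proof -
  let ?L = "{w :: word. set w \<subseteq> UNIV \<and> length w \<le> 3}"
  have "inj_on (\<lambda>\<phi>. (\<phi> [px], \<phi> [py])) whitehead_autos"
  proof (rule inj_onI)
    fix \<phi> \<psi> assume W: "\<phi> \<in> whitehead_autos" "\<psi> \<in> whitehead_autos"
      and eq: "(\<phi> [px], \<phi> [py]) = (\<psi> [px], \<psi> [py])"
    note hom = iso_F2D(1)[OF whitehead_iso[OF W(1)]] iso_F2D(1)[OF whitehead_iso[OF W(2)]]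
    have inv: "\<phi> [inv_letter a] = \<psi> [inv_letter a]" if "\<phi> [a] = \<psi> [a]" for a
      using hom_winv[OF hom(1), of "[a]"] hom_winv[OF hom(2), of "[a]"] that by simp
    have "\<phi> [a] = \<psi> [a]" for a
      using eq inv[of px] inv[of py] by (cases a rule: letter_cases) auto
    then have "\<phi> w = \<psi> w" if "reduced w" for w
      using hom_eq_ext[OF hom(1) that] hom_eq_ext[OF hom(2) that] by simp
    moreover have "\<phi> \<in> extensional (carrier F2)" "\<psi> \<in> extensional (carrier F2)"
      using W by (auto simp: whitehead_autos_def auto_F2_iff)
    ultimately show "\<phi> = \<psi>" by (intro extensionalityI) auto
  qed
  moreover have "(\<lambda>\<phi>. (\<phi> [px], \<phi> [py])) ` whitehead_autos \<subseteq> ?L \<times> ?L"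
    using length_whitehead_letter by auto
  moreover have "finite (?L \<times> ?L)"
    by (intro finite_cartesian_product finite_lists_length_le) (simp_all add: UNIV_letter)
  ultimately show ?thesis using inj_on_finite by blast
qed

lemma restrict_auto:
  assumes "\<psi> \<in> iso F2 F2"
  shows "restrict \<psi> (carrier F2) \<in> auto F2"
proof -
  have "bij_betw (restrict \<psi> (carrier F2)) (carrier F2) (carrier F2)"
    using assms by (simp add: iso_def)
  moreover have "restrict \<psi> (carrier F2) \<in> hom F2 F2"
    using iso_F2D(1)[OF assms] hom_mult[OF iso_F2D(1)[OF assms]] hom_reduced[OF iso_F2D(1)[OF assms]]
    by (auto simp: hom_def F2_mult)
  ultimately show ?thesis by (simp add: auto_F2_iff iso_def)
qed

lemma iso_auto:
  assumes "\<psi> \<in> iso F2 F2" "reduced u" "\<psi> u = v"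
  shows "\<exists>\<phi>\<in>auto F2. \<phi> u = v"
  using assms by (intro bexI[OF _ restrict_auto[OF assms(1)]]) simp

text \<open>An automorphism is only determined on the carrier, and the second clause speaks about positive
  letters only; taking inverses exchanges \<open>c a\<close> with \<open>a\<^sup>-\<^sup>1 c\<^sup>-\<^sup>1\<close>, so that \<open>c\<close> may be negative.\<close>

lemma whitehead_fixI:
  assumes "\<psi> \<in> iso F2 F2" "\<psi> [a] = [a]" "fst c \<noteq> fst a"
    "\<psi> [c] \<in> {[c], [c, a], [inv_letter a, c], [inv_letter a, c, a]}"
  shows "restrict \<psi> (carrier F2) \<in> whitehead_autos"
proof -
  have "\<psi> [(x, True)] \<in> {[(x, True)], [(x, True), a], [inv_letter a, (x, True)],
              [inv_letter a, (x, True), a]}" if x: "x \<noteq> fst a" for x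
  proof -
    have "x = fst c" using x assms(3) by (metis gen.exhaust)
    show ?thesis
    proof (cases "snd c")
      case True
      then have "c = (x, True)" using \<open>x = fst c\<close> by (cases c) auto
      then show ?thesis using assms(4) by simp
    next
      case False
      then have c: "(x, True) = inv_letter c" using \<open>x = fst c\<close> by (cases c) auto
      have "\<psi> [inv_letter c] = winv (\<psi> [c])"
        using hom_winv[OF iso_F2D(1)[OF assms(1)], of "[c]"] by simp
      then show ?thesis unfolding c using assms(4) by auto
    qed
  qed
  then show ?thesis using restrict_auto[OF assms(1)] assms(2)
    unfolding whitehead_autos_def mem_Collect_eq
    by (intro conjI disjI2 exI[of _ a] allI impI) (simp_all only: restrict_apply F2_carrier reduced_single if_True)
qed

lemma whitehead_map: assumes "signed_perm \<pi>" shows "restrict (map \<pi>) (carrier F2) \<in> whitehead_autos"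
proof -
  have "restrict (map \<pi>) (carrier F2) ` {[a] | a. True} = {[a] | a. True}"
  proof (intro equalityI subsetI)
    fix w assume "w \<in> {[a] | a :: letter. True}"
    then obtain a where a: "w = [a]" by blast
    have "\<pi> (inv_into UNIV \<pi> a) = a"
      using signed_perm_bij[OF assms] by (simp add: bij_is_surj surj_f_inv_f)
    then have "w = restrict (map \<pi>) (carrier F2) [inv_into UNIV \<pi> a]" using a by simp
    then show "w \<in> restrict (map \<pi>) (carrier F2) ` {[a] | a. True}" by blast
  qed auto
  then show ?thesis using restrict_auto[OF map_iso[OF assms]] unfolding whitehead_autos_def by blast
qed

lemma other_gen: "\<exists>c :: letter. fst c \<noteq> g"
proof (cases g)
  case X1
  then show ?thesis by (intro exI[of _ py]) simp
next
  case X2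
  then show ?thesis by (intro exI[of _ px]) simp
qed

lemma whitehead_inner: "restrict (\<lambda>w. free_reduce (winv [a] @ w @ [a])) (carrier F2) \<in> whitehead_autos"
proof -
  obtain c :: letter where c: "fst c \<noteq> fst a" using other_gen by blast
  then have "c \<noteq> a" "c \<noteq> inv_letter a" by auto
  then show ?thesis
    by (intro whitehead_fixI[OF inner_iso _ c]) (auto simp: free_reduce_Cons inv_letter_swap)
qed

text \<open>The transvection \<open>x \<mapsto> y x\<close>, \<open>y \<mapsto> y\<close> from the left.\<close>

definition tvl :: "word \<Rightarrow> word" where
  "tvl w = map inv_letter (tv (map inv_letter w))"

lemma tvl_iso: "tvl \<in> iso F2 F2"
  unfolding tvl_def
  using iso_comp[OF iso_comp[OF map_iso[OF signed_perm_inv_letter] tv_iso] map_iso[OF signed_perm_inv_letter]] .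

lemma conjF_tvl: "conjF (tvl w) (tv w)"
  using conjF_map[OF signed_perm_inv_letter tv_inv_letter[of w]] by (simp add: tvl_def o_def)

lemma reduced_tvl [simp]: "reduced (tvl w)"
  by (simp add: tvl_def signed_perm_inv_letter)

lemma whitehead_tv:
  assumes "signed_perm \<pi>" "\<psi> \<in> iso F2 F2" "\<psi> [py] = [py]" "\<psi> [px] \<in> {[px, py], [py, px]}"
  shows "restrict (\<lambda>w. map (inv_into UNIV \<pi>) (\<psi> (map \<pi> w))) (carrier F2) \<in> whitehead_autos"
proof -
  let ?\<sigma> = "inv_into UNIV \<pi>"
  note \<sigma> = signed_perm_the_inv[OF assms(1)]
  have \<pi>: "\<pi> (?\<sigma> a) = a" for a
    using signed_perm_bij[OF assms(1)] by (simp add: bij_is_surj surj_f_inv_f)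
  have iso: "(\<lambda>w. map ?\<sigma> (\<psi> (map \<pi> w))) \<in> iso F2 F2"
    using iso_comp[OF iso_comp[OF map_iso[OF assms(1)] assms(2)] map_iso[OF \<sigma>]] .
  have ne: "fst (?\<sigma> px) \<noteq> fst (?\<sigma> py)" by (rule signed_perm_fst[OF \<sigma>])
  have py: "?\<sigma> py = inv_letter (?\<sigma> ny)" using signed_perm_inv[OF \<sigma>, of ny] by simp
  show ?thesis
  proof (cases "\<psi> [px] = [px, py]")
    case True
    show ?thesis
      by (rule whitehead_fixI[OF iso, of "?\<sigma> py" "?\<sigma> px"]) (use True assms(3) \<pi> ne in auto)
  next
    case False
    then have px: "\<psi> [px] = [py, px]" using assms(4) by simp
    have "\<psi> [ny] = [ny]" using hom_winv[OF iso_F2D(1)[OF assms(2)], of "[py]"] assms(3) by simp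
    then show ?thesis
      by (intro whitehead_fixI[OF iso, of "?\<sigma> ny" "?\<sigma> px"])
        (use px \<pi> ne py in auto)
  qed
qed

lemma tv_letters: "tv [py] = [py]" "tv [px] = [px, py]"
  by (simp_all add: tv_eq_tr)

lemma tvl_letters: "tvl [py] = [py]" "tvl [px] = [py, px]"
  by (simp_all add: tvl_def tv_eq_tr)

lemma adj_count_map: "signed_perm \<pi> \<Longrightarrow> adj_count (map \<pi> w) (\<pi> a) (\<pi> b) = adj_count w a b"
proof -
  assume "signed_perm \<pi>"
  then have "inj (map_prod \<pi> \<pi>)" by (auto simp: signed_perm_def prod.inj_map)
  from count_list_map_inj[OF this, of "zip w (tl w)" "(a, b)"]
  show ?thesis by (simp add: zip_map_map map_prod_def map_tl[symmetric] case_prod_beta)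
qed

text \<open>The lengths of the conjugate words \<open>tv c\<close> and \<open>tvl c\<close> are determined by the digrams \<open>x y\<^sup>-\<^sup>1\<close>, \<open>y x\<^sup>-\<^sup>1\<close>
  and \<open>y\<^sup>-\<^sup>1 x\<close>, \<open>x\<^sup>-\<^sup>1 y\<close> of the linear word, respectively. In the cyclic word both kinds are equally
  frequent, and the digram that joins its end to its beginning can be missed for one kind only.\<close>

lemma length_tv_or_tvl:
  assumes "cyc_reduced c"
  shows "length (tv c) = clen (tv c) \<or> length (tvl c) = clen (tv c)"
proof (cases "c = []")
  case True
  then show ?thesis using clen_cyc_reduced[OF assms] by simp
next
  case False
  have r: "reduced c" using assms by (simp add: cyc_reduced_def)
  have len: "clen (tv c) + 2 * (cyc_count c px ny + cyc_count c py nx) = length c + num_x c"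
    using clen_tv[of c] assms by (simp add: kc_cyc_reduced kx_cyc_reduced clen_cyc_reduced)
  have "cyc_count c px ny + cyc_count c py nx = cyc_count c ny px + cyc_count c nx py"
    using kc_balance(5-8)[of c] assms unfolding kc_cyc_reduced[OF assms] by linarith
  then have len': "clen (tv c) + 2 * (cyc_count c ny px + cyc_count c nx py) = length c + num_x c"
    using len by simp
  have 1: "length (tv c) + 2 * (adj_count c px ny + adj_count c py nx) = length c + num_x c"
    using length_tr[of c] tv_eq_tr[OF r] by simp
  have "num_x (map inv_letter c) = num_x c"
    using count_list_map_inj[of inv_letter c px] count_list_map_inj[of inv_letter c nx] signed_perm_inv_letter
    by (simp add: num_x_def signed_perm_def)
  then have 2: "length (tvl c) + 2 * (adj_count c nx py + adj_count c ny px) = length c + num_x c"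
    using length_tr[of "map inv_letter c"] tv_eq_tr[of "map inv_letter c"] r
      adj_count_map[OF signed_perm_inv_letter, of c nx py] adj_count_map[OF signed_perm_inv_letter, of c ny px]
    by (simp add: tvl_def signed_perm_inv_letter)
  show ?thesis
  proof (cases "(last c, hd c) \<in> {(px, ny), (py, nx)}")
    case True
    then have "cyc_count c ny px = adj_count c ny px" "cyc_count c nx py = adj_count c nx py"
      using False by (auto simp: cyc_count_adj)
    then have "length (tvl c) = clen (tv c)" using len' 2 by simp
    then show ?thesis ..
  next
    case wrap: False
    then have "cyc_count c px ny = adj_count c px ny" "cyc_count c py nx = adj_count c py nx"
      using False by (auto simp: cyc_count_adj)
    then have "length (tv c) = clen (tv c)" using len 1 by simp
    then show ?thesis ..
  qed
qed

text \<open>The words at which the first part of the algorithm stops.\<close>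

definition terminal :: "word \<Rightarrow> bool" where
  "terminal u \<longleftrightarrow> reduced u \<and> (\<forall>\<phi>\<in>whitehead_autos. length u \<le> length (\<phi> u))"

lemma terminal_cyc_reduced:
  assumes "terminal u"
  shows "cyc_reduced u"
proof (rule ccontr)
  assume "\<not> ?thesis"
  then have ne: "u \<noteq> []" and h: "hd u = inv_letter (last u)" and r: "reduced u"
    using assms by (auto simp: cyc_reduced_def terminal_def)
  obtain v a where v: "u = v @ [a]" using ne by (cases u rule: rev_cases) auto
  with h obtain m where u: "u = inv_letter a # m @ [a]" by (cases v) auto
  have "free_reduce (winv [inv_letter a] @ u @ [inv_letter a]) = free_reduce m"
    using eqF_append[OF refl eqF_cancel_letter(2)[of a "[]"], of m] by (simp add: u)
  then have "length (free_reduce (winv [inv_letter a] @ u @ [inv_letter a])) < length u"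
    using length_free_reduce[of m] by (simp add: u)
  moreover have "length u \<le> length (restrict (\<lambda>w. free_reduce (winv [inv_letter a] @ w @ [inv_letter a])) (carrier F2) u)"
    using assms whitehead_inner[of "inv_letter a"] unfolding terminal_def by blast
  ultimately show False using r by simp
qed

lemma terminal_loc_min:
  assumes "terminal u"
  shows "loc_min u"
  unfolding loc_min_def
proof (intro allI impI)
  fix \<pi> assume \<pi>: "signed_perm \<pi>"
  note c = terminal_cyc_reduced[OF assms]
  have r: "reduced u" using assms by (simp add: terminal_def)
  have le: "length u \<le> length (\<psi> (map \<pi> u))"
    if "\<psi> \<in> iso F2 F2" "\<psi> [py] = [py]" "\<psi> [px] \<in> {[px, py], [py, px]}" for \<psi>
  proof -
    have "length u \<le> length (restrict (\<lambda>w. map (inv_into UNIV \<pi>) (\<psi> (map \<pi> w))) (carrier F2) u)"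
      using assms whitehead_tv[OF \<pi> that] unfolding terminal_def by blast
    then show ?thesis using r by simp
  qed
  have "cyc_reduced (map \<pi> u)" using c cyc_reduced_map[OF \<pi>] by blast
  from length_tv_or_tvl[OF this]
  have "length u \<le> clen (tv (map \<pi> u))"
    using le[OF tv_iso] le[OF tvl_iso] tv_letters tvl_letters by auto
  then show "clen u \<le> clen (tv (map \<pi> u))" using clen_cyc_reduced[OF c] by simp
qed

section \<open>Level paths of elementary automorphisms\<close>

text \<open>The steps of the second part of the algorithm.\<close>

definition lev :: "word \<Rightarrow> word \<Rightarrow> bool" where
  "lev u v \<longleftrightarrow> (\<exists>\<phi>\<in>whitehead_autos. v = \<phi> u \<and> length v = length u)"

lemma levI:
  "restrict \<psi> (carrier F2) \<in> whitehead_autos \<Longrightarrow> reduced u \<Longrightarrow> length (\<psi> u) = length u \<Longrightarrow> lev u (\<psi> u)"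
  unfolding lev_def by (intro bexI[of _ "restrict \<psi> (carrier F2)"]) auto

lemma lev_map: "signed_perm \<pi> \<Longrightarrow> reduced u \<Longrightarrow> lev u (map \<pi> u)"
  by (rule levI[OF whitehead_map]) auto

lemma lev_rotate: "cyc_reduced c \<Longrightarrow> lev\<^sup>*\<^sup>* c (rotate n c)"
proof (induction n)
  case (Suc n)
  let ?d = "rotate n c"
  have d: "cyc_reduced ?d" using Suc.prems by (rule cyc_reduced_rotate)
  have "lev\<^sup>*\<^sup>* ?d (rotate1 ?d)"
  proof (cases ?d)
    case (Cons a w)
    have "free_reduce (winv [a] @ ?d @ [a]) = free_reduce (rotate1 ?d)" using Cons by simp
    also have "\<dots> = rotate1 ?d" using cyc_reduced_rotate1[OF d] by (simp add: cyc_reduced_def)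
    finally have "lev ?d (rotate1 ?d)"
      using levI[OF whitehead_inner[of a], of ?d] d by (simp add: cyc_reduced_def)
    then show ?thesis by blast
  qed simp
  then show ?case using Suc by (simp add: rtranclp_trans)
qed simp

text \<open>A path of cyclic words of constant length is followed by elementary automorphisms: between
  any two steps the word is rotated, and \<open>tv\<close> or \<open>tvl\<close> yields a cyclically reduced word.\<close>

lemma level_lev:
  assumes "cyc_reduced u"
  shows "level u v \<Longrightarrow> cyc_reduced w \<Longrightarrow> conjF v w \<Longrightarrow> lev\<^sup>*\<^sup>* u w"
proof (induction v arbitrary: w rule: level.induct)
  case level_refl
  then show ?case using conjF_cyc_reduced_rotate[OF assms] lev_rotate[OF assms] by blast
next
  case (level_map v \<pi>)
  let ?\<sigma> = "inv_into UNIV \<pi>"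
  note \<sigma> = signed_perm_the_inv[OF level_map.hyps(2)]
  have "conjF (map ?\<sigma> (map \<pi> v)) (map ?\<sigma> w)" by (rule conjF_map[OF \<sigma> level_map.prems(2)])
  then have "lev\<^sup>*\<^sup>* u (map ?\<sigma> w)"
    using level_map.IH[of "map ?\<sigma> w"] level_map.prems(1) cyc_reduced_map[OF \<sigma>]
    unfolding map_inv_signed_perm[OF level_map.hyps(2)] by blast
  moreover have "lev (map ?\<sigma> w) (map \<pi> (map ?\<sigma> w))"
    using level_map.prems(1) \<sigma> by (intro lev_map[OF level_map.hyps(2)]) (simp add: cyc_reduced_def)
  ultimately show ?case unfolding map_inv_signed_perm[OF level_map.hyps(2)] by simp
next
  case (level_conj v v')
  then show ?case using conjF_trans by blast
next
  case (level_tv v)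
  let ?c = "core v"
  have "lev\<^sup>*\<^sup>* u ?c" using level_tv.IH core by blast
  have r: "reduced ?c" using core(1)[of v] by (simp add: cyc_reduced_def)
  have tvc: "conjF (tv ?c) (tv v)" by (intro conjF_tv conjF_sym[OF core(2)])
  have len: "clen (tv ?c) = length ?c" using clen_conjF[OF tvc] level_tv.hyps(2) by simp
  have "\<exists>t. lev ?c t \<and> reduced t \<and> length t = clen (tv ?c) \<and> conjF t (tv ?c)"
    using length_tv_or_tvl[OF core(1)[of v]]
  proof
    assume l: "length (tv ?c) = clen (tv ?c)"
    have "restrict tv (carrier F2) \<in> whitehead_autos"
      using whitehead_tv[OF signed_perm_id tv_iso] tv_letters by (simp add: id_def)
    then have "lev ?c (tv ?c)" using levI r l len by simp
    then show ?thesis using l by (intro exI[of _ "tv ?c"]) simp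
  next
    assume l: "length (tvl ?c) = clen (tv ?c)"
    have "restrict tvl (carrier F2) \<in> whitehead_autos"
      using whitehead_tv[OF signed_perm_id tvl_iso] tvl_letters by (simp add: id_def)
    then have "lev ?c (tvl ?c)" using levI r l len by simp
    then show ?thesis using l conjF_tvl by (intro exI[of _ "tvl ?c"]) simp
  qed
  then obtain t where t: "lev ?c t" "reduced t" "length t = clen (tv ?c)" "conjF t (tv ?c)" by blast
  then have ct: "cyc_reduced t" using cyc_reduced_iff_clen clen_conjF[OF t(4)] by simp
  have "conjF t w" using conjF_trans[OF t(4) conjF_trans[OF tvc level_tv.prems(2)]] .
  then obtain n where "w = rotate n t" using conjF_cyc_reduced_rotate[OF ct level_tv.prems(1)] by blast
  then have "lev\<^sup>*\<^sup>* t w" using lev_rotate[OF ct] by blast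
  then show ?case using \<open>lev\<^sup>*\<^sup>* u ?c\<close> t(1) by (meson rtranclp.rtrancl_into_rtrancl rtranclp_trans)
qed

lemma iso_id: "(\<lambda>w. w) \<in> iso F2 F2"
  using map_iso[OF signed_perm_id] by (simp add: id_def)

lemma lev_iso:
  "lev\<^sup>*\<^sup>* u w \<Longrightarrow> length w = length u \<and> (\<exists>\<phi>\<in>iso F2 F2. \<phi> u = w)"
proof (induction rule: rtranclp_induct)
  case base
  show ?case using iso_id by auto
next
  case (step v w)
  then obtain \<phi> \<psi> where "\<phi> \<in> iso F2 F2" "\<phi> u = v" "\<psi> \<in> whitehead_autos" "w = \<psi> v" "length w = length v"
    unfolding lev_def by blast
  then show ?case using iso_comp[of \<phi> \<psi>] whitehead_iso step by (intro conjI bexI[of _ "\<lambda>w. \<psi> (\<phi> w)"]) auto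
qed

text \<open>The first two of the following theorems justify the two parts of the algorithm; the third one
  bounds the size of the search tree.\<close>

theorem terminal_minimal:
  assumes "terminal u" "\<phi> \<in> iso F2 F2"
  shows "length u \<le> length (\<phi> u)"
proof -
  have r: "reduced u" using assms by (simp add: terminal_def)
  have "length u \<le> clen (\<phi> u)"
    using clen_loc_min(1)[OF terminal_loc_min[OF assms(1)] r assms(2)]
      clen_cyc_reduced[OF terminal_cyc_reduced[OF assms(1)]] by simp
  then show ?thesis using clen_le_length[OF hom_reduced[OF iso_F2D(1)[OF assms(2)] r]] by simp
qed

lemma terminal_level:
  assumes "terminal u" "\<phi> \<in> iso F2 F2" "length (\<phi> u) = length u"
  shows "cyc_reduced (\<phi> u) \<and> level u (\<phi> u)"
proof -
  have r: "reduced u" using assms by (simp add: terminal_def)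
  note loc = terminal_loc_min[OF assms(1)] and cu = clen_cyc_reduced[OF terminal_cyc_reduced[OF assms(1)]]
  have r': "reduced (\<phi> u)" by (rule hom_reduced[OF iso_F2D(1)[OF assms(2)] r])
  have "clen (\<phi> u) = clen u"
    using clen_loc_min(1)[OF loc r assms(2)] clen_le_length[OF r'] assms(3) cu by simp
  then show ?thesis using clen_loc_min(2)[OF loc r assms(2)] cyc_reduced_iff_clen[OF r'] cu assms(3) by simp
qed

theorem terminal_connected:
  assumes "terminal u" "\<phi> \<in> iso F2 F2" "length (\<phi> u) = length u"
  shows "lev\<^sup>*\<^sup>* u (\<phi> u)"
  using level_lev[OF terminal_cyc_reduced[OF assms(1)]] terminal_level[OF assms] conjF_refl by blast

theorem card_lev:
  "\<exists>K. \<forall>u. terminal u \<longrightarrow> finite {w. lev\<^sup>*\<^sup>* u w} \<and> card {w. lev\<^sup>*\<^sup>* u w} \<le> K * (length u + 1) ^ 2"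
proof -
  obtain K where K: "\<And>u. loc_min u \<Longrightarrow> finite {w. cyc_reduced w \<and> level u w} \<and>
     card {w. cyc_reduced w \<and> level u w} \<le> K * (clen u + 1) ^ 2"
    using card_level by blast
  show ?thesis
  proof (intro exI allI impI)
    fix u assume u: "terminal u"
    let ?L = "{w. lev\<^sup>*\<^sup>* u w}" and ?M = "{w. cyc_reduced w \<and> level u w}"
    have sub: "?L \<subseteq> ?M"
    proof
      fix w assume "w \<in> ?L"
      then obtain \<phi> where "\<phi> \<in> iso F2 F2" "\<phi> u = w" "length w = length u" using lev_iso by blast
      then show "w \<in> ?M" using terminal_level[OF u, of \<phi>] by simp
    qed
    have M: "finite ?M" "card ?M \<le> K * (length u + 1) ^ 2"
      using K[OF terminal_loc_min[OF u]] clen_cyc_reduced[OF terminal_cyc_reduced[OF u]] by simp_all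
    show "finite ?L \<and> card ?L \<le> K * (length u + 1) ^ 2"
      using finite_subset[OF sub M(1)] le_trans[OF card_mono[OF M(1) sub] M(2)] by blast
  qed
qed

section \<open>Results and costs of the list functions\<close>

lemmas timed_defs = ret_def tick_def bindT_def

lemma fst_prepend_t: "fst (prepend_t u v) = foldr push u v"
  by (induction u) (simp_all add: timed_defs)

lemma snd_prepend_t: "snd (prepend_t u v) = 2 * length u + 1"
  by (induction u) (simp_all add: timed_defs)

lemma fst_apply_t_ext: "fst (apply_t \<phi> w) = ext (\<lambda>a. \<phi> [a]) w"
proof (induction w)
  case (Cons a w)
  have "foldr push (\<phi> [a]) (ext (\<lambda>a. \<phi> [a]) w) = free_reduce (\<phi> [a] @ ext (\<lambda>a. \<phi> [a]) w)"
    by (simp add: free_reduce_append)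
  then show ?case using Cons by (simp add: timed_defs fst_prepend_t ext_Cons)
qed (simp add: timed_defs)

lemma fst_apply_t: "\<phi> \<in> whitehead_autos \<Longrightarrow> reduced w \<Longrightarrow> fst (apply_t \<phi> w) = \<phi> w"
  using hom_eq_ext[OF iso_F2D(1)[OF whitehead_iso]] by (simp add: fst_apply_t_ext)

text \<open>Each letter has an image of length at most 3, whose prepending costs at most 7 units.\<close>

lemma snd_apply_t:
  assumes "\<phi> \<in> whitehead_autos"
  shows "snd (apply_t \<phi> w) \<le> 8 * length w + 1"
proof (induction w)
  case (Cons a w)
  then show ?case using length_whitehead_letter[OF assms, of a] by (simp add: timed_defs snd_prepend_t)
qed (simp add: timed_defs)

lemma fst_shorter_t: "fst (shorter_t u v) \<longleftrightarrow> length u < length v"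
  by (induction u v rule: shorter_t.induct) (simp_all add: timed_defs)

lemma snd_shorter_t: "snd (shorter_t u v) \<le> length v + 1"
  by (induction u v rule: shorter_t.induct) (simp_all add: timed_defs)

lemma fst_same_length_t: "fst (same_length_t u v) \<longleftrightarrow> length u = length v"
  by (induction u v rule: same_length_t.induct) (simp_all add: timed_defs)

lemma snd_same_length_t: "snd (same_length_t u v) \<le> length v + 1"
  by (induction u v rule: same_length_t.induct) (simp_all add: timed_defs)

lemma fst_equal_t: "fst (equal_t u v) \<longleftrightarrow> u = v"
  by (induction u v rule: equal_t.induct) (simp_all add: timed_defs)

lemma snd_equal_t: "snd (equal_t u v) \<le> length u + 1"
  by (induction u v rule: equal_t.induct) (simp_all add: timed_defs)

abbreviation nodes :: "tree \<Rightarrow> word set" where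
  "nodes T \<equiv> fst ` set T"

lemma fst_recorded_t: "fst (recorded_t w T) \<longleftrightarrow> w \<in> nodes T"
  by (induction T) (auto simp: timed_defs fst_equal_t)

lemma snd_recorded_t: "snd (recorded_t w T) \<le> length T * (length w + 2) + 1"
proof (induction T)
  case (Cons e T)
  then show ?case using snd_equal_t[of w "fst e"] by (simp add: timed_defs)
qed (simp add: timed_defs)

lemma fst_preceding_t: "fst (preceding_t w T) = (case map_of T w of None \<Rightarrow> None | Some p \<Rightarrow> p)"
  by (induction T) (auto simp: timed_defs fst_equal_t)

lemma snd_preceding_t: "snd (preceding_t w T) \<le> length T * (length w + 2) + 1"
proof (induction T)
  case (Cons e T)
  then show ?case using snd_equal_t[of w "fst e"] by (simp add: timed_defs)
qed (simp add: timed_defs)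

lemma find_shorter_t:
  assumes "set \<phi>s \<subseteq> whitehead_autos" "reduced w"
  shows "case fst (find_shorter_t \<phi>s w) of
      None \<Rightarrow> \<forall>\<phi>\<in>set \<phi>s. length w \<le> length (\<phi> w)
    | Some w' \<Rightarrow> \<exists>\<phi>\<in>set \<phi>s. w' = \<phi> w \<and> length w' < length w"
    and "snd (find_shorter_t \<phi>s w) \<le> length \<phi>s * (9 * length w + 3) + 1"
proof -
  have "(case fst (find_shorter_t \<phi>s w) of
      None \<Rightarrow> \<forall>\<phi>\<in>set \<phi>s. length w \<le> length (\<phi> w)
    | Some w' \<Rightarrow> \<exists>\<phi>\<in>set \<phi>s. w' = \<phi> w \<and> length w' < length w) \<and>
    snd (find_shorter_t \<phi>s w) \<le> length \<phi>s * (9 * length w + 3) + 1"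
    using assms(1)
  proof (induction \<phi>s)
    case (Cons \<phi> \<phi>s)
    then have \<phi>: "\<phi> \<in> whitehead_autos" by simp
    have f: "fst (apply_t \<phi> w) = \<phi> w" by (rule fst_apply_t[OF \<phi> assms(2)])
    have c: "snd (apply_t \<phi> w) \<le> 8 * length w + 1" "snd (shorter_t (\<phi> w) w) \<le> length w + 1"
      using snd_apply_t[OF \<phi>] snd_shorter_t by blast+
    show ?case
    proof (cases "length (\<phi> w) < length w")
      case True
      then show ?thesis using c by (simp add: timed_defs f fst_shorter_t)
    next
      case False
      have "fst (find_shorter_t (\<phi> # \<phi>s) w) = fst (find_shorter_t \<phi>s w)"
        "snd (find_shorter_t (\<phi> # \<phi>s) w) =
          Suc (snd (apply_t \<phi> w) + (snd (shorter_t (\<phi> w) w) + snd (find_shorter_t \<phi>s w)))"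
        using False by (simp_all add: timed_defs f fst_shorter_t)
      then show ?thesis using Cons c False by (auto split: option.splits)
    qed
  qed (simp add: timed_defs)
  then show "case fst (find_shorter_t \<phi>s w) of
      None \<Rightarrow> \<forall>\<phi>\<in>set \<phi>s. length w \<le> length (\<phi> w)
    | Some w' \<Rightarrow> \<exists>\<phi>\<in>set \<phi>s. w' = \<phi> w \<and> length w' < length w"
    "snd (find_shorter_t \<phi>s w) \<le> length \<phi>s * (9 * length w + 3) + 1" by blast+
qed

lemma find_new_t:
  assumes "set \<phi>s \<subseteq> whitehead_autos" "reduced w" "length w = length u"
  shows "case fst (find_new_t \<phi>s u T w) of
      None \<Rightarrow> \<forall>\<phi>\<in>set \<phi>s. length (\<phi> w) = length u \<longrightarrow> \<phi> w \<in> nodes T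
    | Some w' \<Rightarrow> \<exists>\<phi>\<in>set \<phi>s. w' = \<phi> w \<and> length w' = length u \<and> w' \<notin> nodes T"
    and "snd (find_new_t \<phi>s u T w) \<le> length \<phi>s * (9 * length u + length T * (length u + 2) + 4) + 1"
proof -
  let ?c = "9 * length u + length T * (length u + 2) + 4"
  have "(case fst (find_new_t \<phi>s u T w) of
      None \<Rightarrow> \<forall>\<phi>\<in>set \<phi>s. length (\<phi> w) = length u \<longrightarrow> \<phi> w \<in> nodes T
    | Some w' \<Rightarrow> \<exists>\<phi>\<in>set \<phi>s. w' = \<phi> w \<and> length w' = length u \<and> w' \<notin> nodes T) \<and>
    snd (find_new_t \<phi>s u T w) \<le> length \<phi>s * ?c + 1"
    using assms(1)
  proof (induction \<phi>s)
    case (Cons \<phi> \<phi>s)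
    then have \<phi>: "\<phi> \<in> whitehead_autos" by simp
    have f: "fst (apply_t \<phi> w) = \<phi> w" by (rule fst_apply_t[OF \<phi> assms(2)])
    have c: "snd (apply_t \<phi> w) \<le> 8 * length u + 1" "snd (same_length_t (\<phi> w) u) \<le> length u + 1"
      using snd_apply_t[OF \<phi>, of w] snd_same_length_t assms(3) by auto
    have r: "snd (recorded_t (\<phi> w) T) \<le> length T * (length u + 2) + 1" if "length (\<phi> w) = length u"
      using snd_recorded_t[of "\<phi> w" T] that by simp
    show ?case
    proof (cases "length (\<phi> w) = length u \<and> \<phi> w \<notin> nodes T")
      case True
      then have "fst (find_new_t (\<phi> # \<phi>s) u T w) = Some (\<phi> w)"
        "snd (find_new_t (\<phi> # \<phi>s) u T w) =
          Suc (snd (apply_t \<phi> w) + (snd (same_length_t (\<phi> w) u) + snd (recorded_t (\<phi> w) T)))"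
        by (simp_all add: timed_defs f fst_same_length_t fst_recorded_t)
      then show ?thesis using c r True by simp
    next
      case False
      then have "fst (find_new_t (\<phi> # \<phi>s) u T w) = fst (find_new_t \<phi>s u T w)"
        by (auto simp: timed_defs f fst_same_length_t fst_recorded_t)
      moreover have "snd (find_new_t (\<phi> # \<phi>s) u T w) \<le> ?c + snd (find_new_t \<phi>s u T w)"
        using False c r by (auto simp: timed_defs f fst_same_length_t fst_recorded_t)
      ultimately show ?thesis using Cons False by (auto split: option.splits)
    qed
  qed (simp add: timed_defs)
  then show "case fst (find_new_t \<phi>s u T w) of
      None \<Rightarrow> \<forall>\<phi>\<in>set \<phi>s. length (\<phi> w) = length u \<longrightarrow> \<phi> w \<in> nodes T
    | Some w' \<Rightarrow> \<exists>\<phi>\<in>set \<phi>s. w' = \<phi> w \<and> length w' = length u \<and> w' \<notin> nodes T"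
    "snd (find_new_t \<phi>s u T w) \<le> length \<phi>s * ?c + 1" by blast+
qed

section \<open>The search tree\<close>

inductive wf_tree :: "word \<Rightarrow> tree \<Rightarrow> bool" for a where
  wf_root: "wf_tree a [(a, None)]"
| wf_node: "wf_tree a T \<Longrightarrow> w \<notin> nodes T \<Longrightarrow> p \<in> nodes T \<Longrightarrow> lev p w \<Longrightarrow> wf_tree a ((w, Some p) # T)"

text \<open>The path from a node back to the root.\<close>

inductive branch :: "tree \<Rightarrow> word \<Rightarrow> word list \<Rightarrow> bool" for T where
  branch_root: "map_of T w = Some None \<Longrightarrow> branch T w [w]"
| branch_step: "map_of T w = Some (Some p) \<Longrightarrow> branch T p ws \<Longrightarrow> branch T w (w # ws)"

lemma wf_tree_root: "wf_tree a T \<Longrightarrow> a \<in> nodes T"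
  by (induction rule: wf_tree.induct) auto

lemma wf_tree_lev: "wf_tree a T \<Longrightarrow> w \<in> nodes T \<Longrightarrow> lev\<^sup>*\<^sup>* a w"
proof (induction arbitrary: w rule: wf_tree.induct)
  case (wf_node T w p v)
  then show ?case by (auto intro: rtranclp.rtrancl_into_rtrancl)
qed simp

lemma wf_tree_card: "wf_tree a T \<Longrightarrow> length T = card (nodes T)"
  by (induction rule: wf_tree.induct) (auto simp: card_insert_if)

lemma map_of_node: "map_of T w = Some q \<Longrightarrow> w \<in> nodes T"
  by (metis dom_map_of_conv_image_fst domI)

lemma branch_node: "branch T w ws \<Longrightarrow> w \<in> nodes T"
  by (erule branch.cases) (simp_all only: map_of_node)

lemma branch_extend: "branch T w ws \<Longrightarrow> w' \<notin> nodes T \<Longrightarrow> branch ((w', p) # T) w ws"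
proof (induction rule: branch.induct)
  case (branch_root w)
  then have "w \<noteq> w'" using map_of_node by blast
  then show ?case using branch_root by (intro branch.branch_root) simp
next
  case (branch_step w q ws)
  then have "w \<noteq> w'" using map_of_node by blast
  then have "map_of ((w', p) # T) w = Some (Some q)" using branch_step.hyps(1) by simp
  then show ?case by (rule branch.branch_step) (rule branch_step.IH[OF branch_step.prems])
qed

section \<open>The invariant and the running time\<close>

abbreviation same_orbit :: "word \<Rightarrow> word \<Rightarrow> bool" where
  "same_orbit u v \<equiv> \<exists>\<phi>\<in>iso F2 F2. \<phi> u = v"

lemma same_orbit_refl: "same_orbit u u"
  by (rule bexI[OF _ iso_id]) simp

lemma same_orbit_trans: "same_orbit u v \<Longrightarrow> same_orbit v w \<Longrightarrow> same_orbit u w"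
proof -
  assume "same_orbit u v" "same_orbit v w"
  then obtain \<phi> \<psi> where "\<phi> \<in> iso F2 F2" "\<phi> u = v" "\<psi> \<in> iso F2 F2" "\<psi> v = w" by blast
  then show ?thesis by (intro bexI[OF _ iso_comp[of \<phi> \<psi>]]) simp_all
qed

lemma same_orbit_sym: assumes "reduced u" "same_orbit u v" shows "same_orbit v u"
proof -
  obtain \<phi> where \<phi>: "\<phi> \<in> iso F2 F2" "\<phi> u = v" using assms by blast
  have "inv_into (carrier F2) \<phi> \<in> iso F2 F2" using group.iso_set_sym[OF group_F2 \<phi>(1)] .
  moreover have "inv_into (carrier F2) \<phi> v = u"
    using \<phi> assms(1) by (auto simp: iso_def bij_betw_def intro!: inv_into_f_eq)
  ultimately show ?thesis by blast
qed

definition explored :: "tree \<Rightarrow> word \<Rightarrow> bool" where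
  "explored T w \<longleftrightarrow> (\<forall>w'. lev w w' \<longrightarrow> w' \<in> nodes T)"

text \<open>\<open>search_inv u v N s m\<close> holds in the states \<open>s\<close> that occur on the input \<open>u\<close>, \<open>v\<close>, where \<open>m\<close> bounds the
  number of remaining transitions if search trees have at most \<open>N\<close> nodes. During the search, \<open>ws\<close> is
  the branch of the current word, and only words on it may have unrecorded neighbours. An extension
  uses up one of the \<open>N\<close> nodes, which counts twice, and lengthens the branch by one; backtracking
  shortens the branch by one. In the state \<open>Check\<close> the root \<open>a\<close> is no longer part of the state.\<close>

fun search_inv :: "word \<Rightarrow> word \<Rightarrow> nat \<Rightarrow> state \<Rightarrow> nat \<Rightarrow> bool" where
  "search_inv u v N (MinimizeU a b) m \<longleftrightarrow>
     reduced a \<and> same_orbit u a \<and> length a \<le> length u \<and> b = v \<and>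
     length a + length v + 2 * N + 4 \<le> m"
| "search_inv u v N (MinimizeV a b) m \<longleftrightarrow>
     terminal a \<and> same_orbit u a \<and> length a \<le> length u \<and>
     reduced b \<and> same_orbit v b \<and> length b \<le> length v \<and> length b + 2 * N + 3 \<le> m"
| "search_inv u v N (Compare a b) m \<longleftrightarrow>
     terminal a \<and> same_orbit u a \<and> length a \<le> length u \<and>
     terminal b \<and> same_orbit v b \<and> length b \<le> length v \<and> 2 * N + 2 \<le> m"
| "search_inv u v N (Search a b T w) m \<longleftrightarrow>
     terminal a \<and> same_orbit u a \<and> length a \<le> length u \<and>
     terminal b \<and> same_orbit v b \<and> length b = length a \<and>
     wf_tree a T \<and> (\<exists>ws. branch T w ws \<and> (\<forall>t\<in>nodes T - set ws. explored T t) \<and>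
       2 * (N - length T) + length ws + 1 \<le> m)"
| "search_inv u v N (Check b T) m \<longleftrightarrow>
     (\<exists>a. terminal a \<and> same_orbit u a \<and> length a \<le> length u \<and>
       terminal b \<and> same_orbit v b \<and> length b = length a \<and> wf_tree a T \<and>
       nodes T = {w. lev\<^sup>*\<^sup>* a w} \<and> 1 \<le> m)"
| "search_inv u v N (Answer b) m \<longleftrightarrow> (b \<longleftrightarrow> same_orbit u v)"

lemma ex_enumeration: "\<exists>\<phi>s. enumeration \<phi>s"
  using finite_distinct_list[OF finite_whitehead_autos] by (auto simp: enumeration_def)

lemma step_exists: "(\<exists>b. s = Answer b) \<or> (\<exists>c s'. step s c s')"
proof -
  obtain \<phi>s where e: "enumeration \<phi>s" using ex_enumeration by blast
  show ?thesis
  proof (cases s)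
    case (MinimizeU u v)
    obtain r c where "find_shorter_t \<phi>s u = (r, c)" by fastforce
    then show ?thesis using e minU minU_done MinimizeU by (cases r) blast+
  next
    case (MinimizeV u v)
    obtain r c where "find_shorter_t \<phi>s v = (r, c)" by fastforce
    then show ?thesis using e minV minV_done MinimizeV by (cases r) blast+
  next
    case (Compare u v)
    obtain r c where "same_length_t u v = (r, c)" by fastforce
    then have "step s c (if r then Search u v [(u, None)] u else Answer False)"
      using compare_no compare_eq Compare by (cases r) auto
    then show ?thesis by blast
  next
    case (Search u v T w)
    obtain r c where r: "find_new_t \<phi>s u T w = (r, c)" by fastforce
    obtain q d where q: "preceding_t w T = (q, d)" by fastforce
    show ?thesis
    proof (cases r)
      case None
      then show ?thesis using e r q backtrack search_done Search by (cases q) blast+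
    next
      case (Some w')
      then show ?thesis using e r extend Search by blast
    qed
  next
    case (Check v T)
    obtain r c where "recorded_t v T = (r, c)" by fastforce
    then show ?thesis using check Check by blast
  qed blast
qed

lemma lev_reduced: "lev\<^sup>*\<^sup>* a w \<Longrightarrow> reduced a \<Longrightarrow> reduced w"
  using lev_iso hom_reduced[OF iso_F2D(1)] by blast

lemma enumeration_length: "enumeration \<phi>s \<Longrightarrow> length \<phi>s = card whitehead_autos"
  by (metis distinct_card enumeration_def)

text \<open>A bound for the cost of one transition when words have length at most \<open>n\<close> and trees at most \<open>N\<close>
  nodes. The main part is the cost of a backtracking step: each automorphism is applied, the length
  of the image is compared, and the image is looked up in the tree; then the preceding word is
  looked up.\<close>

definition step_cost :: "nat \<Rightarrow> nat \<Rightarrow> nat" where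
  "step_cost n N = card whitehead_autos * (9 * n + N * (n + 2) + 4) + N * (n + 2) + n + 2"

lemma step_search_inv:
  assumes "step s c s'" "search_inv u v N s m"
    and N: "\<And>a T. terminal a \<Longrightarrow> length a \<le> length u \<Longrightarrow> wf_tree a T \<Longrightarrow> length T \<le> N"
    and u: "reduced u" and v: "reduced v"
  shows "c \<le> step_cost (max (length u) (length v)) N \<and> (\<exists>m'<m. search_inv u v N s' m')"
proof -
  let ?n = "max (length u) (length v)"
  let ?W = "card whitehead_autos"
  have shorter: "c \<le> step_cost ?n N \<and> (case r of
      None \<Rightarrow> terminal w
    | Some w' \<Rightarrow> reduced w' \<and> same_orbit w w' \<and> length w' < length w)"
    if e: "enumeration \<phi>s" and f: "find_shorter_t \<phi>s w = (r, c)" and w: "reduced w" "length w \<le> ?n" for \<phi>s w r c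
  proof -
    have set: "set \<phi>s = whitehead_autos" using e by (simp add: enumeration_def)
    have "c \<le> ?W * (9 * length w + 3) + 1"
      using find_shorter_t(2)[of \<phi>s w] w f set enumeration_length[OF e] by simp
    also have "\<dots> \<le> ?W * (9 * ?n + N * (?n + 2) + 4) + 1"
      using w(2) by (intro add_mono mult_mono) auto
    also have "\<dots> \<le> step_cost ?n N" by (simp add: step_cost_def)
    finally have c: "c \<le> step_cost ?n N" .
    have res: "case r of None \<Rightarrow> \<forall>\<phi>\<in>whitehead_autos. length w \<le> length (\<phi> w)
      | Some w' \<Rightarrow> \<exists>\<phi>\<in>whitehead_autos. w' = \<phi> w \<and> length w' < length w"
      using find_shorter_t(1)[of \<phi>s w, unfolded set f fst_conv] w by blast
    show ?thesis
    proof (cases r)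
      case None
      then show ?thesis using res w c by (simp add: terminal_def)
    next
      case (Some w')
      then obtain \<phi> where "\<phi> \<in> whitehead_autos" "w' = \<phi> w" "length w' < length w" using res by auto
      then show ?thesis using Some c whitehead_iso hom_reduced[OF iso_F2D(1)] w(1) by auto
    qed
  qed
  have new: "c \<le> ?W * (9 * ?n + N * (?n + 2) + 4) + 1 \<and> (case r of
      None \<Rightarrow> explored T w
    | Some w' \<Rightarrow> lev w w' \<and> w' \<notin> nodes T)"
    if e: "enumeration \<phi>s" and f: "find_new_t \<phi>s a T w = (r, c)" and w: "reduced w" "length w = length a"
      and a: "length a \<le> ?n" and T: "length T \<le> N" for \<phi>s a T w r c
  proof -
    have set: "set \<phi>s = whitehead_autos" using e by (simp add: enumeration_def)
    have "c \<le> ?W * (9 * length a + length T * (length a + 2) + 4) + 1"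
      using find_new_t(2)[of \<phi>s w a T] w f set enumeration_length[OF e] by simp
    also have "\<dots> \<le> ?W * (9 * ?n + N * (?n + 2) + 4) + 1"
      using a T by (intro add_mono mult_mono order_refl) auto
    finally have c: "c \<le> ?W * (9 * ?n + N * (?n + 2) + 4) + 1" .
    have res: "case r of
      None \<Rightarrow> \<forall>\<phi>\<in>whitehead_autos. length (\<phi> w) = length a \<longrightarrow> \<phi> w \<in> nodes T
    | Some w' \<Rightarrow> \<exists>\<phi>\<in>whitehead_autos. w' = \<phi> w \<and> length w' = length a \<and> w' \<notin> nodes T"
      using find_new_t(1)[of \<phi>s w a T, unfolded set f fst_conv] w by blast
    show ?thesis
    proof (cases r)
      case None
      then show ?thesis using res w c by (auto simp: explored_def lev_def)
    next
      case (Some w')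
      then show ?thesis using res w c by (auto simp: lev_def)
    qed
  qed
  have orbit_uv: "same_orbit u v \<longleftrightarrow> same_orbit a b"
    if "same_orbit u a" "same_orbit v b" for a b
  proof
    assume "same_orbit u v"
    show "same_orbit a b"
      by (rule same_orbit_trans[OF same_orbit_trans[OF same_orbit_sym[OF u that(1)] \<open>same_orbit u v\<close>] that(2)])
  next
    assume "same_orbit a b"
    show "same_orbit u v"
      by (rule same_orbit_trans[OF same_orbit_trans[OF that(1) \<open>same_orbit a b\<close>] same_orbit_sym[OF v that(2)]])
  qed
  have node: "reduced w \<and> length w = length a" if "terminal a" "wf_tree a T" "w \<in> nodes T" for a T w
    using wf_tree_lev[OF that(2,3)] lev_iso[of a w] lev_reduced[of a w] that(1) by (auto simp: terminal_def)
  have preceding: "d \<le> N * (?n + 2) + 1"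
    if "preceding_t w T = (q, d)" "length w \<le> ?n" "length T \<le> N" for w T q d
  proof -
    have "d \<le> length T * (length w + 2) + 1" using snd_preceding_t[of w T] that(1) by simp
    also have "\<dots> \<le> N * (?n + 2) + 1" using that(2,3) by (intro add_mono mult_mono) auto
    finally show ?thesis .
  qed
  show ?thesis
    using assms(1)
  proof cases
    case (minU \<phi>s a a' b)
    then have *: "reduced a" "same_orbit u a" "length a \<le> length u" "b = v"
      "length a + length v + 2 * N + 4 \<le> m" using assms(2) by auto
    from shorter[OF minU(3,4) *(1)] * have 1: "c \<le> step_cost ?n N" "reduced a'" "same_orbit a a'" "length a' < length a"
      by auto
    then have "search_inv u v N (MinimizeU a' b) (length a' + length v + 2 * N + 4)"
      using * same_orbit_trans[OF *(2) 1(3)] by simp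
    moreover have "length a' + length v + 2 * N + 4 < m" using * 1 by simp
    ultimately show ?thesis using 1 minU(2) by blast
  next
    case (minU_done \<phi>s a b)
    then have *: "reduced a" "same_orbit u a" "length a \<le> length u" "b = v"
      "length a + length v + 2 * N + 4 \<le> m" using assms(2) by auto
    from shorter[OF minU_done(3,4) *(1)] * have 1: "c \<le> step_cost ?n N" "terminal a" by auto
    note same_orbit_refl[of v]
    then have "search_inv u v N (MinimizeV a b) (length b + 2 * N + 3)" using * 1 v by simp
    moreover have "length b + 2 * N + 3 < m" using * by simp
    ultimately show ?thesis using 1 minU_done(2) by blast
  next
    case (minV \<phi>s b b' a)
    then have *: "terminal a" "same_orbit u a" "length a \<le> length u"
     "reduced b" "same_orbit v b" "length b \<le> length v" "length b + 2 * N + 3 \<le> m" using assms(2) by auto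
    from shorter[OF minV(3,4) *(4)] * have 1: "c \<le> step_cost ?n N" "reduced b'" "same_orbit b b'" "length b' < length b"
      by auto
    then have "search_inv u v N (MinimizeV a b') (length b' + 2 * N + 3)"
      using * same_orbit_trans[OF *(5) 1(3)] by simp
    moreover have "length b' + 2 * N + 3 < m" using * 1 by simp
    ultimately show ?thesis using 1 minV(2) by blast
  next
    case (minV_done \<phi>s b a)
    then have *: "terminal a" "same_orbit u a" "length a \<le> length u"
     "reduced b" "same_orbit v b" "length b \<le> length v" "length b + 2 * N + 3 \<le> m" using assms(2) by auto
    from shorter[OF minV_done(3,4) *(4)] * have 1: "c \<le> step_cost ?n N" "terminal b" by auto
    then have "search_inv u v N (Compare a b) (2 * N + 2)" using * by simp
    moreover have "2 * N + 2 < m" using * by simp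
    ultimately show ?thesis using 1 minV_done(2) by blast
  next
    case (compare_no a b)
    then have *: "terminal a" "same_orbit u a" "length a \<le> length u"
     "terminal b" "same_orbit v b" "length b \<le> length v" "2 * N + 2 \<le> m" using assms(2) by auto
    have len: "length a \<noteq> length b" using fst_same_length_t[of a b] compare_no(3) by simp
    have r: "reduced a" "reduced b" using * by (auto simp: terminal_def)
    have "\<not> same_orbit a b"
    proof
      assume ab: "same_orbit a b"
      then have "same_orbit b a" by (rule same_orbit_sym[OF r(1)])
      then have "length b \<le> length a" using terminal_minimal[OF *(4)] by auto
      moreover have "length a \<le> length b" using ab terminal_minimal[OF *(1)] by auto
      ultimately show False using len by simp
    qed
    then have "search_inv u v N (Answer False) 0" using orbit_uv[OF *(2,5)] by simp
    moreover have "c \<le> step_cost ?n N"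
      using snd_same_length_t[of a b] compare_no(3) *(6) by (simp add: step_cost_def)
    moreover have "0 < m" using * by simp
    ultimately show ?thesis using compare_no(2) by blast
  next
    case (compare_eq a b)
    then have *: "terminal a" "same_orbit u a" "length a \<le> length u"
     "terminal b" "same_orbit v b" "length b \<le> length v" "2 * N + 2 \<le> m" using assms(2) by auto
    have len: "length b = length a" using fst_same_length_t[of a b] compare_eq(3) by simp
    have "branch [(a, None)] a [a]" by (rule branch_root) simp
    moreover have "wf_tree a [(a, None)]" by (rule wf_root)
    moreover have "1 \<le> N" using N[OF *(1,3) wf_root] by simp
    ultimately have "search_inv u v N (Search a b [(a, None)] a) (2 * N)"
      using * len by (auto intro!: exI[of _ "[a]"])
    moreover have "c \<le> step_cost ?n N"
      using snd_same_length_t[of a b] compare_eq(3) *(6) by (simp add: step_cost_def)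
    moreover have "2 * N < m" using * by simp
    ultimately show ?thesis using compare_eq(2) by blast
  next
    case (extend \<phi>s a T w w' b)
    then obtain ws where *: "terminal a" "same_orbit u a" "length a \<le> length u"
     "terminal b" "same_orbit v b" "length b = length a"
     "wf_tree a T" "branch T w ws" "\<forall>t\<in>nodes T - set ws. explored T t"
       "2 * (N - length T) + length ws + 1 \<le> m" using assms(2) by auto
    have w: "w \<in> nodes T" using branch_node[OF *(8)] .
    have T: "length T \<le> N" using N * by blast
    from new[OF extend(3,4) _ _ _ T] node[OF *(1,7) w] * have
      1: "c \<le> ?W * (9 * ?n + N * (?n + 2) + 4) + 1" "lev w w'" "w' \<notin> nodes T" by auto
    let ?T = "(w', Some w) # T"
    have wf: "wf_tree a ?T" using wf_node[OF *(7) 1(3) w 1(2)] .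
    have br: "branch ?T w' (w' # ws)"
      by (rule branch_step[OF _ branch_extend[OF *(8) 1(3)]]) simp
    have ex: "\<forall>t\<in>nodes ?T - set (w' # ws). explored ?T t"
      using *(9) by (auto simp: explored_def)
    have "search_inv u v N (Search a b ?T w') (2 * (N - length ?T) + length (w' # ws) + 1)"
      unfolding search_inv.simps by (intro conjI exI[of _ "w' # ws"] order_refl *(1-6) wf br ex)
    moreover have "2 * (N - length ?T) + length (w' # ws) + 1 < m"
      using N[OF *(1,3) wf] *(10) by simp
    moreover have "c \<le> step_cost ?n N" using 1 by (simp add: step_cost_def)
    ultimately show ?thesis using extend(2) by blast
  next
    case (backtrack \<phi>s a T w c' w' d b)
    then obtain ws where *: "terminal a" "same_orbit u a" "length a \<le> length u"
     "terminal b" "same_orbit v b" "length b = length a"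
     "wf_tree a T" "branch T w ws" "\<forall>t\<in>nodes T - set ws. explored T t"
       "2 * (N - length T) + length ws + 1 \<le> m" using assms(2) by auto
    have w: "w \<in> nodes T" using branch_node[OF *(8)] .
    have T: "length T \<le> N" using N * by blast
    note nw = node[OF *(1,7) w]
    from new[OF backtrack(4,5) _ _ _ T] nw * have
      1: "c' \<le> ?W * (9 * ?n + N * (?n + 2) + 4) + 1" "explored T w" by auto
    have "d \<le> N * (?n + 2) + 1" using preceding[OF backtrack(6) _ T] nw *(3) by simp
    then have cost: "c \<le> step_cost ?n N" using 1 backtrack(2) by (simp add: step_cost_def)
    have "map_of T w = Some (Some w')"
      using fst_preceding_t[of w T] backtrack(6) by (auto split: option.splits)
    then obtain ws' where ws: "ws = w # ws'" "branch T w' ws'"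
      using *(8) by (auto elim: branch.cases)
    have ex: "\<forall>t\<in>nodes T - set ws'. explored T t" using *(9) 1(2) ws by auto
    have "search_inv u v N (Search a b T w') (2 * (N - length T) + length ws' + 1)"
      unfolding search_inv.simps by (intro conjI exI[of _ ws'] order_refl *(1-7) ws(2) ex)
    moreover have "2 * (N - length T) + length ws' + 1 < m" using *(10) ws by simp
    ultimately show ?thesis using cost backtrack(3) by blast
  next
    case (search_done \<phi>s a T w c' d b)
    then obtain ws where *: "terminal a" "same_orbit u a" "length a \<le> length u"
     "terminal b" "same_orbit v b" "length b = length a"
     "wf_tree a T" "branch T w ws" "\<forall>t\<in>nodes T - set ws. explored T t"
       "2 * (N - length T) + length ws + 1 \<le> m" using assms(2) by auto
    have w: "w \<in> nodes T" using branch_node[OF *(8)] .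
    have T: "length T \<le> N" using N * by blast
    note nw = node[OF *(1,7) w]
    from new[OF search_done(4,5) _ _ _ T] nw * have
      1: "c' \<le> ?W * (9 * ?n + N * (?n + 2) + 4) + 1" "explored T w" by auto
    have "d \<le> N * (?n + 2) + 1" using preceding[OF search_done(6) _ T] nw *(3) by simp
    then have cost: "c \<le> step_cost ?n N" using 1 search_done(2) by (simp add: step_cost_def)
    have "map_of T w = None \<or> map_of T w = Some None"
      using fst_preceding_t[of w T] search_done(6) by (auto split: option.splits)
    then have ws: "ws = [w]" using *(8) by (auto elim: branch.cases)
    have ex: "explored T t" if "t \<in> nodes T" for t using *(9) 1(2) ws that by auto
    have "t \<in> nodes T" if "lev\<^sup>*\<^sup>* a t" for t
      using that
    proof (induction rule: rtranclp_induct)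
      case base
      show ?case using wf_tree_root[OF *(7)] .
    next
      case (step s t)
      then show ?case using ex unfolding explored_def by blast
    qed
    then have nodes: "nodes T = {w. lev\<^sup>*\<^sup>* a w}" using wf_tree_lev[OF *(7)] by blast
    have "search_inv u v N (Check b T) 1"
      unfolding search_inv.simps by (intro conjI exI[of _ a] order_refl *(1-7) nodes)
    moreover have "1 < m" using *(10) ws by simp
    ultimately show ?thesis using cost search_done(3) by blast
  next
    case (check b T r)
    then obtain a where *: "terminal a" "same_orbit u a" "length a \<le> length u"
     "terminal b" "same_orbit v b" "length b = length a" "wf_tree a T"
     "nodes T = {w. lev\<^sup>*\<^sup>* a w}" "1 \<le> m" using assms(2) by auto
    have T: "length T \<le> N" using N * by blast
    have red: "reduced a" "reduced b" using * by (auto simp: terminal_def)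
    have "r \<longleftrightarrow> lev\<^sup>*\<^sup>* a b" using fst_recorded_t[of b T] check(3) *(8) by simp
    also have "\<dots> \<longleftrightarrow> same_orbit a b"
      using lev_iso[of a b] terminal_connected[OF *(1)] *(6) by auto
    also have "\<dots> \<longleftrightarrow> same_orbit u v" using orbit_uv[OF *(2,5)] by simp
    finally have "search_inv u v N (Answer r) 0" by simp
    moreover have "c \<le> step_cost ?n N"
    proof -
      have "c \<le> length T * (length b + 2) + 1" using snd_recorded_t[of b T] check(3) by simp
      also have "\<dots> \<le> N * (?n + 2) + 1" using T *(3,6) by (intro add_mono mult_mono) auto
      also have "\<dots> \<le> step_cost ?n N" by (simp add: step_cost_def)
      finally show ?thesis .
    qed
    moreover have "0 < m" using * by simp
    ultimately show ?thesis using check(2) by blast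
  qed
qed

lemma terminates_within_measure:
  assumes "\<And>s c s' m. I s m \<Longrightarrow> step s c s' \<Longrightarrow> c \<le> C \<and> (\<exists>m'<m. I s' m')"
  shows "I s m \<Longrightarrow> C * m \<le> t \<Longrightarrow> terminates_within s t"
proof (induction m arbitrary: s t rule: less_induct)
  case (less m)
  from step_exists[of s] show ?case
  proof
    assume "\<exists>b. s = Answer b"
    then obtain b where "s = Answer b" ..
    then show ?thesis by (simp only: answered)
  next
    assume ex: "\<exists>c s'. step s c s'"
    show ?thesis
    proof (rule transition[OF ex])
      fix c s' assume st: "step s c s'"
      from assms[OF less.prems(1) st] obtain m' where c: "c \<le> C" and m': "m' < m" "I s' m'" by blast
      have "C * Suc m' \<le> C * m" using m'(1) by (intro mult_le_mono2) simp
      then have "C * m' + c \<le> t" using c less.prems(2) by simp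
      then have "c \<le> t" "C * m' \<le> t - c" by simp_all
      then show "c \<le> t \<and> terminates_within s' (t - c)" using less.IH[OF m'] by blast
    qed
  qed
qed

lemma run_invariant:
  assumes "\<And>s c s' m. I s m \<Longrightarrow> step s c s' \<Longrightarrow> \<exists>m'. I s' m'"
  shows "run s c s' \<Longrightarrow> I s m \<Longrightarrow> \<exists>m'. I s' m'"
proof (induction rule: run.induct)
  case (run_step s c s' d s'')
  then obtain m' where "I s' m'" by blast
  from assms[OF this run_step.hyps(2)] show ?case .
qed (rule exI)

theorem corollary1p3:
  shows "\<exists>p :: nat poly. \<forall>u \<in> carrier F2. \<forall>v \<in> carrier F2.
    terminates_within (whitehead_algorithm u v) (poly p (max (length u) (length v))) \<and>
    (\<forall>c b. run (whitehead_algorithm u v) c (Answer b) \<longrightarrow>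
      (b \<longleftrightarrow> (\<exists>\<phi> \<in> auto F2. \<phi> u = v)))"
proof -
  obtain K where K: "\<And>a. terminal a \<Longrightarrow> finite {w. lev\<^sup>*\<^sup>* a w} \<and>
      card {w. lev\<^sup>*\<^sup>* a w} \<le> K * (length a + 1) ^ 2"
    using card_lev by blast
  define N where "N n = K * (n + 1) ^ 2" for n
  define x where "x = ([:0, 1:] :: nat poly)"
  define pN where "pN = [:K:] * (x + 1) ^ 2"
  define p where "p = ([:card whitehead_autos:] * ([:9:] * x + pN * (x + [:2:]) + [:4:]) + pN * (x + [:2:]) + x + [:2:])
    * (x + x + [:2:] * pN + [:4:])"
  have p: "poly p n = step_cost n (N n) * (n + n + 2 * N n + 4)" for n
    by (simp add: p_def pN_def x_def step_cost_def N_def algebra_simps)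
  show ?thesis
  proof (intro exI[of _ p] ballI)
    fix u v assume "u \<in> carrier F2" "v \<in> carrier F2"
    then have u: "reduced u" and v: "reduced v" by simp_all
    let ?n = "max (length u) (length v)"
    let ?I = "search_inv u v (N ?n)"
    have tree: "length T \<le> N ?n" if "terminal a" "length a \<le> length u" "wf_tree a T" for a T
    proof -
      have "length T = card (nodes T)" by (rule wf_tree_card[OF that(3)])
      also have "\<dots> \<le> card {w. lev\<^sup>*\<^sup>* a w}"
        using K[OF that(1)] wf_tree_lev[OF that(3)] by (intro card_mono) auto
      also have "\<dots> \<le> K * (length a + 1) ^ 2" using K[OF that(1)] by blast
      also have "\<dots> \<le> N ?n" unfolding N_def using that(2) by (intro mult_mono power_mono) auto
      finally show ?thesis .
    qed
    have step: "c \<le> step_cost ?n (N ?n) \<and> (\<exists>m'<m. ?I s' m')" if "?I s m" "step s c s'" for s c s' m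
      using step_search_inv[OF that(2,1) tree u v] .
    note same_orbit_refl[of u]
    then have init: "?I (whitehead_algorithm u v) (length u + length v + 2 * N ?n + 4)"
      using u by (simp add: whitehead_algorithm_def)
    have le: "step_cost ?n (N ?n) * (length u + length v + 2 * N ?n + 4) \<le> poly p ?n"
      unfolding p by (intro mult_le_mono2 add_mono) auto
    have "terminates_within (whitehead_algorithm u v) (poly p ?n)"
      by (rule terminates_within_measure[where I = ?I, OF step init le])
    moreover have "b \<longleftrightarrow> (\<exists>\<phi>\<in>auto F2. \<phi> u = v)" if "run (whitehead_algorithm u v) c (Answer b)" for c b
    proof -
      have "\<exists>m. ?I (Answer b) m" using run_invariant[of ?I, OF _ that init] step by blast
      then have "b \<longleftrightarrow> same_orbit u v" by simp
      then show ?thesis using iso_auto[OF _ u] auto_F2_iff by auto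
    qed
    ultimately show "terminates_within (whitehead_algorithm u v) (poly p ?n) \<and>
      (\<forall>c b. run (whitehead_algorithm u v) c (Answer b) \<longrightarrow> (b \<longleftrightarrow> (\<exists>\<phi>\<in>auto F2. \<phi> u = v)))" by blast
  qed
qed

end
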